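(* Let $(X,T)$ be a dynamical system which is $K$-closeable with respect to a linkable set $K\subset\mathrm{Per}(T)$. Then for every $\mu\in\mathcal M_T(X)$ the set of points generic for $\mu$ is dense in the measure center $C_M(T)$.
   Context: A dynamical system $(X,T)$ consists of a complete separable metric space $(X,\rho)$ and a continuous surjection $T\colon X\to X$. $\mathcal M_T(X)$ is the set of $T$-invariant Borel probability measures (weak$*$ topology). The measure center $C_M(T)$ is the complement of the union of all open sets $U$ with $\mu(U)=0$ for every $\mu\in\mathcal M_T(X)$. $\mathcal E(x,n)=\frac1n\sum_{j<n}\delta_{T^jx}$; $x$ is generic for $\mu$ if $\mathcal E(x,n)\to\mu$ weak$*$. $B(x,n,\varepsilon)=\{y:\rho(T^jy,T^jx)<\varepsilon,\ 0\le j<n\}$. A point $x$ is $K$-closeable if for every $\varepsilon>0$, $N>0$ there exist integers $N\le p\le q\le(1+\varepsilon)p$ and $y\in B(x,p,\varepsilon)\cap K$ with $T^qy=y$; $(X,T)$ is $K$-closeable if every ergodic measure has a $K$-closeable generic point. $K\subset\mathrm{Per}(T)$ is linkable if for all $y_1,y_2\in K$, $\varepsilon>0$, $\lambda\in[0,1]$ there exist $p_1,p_2,q_1,q_2\in\mathbb N$ and $z\in K$ with: $T^{q_2}z=z$; $\lambda-\varepsilon\le\frac{p_1}{p_1+p_2}\le\lambda+\varepsilon$; $p_1\le q_1\le(1+\varepsilon)p_1$ and $z\in B(y_1,p_1,\varepsilon)$; $p_2\le q_2-q_1\le(1+\varepsilon)p_2$ and $T^{q_1}z\in B(y_2,p_2,\varepsilon)$.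 *)

theory Defs
  imports "HOL-Probability.Probability"
begin

text \<open>The phase space X is the whole type 'a, of class polish_space
  (complete separable metric space).\<close>

definition Borel_prob :: "'a::topological_space measure \<Rightarrow> bool" where
  "Borel_prob M \<longleftrightarrow> sets M = sets borel \<and> prob_space M"

definition invariant_measures :: "('a::topological_space \<Rightarrow> 'a) \<Rightarrow> 'a measure set" where
  "invariant_measures T = {M. Borel_prob M \<and>
      (\<forall>A \<in> sets borel. measure M (T -` A) = measure M A)}"

definition ergodic_measures :: "('a::topological_space \<Rightarrow> 'a) \<Rightarrow> 'a measure set" where
  "ergodic_measures T = {M \<in> invariant_measures T.
      \<forall>A \<in> sets borel. T -` A = A \<longrightarrow> measure M A = 0 \<or> measure M A = 1}"

definition measure_center :: "('a::topological_space \<Rightarrow> 'a) \<Rightarrow> 'a set" where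
  "measure_center T = - \<Union>{U. open U \<and> (\<forall>M \<in> invariant_measures T. measure M U = 0)}"

text \<open>x is generic for mu: the empirical measures E(x,n) converge weak* to mu,
  i.e. integrals of every bounded continuous real function converge.\<close>
definition generic :: "('a::topological_space \<Rightarrow> 'a) \<Rightarrow> 'a measure \<Rightarrow> 'a \<Rightarrow> bool" where
  "generic T M x \<longleftrightarrow>
     (\<forall>f :: 'a \<Rightarrow> real. continuous_on UNIV f \<and> bounded (range f) \<longrightarrow>
        (\<lambda>n. (1 / real n) * (\<Sum>j<n. f ((T ^^ j) x))) \<longlonglongrightarrow> integral\<^sup>L M f)"

definition bowen_ball :: "('a::metric_space \<Rightarrow> 'a) \<Rightarrow> 'a \<Rightarrow> nat \<Rightarrow> real \<Rightarrow> 'a set" where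
  "bowen_ball T x n \<epsilon> = {y. \<forall>j<n. dist ((T ^^ j) y) ((T ^^ j) x) < \<epsilon>}"

definition periodic_points :: "('a \<Rightarrow> 'a) \<Rightarrow> 'a set" where
  "periodic_points T = {x. \<exists>q>0. (T ^^ q) x = x}"

definition K_closeable_point :: "('a::metric_space \<Rightarrow> 'a) \<Rightarrow> 'a set \<Rightarrow> 'a \<Rightarrow> bool" where
  "K_closeable_point T K x \<longleftrightarrow>
     (\<forall>\<epsilon>>0. \<forall>N::nat>0. \<exists>p q :: nat. N \<le> p \<and> p \<le> q \<and> real q \<le> (1 + \<epsilon>) * real p \<and>
        (\<exists>y \<in> bowen_ball T x p \<epsilon> \<inter> K. (T ^^ q) y = y))"

definition K_closeable :: "('a::metric_space \<Rightarrow> 'a) \<Rightarrow> 'a set \<Rightarrow> bool" where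
  "K_closeable T K \<longleftrightarrow>
     (\<forall>M \<in> ergodic_measures T. \<exists>x. generic T M x \<and> K_closeable_point T K x)"

definition linkable :: "('a::metric_space \<Rightarrow> 'a) \<Rightarrow> 'a set \<Rightarrow> bool" where
  "linkable T K \<longleftrightarrow> K \<subseteq> periodic_points T \<and>
     (\<forall>y1 \<in> K. \<forall>y2 \<in> K. \<forall>\<epsilon>>0. \<forall>lam::real. 0 \<le> lam \<and> lam \<le> 1 \<longrightarrow>
        (\<exists>p1 p2 q1 q2 :: nat. \<exists>z \<in> K.
            p1 \<ge> 1 \<and> p2 \<ge> 1 \<and>
            (T ^^ q2) z = z \<and>
            lam - \<epsilon> \<le> real p1 / real (p1 + p2) \<and> real p1 / real (p1 + p2) \<le> lam + \<epsilon> \<and>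
            p1 \<le> q1 \<and> real q1 \<le> (1 + \<epsilon>) * real p1 \<and> z \<in> bowen_ball T y1 p1 \<epsilon> \<and>
            real p2 \<le> real q2 - real q1 \<and> real q2 - real q1 \<le> (1 + \<epsilon>) * real p2 \<and>
            (T ^^ q1) z \<in> bowen_ball T y2 p2 \<epsilon>))"

end

theory Submission
  imports Defs
begin

text \<open>
  Weak convergence is tested on a countable family of bounded uniformly continuous functions. An
  irrational choice of \<open>lam\<close> makes both orbit segments in the definition of linkability long, so
  the periodic averages over \<open>K\<close> of finitely many test functions form an approximately convex
  set. Closeability puts the integrals of every ergodic measure into its closure. For every bounded
  function some ergodic measure has, up to \<open>\<delta>\<close>, at least the integral of a given invariant
  measure \<open>M\<close>; by a descent argument the integrals of \<open>M\<close> then belong to that closure as well.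

  The ergodic measure is obtained without a disintegration: one conditions \<open>M\<close> on a decreasing
  sequence of invariant sets on which the limits of the time averages of all sets of a countable
  generating algebra become constant. A potential keeps a summable family of sets of small measure
  under control along the sequence, and this yields both countable additivity of the limit and its
  ergodicity.

  Finally, starting at a point of \<open>K\<close> whose orbit visits a given open set meeting the measure
  center, one links successively with points of \<open>K\<close> whose averages approximate \<open>M\<close> better and better.
  The first segment of each link is so long that the averages stay close to \<open>M\<close> at all intermediate
  times, and the limit of the linked points is generic for \<open>M\<close>.
\<close>

section \<open>Birkhoff sums along periodic and shadowing orbits\<close>

text \<open>Genericity requires control at every time, whereas a link describes one whole period of
  \<open>z\<close>. This is why both linked points are asked to have averages near the same value
  \<open>a\<close>: the sums of \<open>z\<close> are then controlled from a time \<open>P\<close>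
  on, and \<open>P\<close> is also a time up to which \<open>z\<close> follows the old point, so
  that consecutive stages leave no uncontrolled times. With \<open>lam = 0\<close> the old point has
  a negligible share in the period of \<open>z\<close>; the averages of \<open>z\<close> improve
  although \<open>P\<close> is as large as desired. In a space that is not compact, a limit of
  measures may lose mass. Hence compact subsets and errors of time averages are fixed for
  \<open>M\<close> before conditioning and carried through it by one summable family. The limits of
  time averages are merely Borel functions, about which convergence on the algebra says nothing;
  sets described by finitely many iterates lie in the algebra, and these are what passes to the
  limit.\<close>

definition birkhoff_sum :: "('a \<Rightarrow> 'a) \<Rightarrow> ('a \<Rightarrow> real) \<Rightarrow> 'a \<Rightarrow> nat \<Rightarrow> real" where
  "birkhoff_sum T f x n = (\<Sum>j<n. f ((T ^^ j) x))"

text \<open>Uniform continuity provides one modulus for all points of a shadowed orbit, wherever it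
  runs. The bound 1 normalises the cost of a time step that is not shadowed.\<close>

definition test_function :: "('a::metric_space \<Rightarrow> real) \<Rightarrow> bool" where
  "test_function f \<longleftrightarrow> uniformly_continuous_on UNIV f \<and> (\<forall>x. \<bar>f x\<bar> \<le> 1)"

text \<open>Any positive period serves, since \<open>periodic_average_eq\<close> makes the average
  independent of the choice.\<close>

definition period :: "('a \<Rightarrow> 'a) \<Rightarrow> 'a \<Rightarrow> nat" where
  "period T y = (SOME q. q > 0 \<and> (T ^^ q) y = y)"

definition periodic_average :: "('a \<Rightarrow> 'a) \<Rightarrow> ('a \<Rightarrow> real) \<Rightarrow> 'a \<Rightarrow> real" where
  "periodic_average T f y = birkhoff_sum T f y (period T y) / real (period T y)"

lemma birkhoff_sum_0 [simp]: "birkhoff_sum T f x 0 = 0"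
  by (simp add: birkhoff_sum_def)

lemma birkhoff_sum_add: "birkhoff_sum T f x (m + n) = birkhoff_sum T f x m + birkhoff_sum T f ((T ^^ m) x) n"
proof (induction n)
  case (Suc n)
  have "(T ^^ (m + n)) x = (T ^^ n) ((T ^^ m) x)"
    by (subst add.commute) (simp add: funpow_add)
  then show ?case
    using Suc by (simp add: birkhoff_sum_def)
qed simp

lemma abs_birkhoff_sum_le:
  assumes "\<And>x. \<bar>f x\<bar> \<le> 1"
  shows "\<bar>birkhoff_sum T f x n\<bar> \<le> real n"
proof -
  have "\<bar>birkhoff_sum T f x n\<bar> \<le> (\<Sum>j<n. \<bar>f ((T ^^ j) x)\<bar>)"
    unfolding birkhoff_sum_def by (rule sum_abs)
  also have "\<dots> \<le> (\<Sum>j<n. 1)"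
    by (rule sum_mono) (use assms in auto)
  finally show ?thesis by simp
qed

lemma birkhoff_sum_shadow:
  assumes "\<And>j. j < n \<Longrightarrow> \<bar>f ((T ^^ j) y) - f ((T ^^ j) x)\<bar> \<le> \<omega>"
  shows "\<bar>birkhoff_sum T f y n - birkhoff_sum T f x n\<bar> \<le> \<omega> * real n"
proof -
  have "\<bar>birkhoff_sum T f y n - birkhoff_sum T f x n\<bar> \<le> (\<Sum>j<n. \<bar>f ((T ^^ j) y) - f ((T ^^ j) x)\<bar>)"
    unfolding birkhoff_sum_def sum_subtractf [symmetric] by (rule sum_abs)
  also have "\<dots> \<le> (\<Sum>j<n. \<omega>)"
    by (rule sum_mono) (use assms in auto)
  finally show ?thesis by (simp add: mult.commute)
qed

lemma birkhoff_sum_periodic: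
  assumes "(T ^^ q) x = x"
  shows "birkhoff_sum T f x (k * q + r) = real k * birkhoff_sum T f x q + birkhoff_sum T f x r"
proof (induction k)
  case (Suc k)
  have "birkhoff_sum T f x (Suc k * q + r) = birkhoff_sum T f x (q + (k * q + r))"
    by (simp add: add.assoc)
  also have "\<dots> = birkhoff_sum T f x q + birkhoff_sum T f x (k * q + r)"
    using assms by (simp add: birkhoff_sum_add)
  finally show ?case
    using Suc by (simp add: algebra_simps)
qed simp

lemma period:
  assumes "x \<in> periodic_points T"
  shows period_pos: "period T x > 0" and funpow_period: "(T ^^ period T x) x = x"
  using someI_ex [of "\<lambda>q. q > 0 \<and> (T ^^ q) x = x"] assms
  by (auto simp: periodic_points_def period_def)

text \<open>The sum over \<open>q * period T x\<close> steps, computed once in blocks of length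
  \<open>q\<close> and once in blocks of length \<open>period T x\<close>.\<close>

lemma periodic_average_eq:
  assumes "(T ^^ q) x = x" "q > 0"
  shows "periodic_average T f x = birkhoff_sum T f x q / real q"
proof -
  define r where "r = period T x"
  have x: "x \<in> periodic_points T"
    using assms by (auto simp: periodic_points_def)
  have r: "r > 0" "(T ^^ r) x = x"
    using period [OF x] by (auto simp: r_def)
  have "real r * birkhoff_sum T f x q = real q * birkhoff_sum T f x r"
    using birkhoff_sum_periodic [OF assms(1), of f r 0] birkhoff_sum_periodic [OF r(2), of f q 0]
    by (simp add: mult.commute)
  then show ?thesis
    using r assms(2) unfolding periodic_average_def r_def [symmetric] by (simp add: field_simps)
qed

lemma abs_periodic_average_le:
  assumes "x \<in> periodic_points T" "\<And>x. \<bar>f x\<bar> \<le> 1"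
  shows "\<bar>periodic_average T f x\<bar> \<le> 1"
  using abs_birkhoff_sum_le [where f = f and T = T and x = x and n = "period T x", OF assms(2)] period_pos [OF assms(1)]
  by (simp add: periodic_average_def)

text \<open>Full periods contribute an error at rate \<open>\<eta>\<close>. The incomplete last
  period has fewer than \<open>period T x\<close> steps, each costing at most 2 because
  \<open>f\<close> and \<open>a\<close> are bounded by 1.\<close>

lemma birkhoff_sum_deviation_periodic:
  assumes x: "x \<in> periodic_points T" and f: "\<And>x. \<bar>f x\<bar> \<le> 1"
    and a: "\<bar>a\<bar> \<le> 1" and \<eta>: "\<bar>periodic_average T f x - a\<bar> \<le> \<eta>"
  shows "\<bar>birkhoff_sum T f x n - real n * a\<bar> \<le> \<eta> * real n + 2 * real (period T x)"
proof -
  define q where "q = period T x"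
  have q: "q > 0" "(T ^^ q) x = x"
    using period [OF x] by (auto simp: q_def)
  define k r where "k = n div q" and "r = n mod q"
  have n: "n = k * q + r" and r: "r < q"
    using q by (auto simp: k_def r_def)
  have bq: "birkhoff_sum T f x q = real q * periodic_average T f x"
    using periodic_average_eq [OF q(2,1)] q(1) by simp
  have "birkhoff_sum T f x n - real n * a
      = real (k * q) * (periodic_average T f x - a) + (birkhoff_sum T f x r - real r * a)"
    unfolding n birkhoff_sum_periodic [OF q(2)] bq by (simp add: algebra_simps)
  also have "\<bar>\<dots>\<bar> \<le> real (k * q) * \<eta> + 2 * real r"
  proof -
    have "\<bar>real (k * q) * (periodic_average T f x - a)\<bar> \<le> real (k * q) * \<eta>"
      unfolding abs_mult using \<eta> by (intro mult_mono) auto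
    moreover have "\<bar>real r * a\<bar> \<le> real r"
      unfolding abs_mult using a mult_left_le[of "\<bar>a\<bar>" "real r"] by simp
    ultimately show ?thesis
      using abs_birkhoff_sum_le [where f = f and T = T and x = x and n = r, OF f] by linarith
  qed
  also have "\<dots> \<le> \<eta> * real n + 2 * real q"
  proof -
    have "\<eta> * real n = real (k * q) * \<eta> + \<eta> * real r"
      by (simp add: n algebra_simps)
    moreover have "0 \<le> \<eta> * real r" using \<eta> by simp
    ultimately show ?thesis using r by linarith
  qed
  finally show ?thesis by (simp add: q_def)
qed

text \<open>After time \<open>p\<close> the orbit of \<open>z\<close> is free until
  \<open>q\<close>, but these are at most \<open>\<epsilon> * p\<close> steps at a cost of 2 each.
  The bound covers every intermediate \<open>n\<close>, and \<open>C\<close> remains additive, so it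
  can be absorbed later by long times.\<close>

lemma birkhoff_sum_deviation_shadow:
  assumes f: "\<And>x. \<bar>f x\<bar> \<le> 1" and a: "\<bar>a\<bar> \<le> 1" and nonneg: "0 \<le> \<eta>" "0 \<le> \<omega>" "0 \<le> \<epsilon>"
    and sh: "\<And>j. j < p \<Longrightarrow> \<bar>f ((T ^^ j) z) - f ((T ^^ j) y)\<bar> \<le> \<omega>"
    and y: "\<And>n. \<bar>birkhoff_sum T f y n - real n * a\<bar> \<le> \<eta> * real n + C"
    and q: "real q \<le> (1 + \<epsilon>) * real p" and n: "n \<le> q"
  shows "\<bar>birkhoff_sum T f z n - real n * a\<bar> \<le> (\<eta> + \<omega> + 2 * \<epsilon>) * real n + C"
proof -
  define m where "m = min n p"
  define l where "l = n - m"
  have nm: "n = m + l" by (simp add: m_def l_def)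
  have l: "real l \<le> \<epsilon> * real m"
  proof (cases "n \<le> p")
    case False
    then have "real l = real n - real p" "m = p" by (auto simp: l_def m_def)
    then show ?thesis using q n by (simp add: algebra_simps)
  qed (simp add: l_def m_def nonneg)
  have 1: "\<bar>birkhoff_sum T f z m - birkhoff_sum T f y m\<bar> \<le> \<omega> * real m"
    by (rule birkhoff_sum_shadow) (use sh in \<open>auto simp: m_def\<close>)
  have 2: "\<bar>birkhoff_sum T f ((T ^^ m) z) l\<bar> \<le> real l"
    by (rule abs_birkhoff_sum_le [OF f])
  have 3: "\<bar>real l * a\<bar> \<le> real l"
    unfolding abs_mult using a mult_left_le[of "\<bar>a\<bar>" "real l"] by simp
  have "birkhoff_sum T f z n - real n * a = (birkhoff_sum T f z m - birkhoff_sum T f y m) + (birkhoff_sum T f y m - real m * a)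
      + birkhoff_sum T f ((T ^^ m) z) l - real l * a"
    unfolding nm birkhoff_sum_add by (simp add: algebra_simps)
  then have "\<bar>birkhoff_sum T f z n - real n * a\<bar> \<le> \<omega> * real m + (\<eta> * real m + C) + 2 * real l"
    using 1 2 3 y [of m] by linarith
  also have "\<dots> \<le> (\<eta> + \<omega> + 2 * \<epsilon>) * real m + C"
    using l by (simp add: algebra_simps)
  also have "\<dots> \<le> (\<eta> + \<omega> + 2 * \<epsilon>) * real n + C"
    using nonneg by (intro add_right_mono mult_left_mono) (auto simp: m_def)
  finally show ?thesis .
qed

text \<open>Linkability itself does not force the shadowing times to be long. Perturbing
  \<open>lam\<close> to an irrational number does, as fractions with bounded denominator stay away from it.\<close>

lemma fractions_near_irrational:
  fixes lam :: real
  assumes lam: "0 < lam" "lam < 1" "lam \<notin> \<rat>"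
  obtains \<epsilon> where "\<epsilon> > 0" and
    "\<And>p1 p2 :: nat. p1 \<ge> 1 \<Longrightarrow> p2 \<ge> 1 \<Longrightarrow> \<bar>real p1 / real (p1 + p2) - lam\<bar> \<le> \<epsilon> \<Longrightarrow> N \<le> p1 \<and> N \<le> p2"
proof -
  \<comment> \<open>Halving leaves room: a fraction within \<open>b\<close> of \<open>lam\<close> is
    still at distance at least \<open>b\<close> from 0 and from 1, so each of \<open>p1\<close> and
    \<open>p2\<close> has at least the share \<open>b\<close> of \<open>p1 + p2\<close>.\<close>
  define b where "b = min lam (1 - lam) / 2"
  have b: "b > 0" using lam by (simp add: b_def)
  obtain L :: nat where L: "real N / b \<le> real L" using real_arch_simple by blast
  define S where "S = (\<lambda>(p1, p2). real p1 / real (p1 + p2)) ` ({..L} \<times> {..L :: nat})"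
  have "finite S" by (simp add: S_def)
  then obtain d where d: "d > 0" "\<And>x. x \<in> S \<Longrightarrow> x \<noteq> lam \<Longrightarrow> d \<le> dist lam x"
    using finite_set_avoid [of S lam] by blast
  have notin: "lam \<notin> S"
    using lam(3) by (auto simp: S_def)
  define \<epsilon> where "\<epsilon> = min (d / 2) b"
  show ?thesis
  proof (rule that)
    show "\<epsilon> > 0" using d b by (simp add: \<epsilon>_def)
    fix p1 p2 :: nat
    assume p: "p1 \<ge> 1" "p2 \<ge> 1" and near: "\<bar>real p1 / real (p1 + p2) - lam\<bar> \<le> \<epsilon>"
    have pos: "real (p1 + p2) > 0" using p by simp
    have "real p1 / real (p1 + p2) \<notin> S"
    proof
      assume "real p1 / real (p1 + p2) \<in> S"
      then have "d \<le> dist lam (real p1 / real (p1 + p2))"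
        using d(2) notin by metis
      then show False
        using near d(1) unfolding dist_real_def \<epsilon>_def by linarith
    qed
    then have "(p1, p2) \<notin> {..L} \<times> {..L}"
      unfolding S_def by (metis (no_types, lifting) case_prod_conv image_eqI)
    then have "L \<le> p1 + p2" by auto
    then have "real N / b \<le> real (p1 + p2)"
      using L by linarith
    then have N: "real N \<le> b * real (p1 + p2)"
      using b by (simp only: pos_divide_le_eq mult.commute)
    have "2 * b \<le> lam" "2 * b \<le> 1 - lam" by (auto simp: b_def)
    then have "b \<le> real p1 / real (p1 + p2)" "b \<le> 1 - real p1 / real (p1 + p2)"
      using near by (auto simp: \<epsilon>_def)
    moreover have "1 - real p1 / real (p1 + p2) = real p2 / real (p1 + p2)"
      using pos by (simp add: field_simps)
    ultimately have "b * real (p1 + p2) \<le> real p1" "b * real (p1 + p2) \<le> real p2"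
      using pos by (simp_all add: pos_le_divide_eq)
    then show "N \<le> p1 \<and> N \<le> p2" using N by linarith
  qed
qed

text \<open>The endpoints of the range of \<open>lam\<close> are the point here: for
  \<open>lam = 0\<close> the first segment has an arbitrarily small share of the total, yet it is
  still at least \<open>N\<close> long.\<close>

lemma linkable_long:
  assumes K: "linkable T K" and y: "y1 \<in> K" "y2 \<in> K" and \<epsilon>: "\<epsilon> > 0" and lam: "0 \<le> lam" "lam \<le> 1"
  obtains p1 p2 q1 q2 z where "z \<in> K" "N \<le> p1" "N \<le> p2" "p1 \<ge> 1" "p2 \<ge> 1" "(T ^^ q2) z = z"
    "\<bar>real p1 / real (p1 + p2) - lam\<bar> \<le> \<epsilon>"
    "p1 \<le> q1" "real q1 \<le> (1 + \<epsilon>) * real p1" "z \<in> bowen_ball T y1 p1 \<epsilon>"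
    "q1 + p2 \<le> q2" "real (q2 - q1) \<le> (1 + \<epsilon>) * real p2" "(T ^^ q1) z \<in> bowen_ball T y2 p2 \<epsilon>"
proof -
  have "max 0 (lam - \<epsilon> / 2) < min 1 (lam + \<epsilon> / 2)"
    using \<epsilon> lam by auto
  then obtain lam' where l: "lam' \<in> {max 0 (lam - \<epsilon> / 2)<..<min 1 (lam + \<epsilon> / 2)}" "lam' \<notin> \<rat>"
    using real_interval_avoid_countable_set [of _ _ "\<rat>"] countable_rat by blast
  then have l': "0 < lam'" "lam' < 1" "\<bar>lam' - lam\<bar> \<le> \<epsilon> / 2"
    unfolding abs_le_iff by auto
  obtain \<delta> where \<delta>: "\<delta> > 0" and
    big: "\<And>p1 p2 :: nat. p1 \<ge> 1 \<Longrightarrow> p2 \<ge> 1 \<Longrightarrow> \<bar>real p1 / real (p1 + p2) - lam'\<bar> \<le> \<delta> \<Longrightarrow> N \<le> p1 \<and> N \<le> p2"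
    using fractions_near_irrational [OF l'(1,2) l(2)] by metis
  \<comment> \<open>The bound \<open>\<delta>\<close> makes the segments long;
    \<open>\<epsilon> / 2\<close> is what remains of the precision after moving \<open>lam\<close>
    to \<open>lam'\<close>.\<close>
  define e where "e = min \<delta> (\<epsilon> / 2)"
  have e: "e > 0" "e \<le> \<delta>" "e \<le> \<epsilon> / 2" using \<delta> \<epsilon> by (auto simp: e_def)
  from K y e(1) l'(1,2) obtain p1 p2 q1 q2 z where
    z: "z \<in> K" "p1 \<ge> 1" "p2 \<ge> 1" "(T ^^ q2) z = z"
    "lam' - e \<le> real p1 / real (p1 + p2)" "real p1 / real (p1 + p2) \<le> lam' + e"
    "p1 \<le> q1" "real q1 \<le> (1 + e) * real p1" "z \<in> bowen_ball T y1 p1 e"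
    "real p2 \<le> real q2 - real q1" "real q2 - real q1 \<le> (1 + e) * real p2"
    "(T ^^ q1) z \<in> bowen_ball T y2 p2 e"
    unfolding linkable_def by (metis less_imp_le)
  have eps: "(1 + e) * real p \<le> (1 + \<epsilon>) * real p" for p
    using e \<epsilon> by (intro mult_right_mono) auto
  have sub: "bowen_ball T y p e \<subseteq> bowen_ball T y p \<epsilon>" for y p
    using e \<epsilon> unfolding bowen_ball_def by fastforce
  have q2: "q1 + p2 \<le> q2" using z(10) by linarith
  have near: "\<bar>real p1 / real (p1 + p2) - lam'\<bar> \<le> e" using z(5,6) by linarith
  show ?thesis
  proof (rule that [of z p1 p2 q2 q1])
    show "N \<le> p1" "N \<le> p2" using big [OF z(2,3)] near e by auto
    show "\<bar>real p1 / real (p1 + p2) - lam\<bar> \<le> \<epsilon>" using near e l'(3) by linarith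
    show "real q1 \<le> (1 + \<epsilon>) * real p1" using z(8) eps [of p1] by linarith
    show "real (q2 - q1) \<le> (1 + \<epsilon>) * real p2" using z(11) eps [of p2] q2 by (simp add: of_nat_diff)
  qed (use z q2 sub in auto)
qed

section \<open>Averages along linked orbits\<close>

lemma finite_test_functions_modulus:
  fixes F :: "('a::metric_space \<Rightarrow> real) set"
  assumes "finite F" "\<And>f. f \<in> F \<Longrightarrow> test_function f" "\<omega> > 0"
  obtains \<epsilon> where "\<epsilon> > 0" "\<And>f x y. f \<in> F \<Longrightarrow> dist x y < \<epsilon> \<Longrightarrow> \<bar>f x - f y\<bar> \<le> \<omega>"
proof -
  have "\<exists>\<epsilon>>0. \<forall>f\<in>F. \<forall>x y. dist x y < \<epsilon> \<longrightarrow> \<bar>f x - f y\<bar> \<le> \<omega>"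
    using assms(1,2)
  proof (induction F)
    case empty
    show ?case by (auto intro: exI [of _ 1])
  next
    case (insert f F)
    obtain e1 where e1: "e1 > 0" "\<forall>f\<in>F. \<forall>x y. dist x y < e1 \<longrightarrow> \<bar>f x - f y\<bar> \<le> \<omega>"
      using insert by auto
    obtain e2 where e2: "e2 > 0" "\<forall>x y. dist y x < e2 \<longrightarrow> dist (f y) (f x) < \<omega>"
      using insert.prems [of f] \<open>\<omega> > 0\<close> unfolding test_function_def uniformly_continuous_on_def by auto
    show ?case
    proof (intro exI [of _ "min e1 e2"] conjI ballI allI impI)
      fix h and x y :: 'a
      assume h: "h \<in> insert f F" and xy: "dist x y < min e1 e2"
      show "\<bar>h x - h y\<bar> \<le> \<omega>"
      proof (cases "h = f")
        case True
        have "dist (f x) (f y) < \<omega>" using e2(2) xy by simp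
        then show ?thesis using True by (simp add: dist_real_def)
      next
        case False
        then show ?thesis using e1(2) h xy by simp
      qed
    qed (use e1 e2 in simp)
  qed
  then show ?thesis using that by blast
qed

text \<open>The unshadowed gaps are a small fraction of the period, so the average of
  \<open>z\<close> is nearly the convex combination. If both averages are near \<open>a\<close>,
  adding the two segments controls all times within a period, and periodicity all later ones.
  \<open>P\<close> is the length of the first segment and serves both for shadowing
  \<open>y1\<close> and as the start of this control.\<close>

lemma linkable_periodic_average:
  assumes K: "linkable T K" and y: "y1 \<in> K" "y2 \<in> K" and \<omega>: "\<omega> > 0" and lam: "0 \<le> lam" "lam \<le> 1"
    and F: "finite F" "\<And>f. f \<in> F \<Longrightarrow> test_function f"
  obtains z P where "z \<in> K" "N \<le> P" "z \<in> bowen_ball T y1 P \<omega>"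
    and "\<And>f. f \<in> F \<Longrightarrow>
      \<bar>periodic_average T f z - (lam * periodic_average T f y1 + (1 - lam) * periodic_average T f y2)\<bar> \<le> \<omega>"
    and "\<And>f a \<eta> n. f \<in> F \<Longrightarrow> \<bar>a\<bar> \<le> 1 \<Longrightarrow> \<bar>periodic_average T f y1 - a\<bar> \<le> \<eta> \<Longrightarrow>
      \<bar>periodic_average T f y2 - a\<bar> \<le> \<eta> \<Longrightarrow> P \<le> n \<Longrightarrow> \<bar>birkhoff_sum T f z n - real n * a\<bar> \<le> (\<eta> + \<omega>) * real n"
proof -
  define C1 C2 where "C1 = 2 * real (period T y1)" and "C2 = 2 * real (period T y2)"
  have C: "0 \<le> C1" "0 \<le> C2" by (simp_all add: C1_def C2_def)
  \<comment> \<open>Any time of at least \<open>L\<close> steps absorbs the fixed costs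
    \<open>C1\<close> and \<open>C2\<close> of incomplete periods at the rate
    \<open>\<omega> / 8\<close>.\<close>
  obtain L :: nat where L: "(C1 + C2) / (\<omega> / 8) \<le> real L" using real_arch_simple by blast
  obtain e0 where e0: "e0 > 0" "\<And>f x y. f \<in> F \<Longrightarrow> dist x y < e0 \<Longrightarrow> \<bar>f x - f y\<bar> \<le> \<omega> / 8"
    using finite_test_functions_modulus [OF F, of "\<omega> / 8"] \<omega> by auto
  define \<epsilon> where "\<epsilon> = min (min e0 1) (\<omega> / 16)"
  have \<epsilon>: "\<epsilon> > 0" "\<epsilon> \<le> e0" "\<epsilon> \<le> \<omega> / 16" "\<epsilon> \<le> 1" using e0 \<omega> by (auto simp: \<epsilon>_def)
  obtain p1 p2 q1 q2 z where z: "z \<in> K" "max N L \<le> p1" "max N L \<le> p2" "p1 \<ge> 1" "p2 \<ge> 1" "(T ^^ q2) z = z"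
    and ratio: "\<bar>real p1 / real (p1 + p2) - lam\<bar> \<le> \<epsilon>"
    and q1: "p1 \<le> q1" "real q1 \<le> (1 + \<epsilon>) * real p1" and sh1: "z \<in> bowen_ball T y1 p1 \<epsilon>"
    and q2: "q1 + p2 \<le> q2" "real (q2 - q1) \<le> (1 + \<epsilon>) * real p2"
    and sh2: "(T ^^ q1) z \<in> bowen_ball T y2 p2 \<epsilon>"
    using linkable_long [OF K y \<epsilon>(1) lam, of "max N L"] by metis
  have per: "y1 \<in> periodic_points T" "y2 \<in> periodic_points T"
    using K y unfolding linkable_def by auto
  have q2pos: "q2 > 0" using z q2 by linarith
  have sh1': "\<bar>f ((T ^^ j) z) - f ((T ^^ j) y1)\<bar> \<le> \<omega> / 8" if "f \<in> F" "j < p1" for f j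
    using sh1 that \<epsilon>(2) by (intro e0(2)) (auto simp: bowen_ball_def intro: less_le_trans)
  have sh2': "\<bar>f ((T ^^ j) ((T ^^ q1) z)) - f ((T ^^ j) y2)\<bar> \<le> \<omega> / 8" if "f \<in> F" "j < p2" for f j
    using sh2 that \<epsilon>(2) by (intro e0(2)) (auto simp: bowen_ball_def intro: less_le_trans)
  have CL: "C1 + C2 \<le> \<omega> / 8 * real m" if "L \<le> m" for m
  proof -
    have "(C1 + C2) / (\<omega> / 8) \<le> real m" using L that by linarith
    moreover have "\<omega> / 8 > 0" using \<omega> by simp
    ultimately show ?thesis by (simp only: pos_divide_le_eq mult.commute)
  qed
  have first: "\<bar>birkhoff_sum T f z n - real n * a\<bar> \<le> (\<eta> + \<omega> / 4) * real n + C1"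
    if f: "f \<in> F" and a: "\<bar>a\<bar> \<le> 1" and \<eta>: "\<bar>periodic_average T f y1 - a\<bar> \<le> \<eta>" and n: "n \<le> q1" for f a \<eta> n
  proof -
    have f1: "\<And>x. \<bar>f x\<bar> \<le> 1" using F f by (auto simp: test_function_def)
    have "\<bar>birkhoff_sum T f z n - real n * a\<bar> \<le> (\<eta> + \<omega> / 8 + 2 * \<epsilon>) * real n + C1"
      using \<eta> \<omega> \<epsilon> sh1' f q1 n birkhoff_sum_deviation_periodic [OF per(1) f1 a \<eta>]
      by (intro birkhoff_sum_deviation_shadow [where y = y1 and p = p1 and q = q1, OF f1 a]) (auto simp: C1_def)
    also have "\<dots> \<le> (\<eta> + \<omega> / 4) * real n + C1"
      using \<epsilon> by (intro add_right_mono mult_right_mono) auto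
    finally show ?thesis .
  qed
  have second: "\<bar>birkhoff_sum T f ((T ^^ q1) z) n - real n * a\<bar> \<le> (\<eta> + \<omega> / 4) * real n + C2"
    if f: "f \<in> F" and a: "\<bar>a\<bar> \<le> 1" and \<eta>: "\<bar>periodic_average T f y2 - a\<bar> \<le> \<eta>" and n: "n \<le> q2 - q1" for f a \<eta> n
  proof -
    have f1: "\<And>x. \<bar>f x\<bar> \<le> 1" using F f by (auto simp: test_function_def)
    have "\<bar>birkhoff_sum T f ((T ^^ q1) z) n - real n * a\<bar> \<le> (\<eta> + \<omega> / 8 + 2 * \<epsilon>) * real n + C2"
      using \<eta> \<omega> \<epsilon> sh2' f q2 n birkhoff_sum_deviation_periodic [OF per(2) f1 a \<eta>]
      by (intro birkhoff_sum_deviation_shadow [where y = y2 and p = p2 and q = "q2 - q1", OF f1 a]) (auto simp: C2_def)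
    also have "\<dots> \<le> (\<eta> + \<omega> / 4) * real n + C2"
      using \<epsilon> by (intro add_right_mono mult_right_mono) auto
    finally show ?thesis .
  qed
  show ?thesis
  proof (rule that [of z p1])
    show "z \<in> bowen_ball T y1 p1 \<omega>"
      using sh1 \<epsilon> \<omega> unfolding bowen_ball_def by fastforce
  next
    fix f assume f: "f \<in> F"
    define a1 a2 where "a1 = periodic_average T f y1" and "a2 = periodic_average T f y2"
    have a: "\<bar>a1\<bar> \<le> 1" "\<bar>a2\<bar> \<le> 1"
      using abs_periodic_average_le [OF per(1), of f] abs_periodic_average_le [OF per(2), of f] F(2) [OF f]
      by (auto simp: a1_def a2_def test_function_def)
    define r where "r = q2 - q1"
    have q2r: "q2 = q1 + r" using q2 by (simp add: r_def)
    have "\<bar>birkhoff_sum T f z q1 - real q1 * a1\<bar> \<le> \<omega> / 4 * real q1 + C1"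
      using first [OF f a(1), of 0 q1] by (simp add: a1_def)
    moreover have "\<bar>birkhoff_sum T f ((T ^^ q1) z) r - real r * a2\<bar> \<le> \<omega> / 4 * real r + C2"
      using second [OF f a(2), of 0 r] by (simp add: a2_def r_def)
    ultimately have 1: "\<bar>birkhoff_sum T f z q2 - (real q1 * a1 + real r * a2)\<bar> \<le> \<omega> / 4 * real q2 + (C1 + C2)"
      unfolding q2r birkhoff_sum_add of_nat_add ring_distribs by linarith
    also have "\<dots> \<le> 3 * \<omega> / 8 * real q2"
      using CL [of q2] z q1 q2 by simp
    finally have 1: "\<bar>birkhoff_sum T f z q2 - (real q1 * a1 + real r * a2)\<bar> \<le> 3 * \<omega> / 8 * real q2" .
    define t where "t = real q1 / real q2"
    have "real r = real q2 - real q1" by (simp add: q2r)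
    then have tr: "real r / real q2 = 1 - t" using q2pos by (simp add: t_def diff_divide_distrib)
    have "periodic_average T f z - (t * a1 + (1 - t) * a2)
        = (birkhoff_sum T f z q2 - (real q1 * a1 + real r * a2)) / real q2"
      unfolding periodic_average_eq [OF z(6) q2pos] tr [symmetric] unfolding t_def
      by (simp add: diff_divide_distrib add_divide_distrib)
    also have "\<bar>\<dots>\<bar> \<le> 3 * \<omega> / 8"
      using 1 q2pos by (simp add: divide_le_eq)
    finally have 2: "\<bar>periodic_average T f z - (t * a1 + (1 - t) * a2)\<bar> \<le> 3 * \<omega> / 8" .
    \<comment> \<open>Linkability controls \<open>p1 / (p1 + p2)\<close>, while the averages are
      weighted by \<open>q1 / q2\<close>. Numerator and denominator each grow by a factor between 1
      and \<open>1 + \<epsilon>\<close>, which moves the ratio by at most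
      \<open>\<epsilon>\<close>.\<close>
    have 3: "\<bar>t - lam\<bar> \<le> 2 * \<epsilon>"
    proof -
      define s where "s = real p1 / real (p1 + p2)"
      have s: "0 \<le> s" "s \<le> 1" by (auto simp: s_def divide_le_eq)
      define W where "W = real (p1 + p2)"
      have W: "W > 0" using z by (simp add: W_def)
      have p1s: "real p1 = s * W" using W by (simp add: s_def W_def)
      have q2u: "real q2 \<le> (1 + \<epsilon>) * W"
        using q1 q2 by (simp add: W_def of_nat_diff algebra_simps)
      have q2l: "W \<le> real q2" unfolding W_def using q1 q2 by linarith
      have "real q1 \<le> (1 + \<epsilon>) * s * real q2"
      proof -
        have "real q1 \<le> (1 + \<epsilon>) * s * W" using q1(2) p1s by (simp add: mult.assoc)
        also have "\<dots> \<le> (1 + \<epsilon>) * s * real q2" using q2l s \<epsilon> by (intro mult_left_mono) auto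
        finally show ?thesis .
      qed
      then have "t \<le> (1 + \<epsilon>) * s" using q2pos by (simp add: t_def divide_le_eq)
      also have "\<dots> \<le> s + \<epsilon>" using s \<epsilon> by (simp add: algebra_simps mult_left_le)
      finally have u: "t \<le> s + \<epsilon>" .
      have "s * real q2 \<le> (1 + \<epsilon>) * real p1"
        using mult_left_mono [OF q2u s(1)] p1s by (simp add: algebra_simps)
      also have "\<dots> \<le> (1 + \<epsilon>) * real q1" using q1 \<epsilon> by (intro mult_left_mono) auto
      finally have "s \<le> (1 + \<epsilon>) * t" using q2pos by (simp add: t_def le_divide_eq)
      also have "\<dots> \<le> t + \<epsilon>"
        using \<epsilon> q2 q2pos by (simp add: algebra_simps t_def mult_left_le divide_le_eq)
      finally have "s \<le> t + \<epsilon>" .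
      then show ?thesis using u ratio unfolding s_def [symmetric] by linarith
    qed
    have "\<bar>(t - lam) * (a1 - a2)\<bar> \<le> 2 * \<epsilon> * 2"
      unfolding abs_mult using 3 a \<epsilon> by (intro mult_mono) auto
    moreover have "t * a1 + (1 - t) * a2 - (lam * a1 + (1 - lam) * a2) = (t - lam) * (a1 - a2)"
      by (simp add: algebra_simps)
    ultimately show "\<bar>periodic_average T f z - (lam * periodic_average T f y1 + (1 - lam) * periodic_average T f y2)\<bar> \<le> \<omega>"
      using 2 \<epsilon>(3) \<omega> unfolding a1_def [symmetric] a2_def [symmetric] by linarith
  next
    fix f a \<eta> n
    assume f: "f \<in> F" and a: "\<bar>a\<bar> \<le> 1" and \<eta>: "\<bar>periodic_average T f y1 - a\<bar> \<le> \<eta>"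
      "\<bar>periodic_average T f y2 - a\<bar> \<le> \<eta>" and n: "p1 \<le> n"
    have one: "\<bar>birkhoff_sum T f z m - real m * a\<bar> \<le> (\<eta> + \<omega> / 4) * real m + (C1 + C2)" if m: "m \<le> q2" for m
    proof (cases "m \<le> q1")
      case True
      then show ?thesis using first [OF f a \<eta>(1) True] C by linarith
    next
      case False
      define r where "r = m - q1"
      have mr: "m = q1 + r" using False by (simp add: r_def)
      have "\<bar>birkhoff_sum T f z q1 - real q1 * a\<bar> \<le> (\<eta> + \<omega> / 4) * real q1 + C1"
        by (rule first [OF f a \<eta>(1)]) simp
      moreover have "\<bar>birkhoff_sum T f ((T ^^ q1) z) r - real r * a\<bar> \<le> (\<eta> + \<omega> / 4) * real r + C2"
        by (rule second [OF f a \<eta>(2)]) (use m in \<open>simp add: r_def\<close>)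
      ultimately show ?thesis
        unfolding mr birkhoff_sum_add of_nat_add ring_distribs by linarith
    qed
    define k r where "k = n div q2" and "r = n mod q2"
    have nk: "n = k * q2 + r" and r: "r < q2" using q2pos by (auto simp: k_def r_def)
    \<comment> \<open>Every passage through a period of \<open>z\<close> costs
      \<open>C1 + C2\<close> again. The full passages are paid for by their length
      \<open>q2\<close>, the incomplete last one by \<open>n\<close>.\<close>
    have q2C: "C1 + C2 \<le> \<omega> / 8 * real q2" and nC: "C1 + C2 \<le> \<omega> / 8 * real n"
      using CL z q1 q2 n by simp_all
    have "\<bar>birkhoff_sum T f z q2 - real q2 * a\<bar> \<le> (\<eta> + 3 * \<omega> / 8) * real q2"
      using one [of q2] q2C by (simp add: algebra_simps)
    then have "\<bar>real k * (birkhoff_sum T f z q2 - real q2 * a)\<bar> \<le> real k * ((\<eta> + 3 * \<omega> / 8) * real q2)"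
      unfolding abs_mult by (intro mult_mono) auto
    moreover have "birkhoff_sum T f z n - real n * a = real k * (birkhoff_sum T f z q2 - real q2 * a) + (birkhoff_sum T f z r - real r * a)"
      unfolding nk birkhoff_sum_periodic [OF z(6)] by (simp add: algebra_simps)
    moreover have "\<bar>birkhoff_sum T f z r - real r * a\<bar> \<le> (\<eta> + \<omega> / 4) * real r + (C1 + C2)"
      using one r by simp
    moreover have "(\<eta> + \<omega> / 4) * real r \<le> (\<eta> + 3 * \<omega> / 8) * real r"
      using \<omega> by (intro mult_right_mono) auto
    ultimately have "\<bar>birkhoff_sum T f z n - real n * a\<bar>
        \<le> real k * ((\<eta> + 3 * \<omega> / 8) * real q2) + (\<eta> + 3 * \<omega> / 8) * real r + \<omega> / 8 * real n"
      using nC by linarith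
    also have "\<dots> = (\<eta> + \<omega> / 2) * real n" by (simp add: nk algebra_simps)
    also have "\<dots> \<le> (\<eta> + \<omega>) * real n" using \<omega> by (intro mult_right_mono) auto
    finally show "\<bar>birkhoff_sum T f z n - real n * a\<bar> \<le> (\<eta> + \<omega>) * real n" .
  qed (use z in auto)
qed

section \<open>Integrals of test functions and periodic orbits from closing\<close>

lemma test_function_integrable:
  assumes M: "Borel_prob M" and f: "test_function f"
  shows "integrable M f" and "\<bar>integral\<^sup>L M f\<bar> \<le> 1"
proof -
  interpret prob_space M using M by (simp add: Borel_prob_def)
  have [measurable_cong]: "sets M = sets borel" using M by (simp add: Borel_prob_def)
  have f1: "\<And>x. \<bar>f x\<bar> \<le> 1" and [measurable]: "f \<in> borel_measurable borel"
    using f by (auto simp: test_function_def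
        intro!: borel_measurable_continuous_onI uniformly_continuous_imp_continuous)
  show int: "integrable M f"
    by (rule integrable_const_bound [of _ 1]) (use f1 in auto)
  have "\<bar>integral\<^sup>L M f\<bar> \<le> integral\<^sup>L M (\<lambda>x. \<bar>f x\<bar>)"
    by (rule integral_abs_bound)
  also have "\<dots> \<le> integral\<^sup>L M (\<lambda>x. 1)"
    by (rule integral_mono) (use int f1 in auto)
  finally show "\<bar>integral\<^sup>L M f\<bar> \<le> 1" by (simp add: prob_space)
qed

text \<open>Four errors of \<open>\<delta> / 4\<close> per step: shadowing the generic point, the
  distance of its averages from the integrals, and the gap between \<open>p\<close> and
  \<open>q\<close>, which enters once through \<open>f\<close> and once through the integral. The
  closing time \<open>q\<close> may be any multiple of the least period.\<close>

lemma closeable_periodic_average: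
  assumes close: "K_closeable T K" and M: "M \<in> ergodic_measures T"
    and F: "finite F" "\<And>f. f \<in> F \<Longrightarrow> test_function f" and \<delta>: "\<delta> > 0"
  obtains y where "y \<in> K" "\<And>f. f \<in> F \<Longrightarrow> \<bar>periodic_average T f y - integral\<^sup>L M f\<bar> \<le> \<delta>"
proof -
  have BM: "Borel_prob M"
    using M by (auto simp: ergodic_measures_def invariant_measures_def)
  obtain x where x: "generic T M x" "K_closeable_point T K x"
    using close M by (auto simp: K_closeable_def)
  have "\<forall>\<^sub>F n in sequentially. \<bar>birkhoff_sum T f x n - real n * integral\<^sup>L M f\<bar> \<le> \<delta> / 4 * real n" if f: "f \<in> F" for f
  proof -
    have "continuous_on UNIV f" "bounded (range f)"
      using F(2) [OF f] by (auto simp: test_function_def bounded_iff intro: uniformly_continuous_imp_continuous)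
    then have "(\<lambda>n. (1 / real n) * birkhoff_sum T f x n) \<longlonglongrightarrow> integral\<^sup>L M f"
      using x(1) by (simp add: generic_def birkhoff_sum_def)
    then have "\<forall>\<^sub>F n in sequentially. dist ((1 / real n) * birkhoff_sum T f x n) (integral\<^sup>L M f) < \<delta> / 4"
      by (rule tendstoD) (use \<delta> in simp)
    then show ?thesis
      using eventually_gt_at_top [of 0]
    proof eventually_elim
      case (elim n)
      have "birkhoff_sum T f x n - real n * integral\<^sup>L M f = real n * ((1 / real n) * birkhoff_sum T f x n - integral\<^sup>L M f)"
        using elim by (simp add: field_simps)
      also have "\<bar>\<dots>\<bar> \<le> real n * (\<delta> / 4)"
        unfolding abs_mult using elim by (intro mult_mono) (auto simp: dist_real_def)
      finally show ?case by (simp add: mult.commute)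
    qed
  qed
  then have "\<forall>\<^sub>F n in sequentially. \<forall>f\<in>F. \<bar>birkhoff_sum T f x n - real n * integral\<^sup>L M f\<bar> \<le> \<delta> / 4 * real n"
    using F(1) by (intro eventually_ball_finite) auto
  then obtain N0 where N0: "\<And>n f. N0 \<le> n \<Longrightarrow> f \<in> F \<Longrightarrow> \<bar>birkhoff_sum T f x n - real n * integral\<^sup>L M f\<bar> \<le> \<delta> / 4 * real n"
    by (auto simp: eventually_sequentially)
  obtain e0 where e0: "e0 > 0" "\<And>f x y. f \<in> F \<Longrightarrow> dist x y < e0 \<Longrightarrow> \<bar>f x - f y\<bar> \<le> \<delta> / 4"
    using finite_test_functions_modulus [OF F, of "\<delta> / 4"] \<delta> by auto
  define \<epsilon> where "\<epsilon> = min e0 (\<delta> / 4)"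
  have \<epsilon>: "\<epsilon> > 0" "\<epsilon> \<le> e0" "\<epsilon> \<le> \<delta> / 4" using e0 \<delta> by (auto simp: \<epsilon>_def)
  have "max N0 1 > 0" by simp
  then obtain p q y where pq: "max N0 1 \<le> p" "p \<le> q" "real q \<le> (1 + \<epsilon>) * real p"
    and y: "y \<in> bowen_ball T x p \<epsilon>" "y \<in> K" "(T ^^ q) y = y"
    using x(2) \<epsilon>(1) unfolding K_closeable_point_def by (metis IntE)
  show ?thesis
  proof (rule that [OF y(2)])
    fix f assume f: "f \<in> F"
    have f1: "\<And>x. \<bar>f x\<bar> \<le> 1" using F f by (auto simp: test_function_def)
    define a where "a = integral\<^sup>L M f"
    have a: "\<bar>a\<bar> \<le> 1" using test_function_integrable [OF BM F(2) [OF f]] by (simp add: a_def)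
    define r where "r = q - p"
    have q: "q = p + r" using pq by (simp add: r_def)
    have 1: "\<bar>birkhoff_sum T f y p - birkhoff_sum T f x p\<bar> \<le> \<delta> / 4 * real p"
      using y(1) \<epsilon> f by (intro birkhoff_sum_shadow e0(2)) (auto simp: bowen_ball_def intro: less_le_trans)
    have 2: "\<bar>birkhoff_sum T f x p - real p * a\<bar> \<le> \<delta> / 4 * real p"
      using N0 pq f by (simp add: a_def)
    have 3: "\<bar>birkhoff_sum T f ((T ^^ p) y) r\<bar> \<le> real r" by (rule abs_birkhoff_sum_le [OF f1])
    have 4: "\<bar>real r * a\<bar> \<le> real r"
      unfolding abs_mult using a mult_left_le[of "\<bar>a\<bar>" "real r"] by simp
    have "real r \<le> \<epsilon> * real p" using pq(3) by (simp add: q algebra_simps)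
    also have "\<dots> \<le> \<delta> / 4 * real p" using \<epsilon> by (intro mult_right_mono) auto
    finally have 5: "real r \<le> \<delta> / 4 * real p" .
    have "birkhoff_sum T f y q - real q * a = (birkhoff_sum T f y p - birkhoff_sum T f x p) + (birkhoff_sum T f x p - real p * a)
        + birkhoff_sum T f ((T ^^ p) y) r - real r * a"
      unfolding q birkhoff_sum_add by (simp add: algebra_simps)
    then have "\<bar>birkhoff_sum T f y q - real q * a\<bar> \<le> \<delta> * real p"
      using 1 2 3 4 5 by linarith
    also have "\<dots> \<le> \<delta> * real q" using pq \<delta> by (intro mult_left_mono) auto
    finally have 6: "\<bar>birkhoff_sum T f y q - real q * a\<bar> \<le> \<delta> * real q" .
    have q0: "q > 0" using pq by linarith
    have "periodic_average T f y - a = (birkhoff_sum T f y q - real q * a) / real q"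
      unfolding periodic_average_eq [OF y(3) q0] using q0 by (simp add: field_simps)
    also have "\<bar>\<dots>\<bar> \<le> \<delta>" using 6 q0 by (simp add: divide_le_eq)
    finally show "\<bar>periodic_average T f y - integral\<^sup>L M f\<bar> \<le> \<delta>" by (simp add: a_def)
  qed
qed

section \<open>A convergence-determining sequence of test functions\<close>

lemma test_function_max:
  fixes f g :: "'a::metric_space \<Rightarrow> real"
  assumes "test_function f" "test_function g"
  shows "test_function (\<lambda>x. max (f x) (g x))"
proof -
  have "uniformly_continuous_on UNIV (\<lambda>x. max (f x) (g x))"
    unfolding uniformly_continuous_on_def
  proof (intro allI impI)
    fix e :: real assume e: "e > 0"
    obtain d1 where d1: "d1 > 0" "\<forall>x y. dist y x < d1 \<longrightarrow> dist (f y) (f x) < e"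
      using assms(1) e unfolding test_function_def uniformly_continuous_on_def by auto
    obtain d2 where d2: "d2 > 0" "\<forall>x y. dist y x < d2 \<longrightarrow> dist (g y) (g x) < e"
      using assms(2) e unfolding test_function_def uniformly_continuous_on_def by auto
    show "\<exists>d>0. \<forall>x\<in>UNIV. \<forall>y\<in>UNIV. dist y x < d \<longrightarrow> dist (max (f y) (g y)) (max (f x) (g x)) < e"
    proof (intro exI [of _ "min d1 d2"] conjI ballI impI)
      fix x y :: 'a assume "dist y x < min d1 d2"
      then have "dist (f y) (f x) < e" "dist (g y) (g x) < e" using d1 d2 by auto
      then show "dist (max (f y) (g y)) (max (f x) (g x)) < e"
        unfolding dist_real_def by linarith
    qed (use d1 d2 in auto)
  qed
  moreover have "\<bar>max (f x) (g x)\<bar> \<le> 1" for x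
    using assms unfolding test_function_def by (smt (verit, best))
  ultimately show ?thesis by (simp add: test_function_def)
qed

lemma test_function_cone:
  fixes a :: "'a::metric_space"
  assumes "h \<le> 1" "0 \<le> c"
  shows "test_function (\<lambda>x. max 0 (h - c * dist x a))"
proof -
  have "uniformly_continuous_on UNIV (\<lambda>x. max 0 (h - c * dist x a))"
    unfolding uniformly_continuous_on_def
  proof (intro allI impI)
    fix e :: real assume e: "e > 0"
    show "\<exists>d>0. \<forall>x\<in>UNIV. \<forall>y\<in>UNIV. dist y x < d \<longrightarrow> dist (max 0 (h - c * dist y a)) (max 0 (h - c * dist x a)) < e"
    proof (intro exI [of _ "e / (c + 1)"] conjI ballI impI)
      fix x y :: 'a assume d: "dist y x < e / (c + 1)"
      have "\<bar>dist y a - dist x a\<bar> \<le> dist y x"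
        using dist_triangle [of y a x] dist_triangle [of x a y] by (simp add: dist_commute)
      then have "\<bar>c * dist y a - c * dist x a\<bar> \<le> c * dist y x"
        unfolding right_diff_distrib [symmetric] abs_mult using assms by (simp add: mult_left_mono)
      also have "\<dots> \<le> (c + 1) * dist y x" by (simp add: algebra_simps)
      also have "\<dots> < e" using d assms by (simp add: field_simps)
      finally show "dist (max 0 (h - c * dist y a)) (max 0 (h - c * dist x a)) < e"
        unfolding dist_real_def by linarith
    qed (use e assms in auto)
  qed
  moreover have "\<bar>max 0 (h - c * dist x a)\<bar> \<le> 1" for x
    using assms(1) mult_nonneg_nonneg [OF assms(2) zero_le_dist, of x a] by linarith
  ultimately show ?thesis by (simp add: test_function_def)
qed

text \<open>The height \<open>h\<close> lies just below \<open>f x\<close>, and the slope is steep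
  enough for the cone to vanish outside a ball on which \<open>f\<close> exceeds \<open>h\<close>.
  Centre, height and slope come from countable sets, so one countable family serves all
  \<open>f\<close>.\<close>

lemma cone_below_continuous:
  fixes f :: "'a::metric_space \<Rightarrow> real"
  assumes f: "continuous_on UNIV f" "\<And>x. 0 \<le> f x" "\<And>x. f x \<le> 1"
    and D: "\<And>U :: 'a set. open U \<Longrightarrow> U \<noteq> {} \<Longrightarrow> \<exists>d\<in>D. d \<in> U" and e: "e > 0"
  shows "\<exists>a\<in>D. \<exists>h\<in>\<rat>. \<exists>k::nat. h \<le> 1 \<and> (\<forall>y. max 0 (h - real k * dist y a) \<le> f y)
    \<and> f x - e < max 0 (h - real k * dist x a)"
proof -
  obtain h where h: "h \<in> \<rat>" "f x - e / 2 < h" "h < f x"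
    using Rats_dense_in_real [of "f x - e / 2" "f x"] e by auto
  have "\<exists>r>0. \<forall>y. dist y x < r \<longrightarrow> dist (f y) (f x) < f x - h"
    using f(1) h(3) unfolding continuous_on_iff by (metis UNIV_I diff_gt_0_iff_gt)
  then obtain r where r: "r > 0" "\<And>y. dist y x < r \<Longrightarrow> dist (f y) (f x) < f x - h" by blast
  obtain k :: nat where k: "2 / r < real k" using reals_Archimedean2 by blast
  have k0: "real k > 0" using k r by (smt (verit) divide_pos_pos)
  \<comment> \<open>With \<open>r / 2\<close>, points outside the ball are at least
    \<open>r / 2\<close> away from the vertex, where a slope above \<open>2 / r\<close> has used up
    a height of 1. With \<open>e / (2 * real k)\<close>, moving the vertex off \<open>x\<close>
    costs at most \<open>e / 2\<close> there; the other half of \<open>e\<close> went into the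
    choice of \<open>h\<close>.\<close>
  define s where "s = min (r / 2) (e / (2 * real k))"
  have s: "s > 0" using r e k0 by (simp add: s_def)
  obtain a where a: "a \<in> D" "dist x a < s"
    using D [of "ball x s"] s by auto
  have h1: "h \<le> 1" using h(3) f(3) [of x] by linarith
  show ?thesis
  proof (intro bexI [OF _ a(1)] bexI [OF _ h(1)] exI [of _ k] conjI allI h1)
    fix y
    show "max 0 (h - real k * dist y a) \<le> f y"
    proof (cases "dist y x < r")
      case True
      then have "h < f y" using r(2) [OF True] by (simp add: dist_real_def abs_less_iff)
      moreover have "0 \<le> real k * dist y a" by simp
      ultimately show ?thesis using f(2) [of y] by linarith
    next
      case False
      then have "r / 2 \<le> dist y a"
        using dist_triangle [of y x a] a(2) by (simp add: dist_commute s_def)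
      then have "real k * (r / 2) \<le> real k * dist y a" using k0 by (intro mult_left_mono) auto
      moreover have "1 \<le> real k * (r / 2)" using k r by (simp add: field_simps)
      ultimately show ?thesis using h1 f(2) [of y] by linarith
    qed
  next
    have "real k * dist x a \<le> real k * (e / (2 * real k))"
      using a(2) k0 by (intro mult_left_mono) (auto simp: s_def)
    also have "\<dots> = e / 2" using k0 by simp
    finally show "f x - e < max 0 (h - real k * dist x a)" using h(2) by linarith
  qed
qed

text \<open>Lists of indices form a countable type, so all finite maxima can be enumerated. The
  value 0 of the empty list is harmless, as only nonnegative functions are approximated from
  below.\<close>

primrec max_list :: "(nat \<Rightarrow> 'a \<Rightarrow> real) \<Rightarrow> nat list \<Rightarrow> 'a \<Rightarrow> real" where
  "max_list b [] x = 0"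
| "max_list b (i # l) x = max (b i x) (max_list b l x)"

lemma max_list_upper: "i \<in> set l \<Longrightarrow> b i x \<le> max_list b l x"
  by (induction l) auto

lemma max_list_least: "(\<And>i. i \<in> set l \<Longrightarrow> b i x \<le> c) \<Longrightarrow> 0 \<le> c \<Longrightarrow> max_list b l x \<le> c"
  by (induction l) auto

lemma test_function_max_list:
  assumes "\<And>i. test_function (b i)"
  shows "test_function (max_list b l)"
proof (induction l)
  case Nil
  have "max_list b [] = (\<lambda>x. 0)" by auto
  then show ?case by (simp add: test_function_def uniformly_continuous_on_const)
next
  case (Cons i l)
  have "max_list b (i # l) = (\<lambda>x. max (b i x) (max_list b l x))" by auto
  then show ?case using test_function_max [OF assms Cons.IH, of i] by simp
qed

text \<open>Every continuous function with values in \<open>[0, 1]\<close> is the increasing limit of finite maxima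
  of cones below it, so convergence on these maxima yields lower semicontinuity for the function
  and, applied to its complement, convergence.\<close>

lemma convergence_determining_test_functions:
  obtains \<psi> :: "nat \<Rightarrow> 'a::polish_space \<Rightarrow> real" where "\<And>k. test_function (\<psi> k)"
    and "\<And>T M x. Borel_prob M \<Longrightarrow>
      (\<And>k. (\<lambda>n. birkhoff_sum T (\<psi> k) x n / real n) \<longlonglongrightarrow> integral\<^sup>L M (\<psi> k)) \<Longrightarrow> generic T M x"
proof -
  obtain D :: "'a set" where D: "countable D" "\<And>U. open U \<Longrightarrow> U \<noteq> {} \<Longrightarrow> \<exists>d\<in>D. d \<in> U"
    using countable_dense_setE by blast
  define J where "J = D \<times> (\<rat> \<inter> {..1::real}) \<times> (UNIV :: nat set)"
  have cJ: "countable J" by (simp add: J_def D countable_rat)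
  have neJ: "J \<noteq> {}" using D(2) [of UNIV] by (auto simp: J_def intro: exI [of _ 0])
  define cone where "cone = (\<lambda>(a::'a, h, k::nat) x. max 0 (h - real k * dist x a))"
  define b where "b i = cone (from_nat_into J i)" for i
  have tb: "test_function (b i)" for i
    using from_nat_into [OF neJ, of i] by (auto simp: b_def cone_def J_def intro!: test_function_cone)
  define \<psi> where "\<psi> k = max_list b (from_nat k)" for k
  have t\<psi>: "test_function (max_list b l)" for l
    by (rule test_function_max_list [OF tb])
  show ?thesis
  proof (rule that [of \<psi>])
    show "test_function (\<psi> k)" for k by (simp add: \<psi>_def t\<psi>)
  next
    fix T :: "'a \<Rightarrow> 'a" and M x
    assume M: "Borel_prob M"
      and conv: "\<And>k. (\<lambda>n. birkhoff_sum T (\<psi> k) x n / real n) \<longlonglongrightarrow> integral\<^sup>L M (\<psi> k)"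
    interpret prob_space M using M by (simp add: Borel_prob_def)
    have [measurable_cong]: "sets M = sets borel" using M by (simp add: Borel_prob_def)
    have conv': "(\<lambda>n. birkhoff_sum T (max_list b l) x n / real n) \<longlonglongrightarrow> integral\<^sup>L M (max_list b l)" for l
      using conv [of "to_nat l"] by (simp add: \<psi>_def)
    have lower: "\<forall>\<^sub>F n in sequentially. integral\<^sup>L M f - e < birkhoff_sum T f x n / real n"
      if f: "continuous_on UNIV f" "\<And>x. 0 \<le> f x" "\<And>x. f x \<le> 1" and e: "e > 0" for f :: "'a \<Rightarrow> real" and e
    proof -
      define l where "l n = filter (\<lambda>i. \<forall>y. b i y \<le> f y) [0..<n]" for n
      have le: "max_list b (l n) y \<le> f y" for n y
        by (rule max_list_least) (auto simp: l_def f)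
      have fm: "f \<in> borel_measurable borel" using f(1) by (rule borel_measurable_continuous_onI)
      have lim: "(\<lambda>n. max_list b (l n) y) \<longlonglongrightarrow> f y" for y
      proof (rule LIMSEQ_I)
        fix r :: real assume r: "r > 0"
        obtain a h k where ahk: "a \<in> D" "h \<in> \<rat>" "h \<le> 1" "\<forall>z. max 0 (h - real k * dist z a) \<le> f z"
          "f y - r < max 0 (h - real k * dist y a)"
          using cone_below_continuous [OF f D(2) r, of y] by auto
        have "(a, h, k) \<in> J" using ahk by (simp add: J_def)
        then obtain i where i: "from_nat_into J i = (a, h, k)"
          using from_nat_into_surj [OF cJ] by blast
        have bi: "\<forall>z. b i z \<le> f z" "f y - r < b i y"
          using ahk by (auto simp: b_def i cone_def)
        show "\<exists>no. \<forall>n\<ge>no. norm (max_list b (l n) y - f y) < r"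
        proof (intro exI [of _ "Suc i"] allI impI)
          fix n assume "Suc i \<le> n"
          then have "i \<in> set (l n)" using bi(1) by (simp add: l_def)
          then have "b i y \<le> max_list b (l n) y" by (rule max_list_upper)
          then show "norm (max_list b (l n) y - f y) < r"
            using bi(2) le [of n y] by simp
        qed
      qed
      have "(\<lambda>n. integral\<^sup>L M (max_list b (l n))) \<longlonglongrightarrow> integral\<^sup>L M f"
      proof (rule integral_dominated_convergence [where w = "\<lambda>_. 1"])
        show "f \<in> borel_measurable M" using fm by simp
        show "max_list b (l n) \<in> borel_measurable M" for n
          using test_function_integrable(1) [OF M t\<psi>] by (rule borel_measurable_integrable)
        show "AE y in M. norm (max_list b (l n) y) \<le> 1" for n
          using t\<psi> [of "l n"] by (simp add: test_function_def)
      qed (use lim in auto)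
      then have "\<forall>\<^sub>F n in sequentially. integral\<^sup>L M f - e < integral\<^sup>L M (max_list b (l n))"
        using e by (intro order_tendstoD(1)) auto
      then obtain m where m: "integral\<^sup>L M f - e < integral\<^sup>L M (max_list b (l m))"
        by (auto simp: eventually_sequentially)
      have "\<forall>\<^sub>F n in sequentially. integral\<^sup>L M f - e < birkhoff_sum T (max_list b (l m)) x n / real n"
        by (rule order_tendstoD(1) [OF conv' m])
      then show ?thesis
      proof eventually_elim
        case (elim n)
        have "birkhoff_sum T (max_list b (l m)) x n \<le> birkhoff_sum T f x n"
          unfolding birkhoff_sum_def by (intro sum_mono le)
        then have "birkhoff_sum T (max_list b (l m)) x n / real n \<le> birkhoff_sum T f x n / real n"
          by (simp add: divide_right_mono)
        then show ?case using elim by linarith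
      qed
    qed
    show "generic T M x"
      unfolding generic_def
    proof (intro allI impI)
      fix f :: "'a \<Rightarrow> real"
      assume f: "continuous_on UNIV f \<and> bounded (range f)"
      then obtain B where B: "\<And>y. \<bar>f y\<bar> \<le> B" by (auto simp: bounded_iff)
      define c where "c = \<bar>B\<bar> + 1"
      have c: "c > 0" "\<And>y. \<bar>f y\<bar> \<le> c" using order_trans [OF B, of c] by (auto simp: c_def)
      have fm: "f \<in> borel_measurable M"
        using borel_measurable_continuous_onI [of f] f by simp
      have fi: "integrable M f"
        by (rule integrable_const_bound [of _ c]) (use c fm in auto)
      \<comment> \<open>The one-sided estimate is applied to \<open>f\<close> and to
        \<open>-f\<close>, both rescaled affinely into [0, 1]; the signs \<open>s = 1\<close> and
        \<open>s = -1\<close> give the two halves of the limit.\<close>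
      have half: "\<forall>\<^sub>F n in sequentially. s * integral\<^sup>L M f - e < s * (birkhoff_sum T f x n / real n)"
        if s: "\<bar>s\<bar> = 1" and e: "e > 0" for s e :: real
      proof -
        define g where "g y = (c + s * f y) / (2 * c)" for y
        have sf: "\<bar>s * f y\<bar> \<le> c" for y using c s by (simp add: abs_mult)
        have g: "continuous_on UNIV g" "\<And>y. 0 \<le> g y" "\<And>y. g y \<le> 1"
          using f c(1) sf unfolding g_def abs_le_iff
          by (auto intro!: continuous_intros divide_nonneg_pos simp: divide_le_eq) (smt (verit, best))+
        have ig: "integral\<^sup>L M g = (c + s * integral\<^sup>L M f) / (2 * c)"
          unfolding g_def using fi by (simp add: prob_space)
        have "\<forall>\<^sub>F n in sequentially. integral\<^sup>L M g - e / (2 * c) < birkhoff_sum T g x n / real n"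
          by (rule lower [OF g]) (use e c in auto)
        then show ?thesis using eventually_gt_at_top [of 0]
        proof eventually_elim
          case (elim n)
          have "birkhoff_sum T g x n = (real n * c + s * birkhoff_sum T f x n) / (2 * c)"
            unfolding birkhoff_sum_def g_def
            by (simp add: sum_divide_distrib [symmetric] sum.distrib sum_distrib_left)
          then have "birkhoff_sum T g x n / real n = (c + s * (birkhoff_sum T f x n / real n)) / (2 * c)"
            using elim(2) by (simp add: field_simps)
          then have "(c + s * integral\<^sup>L M f - e) / (2 * c) < (c + s * (birkhoff_sum T f x n / real n)) / (2 * c)"
            using elim(1) ig by (simp add: diff_divide_distrib)
          then show ?case using c(1) by (simp add: divide_less_cancel)
        qed
      qed
      have "(\<lambda>n. birkhoff_sum T f x n / real n) \<longlonglongrightarrow> integral\<^sup>L M f"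
      proof (rule tendstoI)
        fix e :: real assume e: "e > 0"
        show "\<forall>\<^sub>F n in sequentially. dist (birkhoff_sum T f x n / real n) (integral\<^sup>L M f) < e"
          using half [of 1, OF _ e] half [of "-1", OF _ e]
          by (auto simp: dist_real_def elim: eventually_elim2)
      qed
      then show "(\<lambda>n. (1 / real n) * (\<Sum>j<n. f ((T ^^ j) x))) \<longlonglongrightarrow> integral\<^sup>L M f"
        by (simp add: birkhoff_sum_def)
    qed
  qed
qed

section \<open>The mean ergodic theorem\<close>

locale invariant_measure = prob_space M for M :: "'a::topological_space measure" +
  fixes T :: "'a \<Rightarrow> 'a"
  assumes sets_M [measurable_cong]: "sets M = sets borel"
    and measurable_T [measurable]: "T \<in> borel_measurable borel"
    and invariant: "A \<in> sets borel \<Longrightarrow> measure M (T -` A) = measure M A"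
begin

lemma space_M [simp]: "space M = UNIV"
  using sets_eq_imp_space_eq [OF sets_M] by simp

lemma prob_UNIV [simp]: "prob UNIV = 1"
  using prob_space by simp

lemma measurable_funpow [measurable]: "(T ^^ n) \<in> borel_measurable borel"
  by (induction n) (simp_all add: id_def)

lemma borel_vimage: "A \<in> sets borel \<Longrightarrow> T -` A \<in> sets borel"
  using measurable_sets [OF measurable_T] by (simp add: space_borel)

lemma distr_T: "distr M borel T = M"
proof (rule measure_eqI)
  fix A assume "A \<in> sets (distr M borel T)"
  then have A: "A \<in> sets borel" by simp
  then have "emeasure (distr M borel T) A = emeasure M (T -` A)"
    by (simp add: emeasure_distr)
  also have "\<dots> = emeasure M A"
    using invariant [OF A] by (simp add: emeasure_eq_measure)
  finally show "emeasure (distr M borel T) A = emeasure M A" .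
qed (simp add: sets_M)

lemma integral_funpow:
  fixes f :: "'a \<Rightarrow> real"
  assumes [measurable]: "f \<in> borel_measurable borel"
  shows "(\<integral>x. f ((T ^^ n) x) \<partial>M) = integral\<^sup>L M f"
proof (induction n)
  case (Suc n)
  have "(\<integral>x. f ((T ^^ Suc n) x) \<partial>M) = (\<integral>x. f ((T ^^ n) (T x)) \<partial>M)"
    by (simp add: funpow_swap1)
  also have "\<dots> = (\<integral>x. f ((T ^^ n) x) \<partial>distr M borel T)"
    by (subst integral_distr) simp_all
  also have "\<dots> = integral\<^sup>L M f"
    using Suc by (simp add: distr_T)
  finally show ?case .
qed simp

lemma integrable_bounded:
  fixes f :: "'a \<Rightarrow> real"
  assumes "f \<in> borel_measurable borel" "\<And>x. \<bar>f x\<bar> \<le> c"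
  shows "integrable M f"
  by (rule integrable_const_bound [of _ c]) (use assms in auto)

end

section \<open>Comparing time averages of different lengths\<close>

definition time_average :: "('a \<Rightarrow> 'a) \<Rightarrow> ('a \<Rightarrow> real) \<Rightarrow> nat \<Rightarrow> 'a \<Rightarrow> real" where
  "time_average T f n x = birkhoff_sum T f x n / real n"

lemma abs_time_average_le:
  assumes "\<And>x. \<bar>f x\<bar> \<le> 1"
  shows "\<bar>time_average T f n x\<bar> \<le> 1"
  using abs_birkhoff_sum_le [where f = f and T = T and x = x and n = n, OF assms]
  by (auto simp: time_average_def divide_le_eq)

lemma time_average_bounds:
  assumes "\<And>x. 0 \<le> f x" "\<And>x. f x \<le> 1"
  shows "0 \<le> time_average T f n x" "time_average T f n x \<le> 1"
  using abs_time_average_le [of f T n x] assms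
  by (auto simp: time_average_def birkhoff_sum_def sum_nonneg abs_le_iff intro: order_trans)

text \<open>The two windows of length \<open>k\<close> differ in at most \<open>j\<close> terms at
  either end.\<close>

lemma birkhoff_sum_funpow_diff:
  assumes f: "\<And>x. \<bar>f x\<bar> \<le> 1"
  shows "\<bar>birkhoff_sum T f ((T ^^ j) x) k - birkhoff_sum T f x k\<bar> \<le> 2 * real j"
proof -
  have "birkhoff_sum T f x j + birkhoff_sum T f ((T ^^ j) x) k = birkhoff_sum T f x k + birkhoff_sum T f ((T ^^ k) x) j"
    by (metis birkhoff_sum_add add.commute)
  then show ?thesis
    using abs_birkhoff_sum_le [where f = f and T = T and x = x and n = j, OF f]
      abs_birkhoff_sum_le [where f = f and T = T and x = "(T ^^ k) x" and n = j, OF f] by linarith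
qed

text \<open>After exchanging the sums, the iterated average is the mean of the
  \<open>k\<close>-averages started at the first \<open>m\<close> points of the orbit. A long
  average thus hardly notices a preceding short one.\<close>

lemma time_average_time_average_diff:
  assumes f: "\<And>x. \<bar>f x\<bar> \<le> 1" and "m > 0" "k > 0"
  shows "\<bar>time_average T (time_average T f m) k x - time_average T f k x\<bar> \<le> 2 * real m / real k"
proof -
  have comm: "f ((T ^^ j) ((T ^^ i) x)) = f ((T ^^ i) ((T ^^ j) x))" for i j
    by (metis add.commute comp_apply funpow_add)
  have "birkhoff_sum T (time_average T f m) x k = (\<Sum>i<k. \<Sum>j<m. f ((T ^^ j) ((T ^^ i) x)) / real m)"
    by (simp add: birkhoff_sum_def time_average_def sum_divide_distrib)
  also have "\<dots> = (\<Sum>j<m. \<Sum>i<k. f ((T ^^ i) ((T ^^ j) x)) / real m)"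
    by (subst sum.swap) (simp only: comm)
  also have "\<dots> = (\<Sum>j<m. birkhoff_sum T f ((T ^^ j) x) k) / real m"
    by (simp add: birkhoff_sum_def sum_divide_distrib)
  finally have "birkhoff_sum T (time_average T f m) x k - birkhoff_sum T f x k
      = (\<Sum>j<m. birkhoff_sum T f ((T ^^ j) x) k - birkhoff_sum T f x k) / real m"
    using assms by (simp add: sum_subtractf diff_divide_distrib)
  also have "\<bar>\<dots>\<bar> \<le> (\<Sum>j<m. 2 * real m) / real m"
  proof -
    have "\<bar>\<Sum>j<m. birkhoff_sum T f ((T ^^ j) x) k - birkhoff_sum T f x k\<bar> \<le> (\<Sum>j<m. \<bar>birkhoff_sum T f ((T ^^ j) x) k - birkhoff_sum T f x k\<bar>)"
      by (rule sum_abs)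
    also have "\<dots> \<le> (\<Sum>j<m. 2 * real m)"
    proof (rule sum_mono)
      fix j assume "j \<in> {..<m}"
      then show "\<bar>birkhoff_sum T f ((T ^^ j) x) k - birkhoff_sum T f x k\<bar> \<le> 2 * real m"
        using birkhoff_sum_funpow_diff [of f T j x k, OF f] by simp
    qed
    finally show ?thesis unfolding abs_divide abs_of_nat by (rule divide_right_mono) simp
  qed
  also have "\<dots> = 2 * real m" using assms by simp
  finally have *: "\<bar>birkhoff_sum T (time_average T f m) x k - birkhoff_sum T f x k\<bar> \<le> 2 * real m" .
  have "time_average T (time_average T f m) k x - time_average T f k x
      = (birkhoff_sum T (time_average T f m) x k - birkhoff_sum T f x k) / real k"
    by (simp add: time_average_def [of T _ k] diff_divide_distrib)
  then show ?thesis using * assms by (simp add: divide_right_mono)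
qed

context invariant_measure
begin

lemma measurable_time_average [measurable]:
  assumes [measurable]: "f \<in> borel_measurable borel"
  shows "time_average T f n \<in> borel_measurable borel"
  unfolding time_average_def birkhoff_sum_def by measurable

lemma integral_time_average:
  assumes [measurable]: "f \<in> borel_measurable borel" and f: "\<And>x. \<bar>f x\<bar> \<le> c" and n: "n > 0"
  shows "integral\<^sup>L M (time_average T f n) = integral\<^sup>L M f"
proof -
  have "integrable M (\<lambda>x. f ((T ^^ j) x))" for j
    by (rule integrable_bounded [of _ c]) (auto simp: f)
  then have "integral\<^sup>L M (time_average T f n) = (\<Sum>j<n. \<integral>x. f ((T ^^ j) x) \<partial>M) / real n"
    unfolding time_average_def birkhoff_sum_def by simp
  also have "\<dots> = integral\<^sup>L M f"
    using n by (simp add: integral_funpow)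
  finally show ?thesis .
qed

text \<open>Averaging contracts the L2 norm: Cauchy-Schwarz along the orbit, followed by invariance
  of the measure.\<close>

lemma integral_time_average_square_le:
  assumes [measurable]: "h \<in> borel_measurable borel" and h: "\<And>x. \<bar>h x\<bar> \<le> 1" and k: "k > 0"
  shows "(\<integral>x. (time_average T h k x)\<^sup>2 \<partial>M) \<le> (\<integral>x. (h x)\<^sup>2 \<partial>M)"
proof -
  have h2: "\<bar>(h x)\<^sup>2\<bar> \<le> 1" for x using h [of x] by (simp add: abs_square_le_1)
  have "(\<integral>x. (time_average T h k x)\<^sup>2 \<partial>M) \<le> (\<integral>x. time_average T (\<lambda>x. (h x)\<^sup>2) k x \<partial>M)"
  proof (rule integral_mono)
    show "integrable M (\<lambda>x. (time_average T h k x)\<^sup>2)"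
      by (rule integrable_bounded [of _ 1]) (use abs_time_average_le [of h T k, OF h] in \<open>auto simp: abs_square_le_1\<close>)
    show "integrable M (time_average T (\<lambda>x. (h x)\<^sup>2) k)"
      by (rule integrable_bounded [of _ 1]) (use abs_time_average_le [of "\<lambda>x. (h x)\<^sup>2" T k, OF h2] in auto)
    fix x
    have "(birkhoff_sum T h x k)\<^sup>2 \<le> birkhoff_sum T (\<lambda>x. (h x)\<^sup>2) x k * real k"
      unfolding birkhoff_sum_def using sum_squared_le_sum_of_squares [of "\<lambda>j. h ((T ^^ j) x)" "{..<k}"] by simp
    then show "(time_average T h k x)\<^sup>2 \<le> time_average T (\<lambda>x. (h x)\<^sup>2) k x"
      using k by (simp add: time_average_def power_divide divide_le_eq power2_eq_square)
  qed
  also have "\<dots> = (\<integral>x. (h x)\<^sup>2 \<partial>M)"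
    using integral_time_average [of "\<lambda>x. (h x)\<^sup>2" 1 k] h2 k by simp
  finally show ?thesis .
qed

text \<open>Any \<open>h\<close> whose \<open>k\<close>-average resembles that of \<open>f\<close>
  has nearly at least the norm of the latter. In the convergence proof \<open>h\<close> is a shorter
  average of \<open>f\<close> or the midpoint of two of them.\<close>

lemma integral_time_average_square_le_close:
  assumes [measurable]: "f \<in> borel_measurable borel" "h \<in> borel_measurable borel"
    and f: "\<And>x. \<bar>f x\<bar> \<le> 1" and h: "\<And>x. \<bar>h x\<bar> \<le> 1" and k: "k > 0"
    and close: "\<And>x. \<bar>time_average T h k x - time_average T f k x\<bar> \<le> \<epsilon>"
  shows "(\<integral>x. (time_average T f k x)\<^sup>2 \<partial>M) \<le> (\<integral>x. (h x)\<^sup>2 \<partial>M) + 2 * \<epsilon>"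
proof -
  have int: "integrable M (\<lambda>x. (time_average T g k x)\<^sup>2)" if "g \<in> borel_measurable borel" "\<And>x. \<bar>g x\<bar> \<le> 1" for g
    by (rule integrable_bounded [of _ 1]) (use that abs_time_average_le [of g T k] in \<open>auto simp: abs_square_le_1\<close>)
  have "(\<integral>x. (time_average T f k x)\<^sup>2 \<partial>M) \<le> (\<integral>x. (time_average T h k x)\<^sup>2 + 2 * \<epsilon> \<partial>M)"
  proof (rule integral_mono)
    fix x
    let ?a = "time_average T f k x" and ?b = "time_average T h k x"
    have ab: "\<bar>?a\<bar> \<le> 1" "\<bar>?b\<bar> \<le> 1" using abs_time_average_le f h by metis+
    have "?a\<^sup>2 - ?b\<^sup>2 = (?a - ?b) * (?a + ?b)" by (simp add: power2_eq_square algebra_simps)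
    also have "\<dots> \<le> \<bar>?a - ?b\<bar> * \<bar>?a + ?b\<bar>" by (metis abs_ge_self abs_mult)
    also have "\<dots> \<le> \<epsilon> * 2" using close [of x] ab by (intro mult_mono) auto
    finally show "?a\<^sup>2 \<le> ?b\<^sup>2 + 2 * \<epsilon>" by simp
  qed (use int f h in auto)
  also have "\<dots> = (\<integral>x. (time_average T h k x)\<^sup>2 \<partial>M) + 2 * \<epsilon>"
    using int [of h] h by simp
  also have "\<dots> \<le> (\<integral>x. (h x)\<^sup>2 \<partial>M) + 2 * \<epsilon>"
    using integral_time_average_square_le [of h k] h k by simp
  finally show ?thesis .
qed

text \<open>The norms of the averages converge to their infimum
  \<open>d\<close>, midpoints of two averages have norm at least \<open>d\<close>, and the parallelogram law applies.\<close>

lemma time_average_Cauchy_L2: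
  assumes fm [measurable]: "f \<in> borel_measurable borel" and f: "\<And>x. \<bar>f x\<bar> \<le> 1" and \<epsilon>: "\<epsilon> > 0"
  obtains N where "N > 0"
    "\<And>m n. N \<le> m \<Longrightarrow> N \<le> n \<Longrightarrow> (\<integral>x. (time_average T f m x - time_average T f n x)\<^sup>2 \<partial>M) \<le> \<epsilon>"
proof -
  define A where "A = time_average T f"
  have Am [measurable]: "A n \<in> borel_measurable borel" for n by (simp add: A_def)
  have A1: "\<bar>A n x\<bar> \<le> 1" for n x using abs_time_average_le [of f T n x, OF f] by (simp add: A_def)
  define I where "I n = (\<integral>x. (A n x)\<^sup>2 \<partial>M)" for n
  define d where "d = Inf (I ` {0<..})"
  have I0: "0 \<le> I n" for n by (simp add: I_def)
  have bdd: "bdd_below (I ` {0<..})" using I0 by (intro bdd_belowI [of _ 0]) auto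
  have dI: "d \<le> I n" if "n > 0" for n
    unfolding d_def using that by (intro cInf_lower bdd) auto
  \<comment> \<open>The norm of a long average hardly exceeds that of a shorter one, so one nearly
    minimal \<open>m\<close> makes all sufficiently long averages nearly minimal.\<close>
  have comp: "I k \<le> I m + 4 * real m / real k" if "m > 0" "k > 0" for m k
    using integral_time_average_square_le_close [of f "A m" k "2 * real m / real k"]
      time_average_time_average_diff [of f m k T, OF f that] f A1 that
    by (simp add: I_def A_def [symmetric])
  have le_small: "a \<le> b" if "\<And>k::nat. k > 0 \<Longrightarrow> a \<le> b + c / real k" for a b c :: real
  proof (rule tendsto_lowerbound)
    show "(\<lambda>k. b + c / real k) \<longlonglongrightarrow> b"
      by (rule tendsto_eq_intros lim_const_over_n refl | simp)+
    show "\<forall>\<^sub>F k in sequentially. a \<le> b + c / real k"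
      using eventually_gt_at_top [of 0] by eventually_elim (use that in auto)
  qed simp
  \<comment> \<open>The \<open>k\<close>-average of the midpoint is almost the
    \<open>k\<close>-average of \<open>f\<close>, whose squared norm is at least \<open>d\<close>.
    As averaging contracts, the midpoint obeys the same bound up to an error that vanishes as
    \<open>k\<close> grows.\<close>
  have mid: "d \<le> (\<integral>x. ((A m x + A n x) / 2)\<^sup>2 \<partial>M)" if "m > 0" "n > 0" for m n
  proof (rule le_small)
    fix k :: nat assume k: "k > 0"
    have "\<bar>time_average T (\<lambda>x. (A m x + A n x) / 2) k x - time_average T f k x\<bar> \<le> (real m + real n) / real k" for x
    proof -
      have "time_average T (\<lambda>x. (A m x + A n x) / 2) k x = (time_average T (A m) k x + time_average T (A n) k x) / 2"
        by (simp add: time_average_def [of T _ k] birkhoff_sum_def sum.distrib add_divide_distrib sum_divide_distrib [symmetric])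
      moreover have "\<bar>time_average T (A m) k x - time_average T f k x\<bar> \<le> 2 * (real m / real k)"
        "\<bar>time_average T (A n) k x - time_average T f k x\<bar> \<le> 2 * (real n / real k)"
        using time_average_time_average_diff [of f _ k T x, OF f _ k] that by (auto simp: A_def)
      ultimately show ?thesis unfolding add_divide_distrib by linarith
    qed
    moreover have "\<bar>(A m x + A n x) / 2\<bar> \<le> 1" for x using A1 [of m x] A1 [of n x]
      by (auto simp: abs_le_iff)
    ultimately have "I k \<le> (\<integral>x. ((A m x + A n x) / 2)\<^sup>2 \<partial>M) + 2 * ((real m + real n) / real k)"
      unfolding I_def A_def using f k
      by (intro integral_time_average_square_le_close [of f]) (simp_all add: A_def [symmetric])
    then show "d \<le> (\<integral>x. ((A m x + A n x) / 2)\<^sup>2 \<partial>M) + (2 * (real m + real n)) / real k"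
      using dI [OF k] by simp
  qed
  have "d < d + \<epsilon> / 8" using \<epsilon> by simp
  then obtain m where m: "m > 0" "I m < d + \<epsilon> / 8"
    using cInf_lessD [of "I ` {0<..}" "d + \<epsilon> / 8", folded d_def] by auto
  obtain N0 :: nat where N0: "4 * real m / (\<epsilon> / 8) \<le> real N0" using real_arch_simple by blast
  define N where "N = max N0 1"
  \<comment> \<open>The parallelogram law turns this margin into \<open>2 * (d + \<epsilon> / 4) + 2
    * (d + \<epsilon> / 4) - 4 * d = \<epsilon>\<close>.\<close>
  have big: "I k \<le> d + \<epsilon> / 4" if "N \<le> k" for k
  proof -
    have k: "k > 0" using that by (simp add: N_def)
    have "4 * real m / (\<epsilon> / 8) \<le> real k" using N0 that by (simp add: N_def)
    then have "4 * real m / real k \<le> \<epsilon> / 8"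
      using k \<epsilon> by (simp add: field_simps)
    then show ?thesis using comp [OF m(1) k] m(2) by linarith
  qed
  show ?thesis
  proof (rule that [of N])
    show "N > 0" by (simp add: N_def)
    fix i j assume ij: "N \<le> i" "N \<le> j"
    then have pos: "i > 0" "j > 0" by (auto simp: N_def)
    have int: "integrable M (\<lambda>x. (A n x)\<^sup>2)" for n
      by (rule integrable_bounded [of _ 1]) (use A1 in \<open>auto simp: abs_square_le_1\<close>)
    have int2: "integrable M (\<lambda>x. ((A i x + A j x) / 2)\<^sup>2)"
    proof (rule integrable_bounded [of _ 1])
      show "\<bar>((A i x + A j x) / 2)\<^sup>2\<bar> \<le> 1" for x
        using A1 [of i x] A1 [of j x] unfolding abs_power2 abs_square_le_1 by (auto simp: abs_le_iff)
    qed simp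
    have "(\<integral>x. (A i x - A j x)\<^sup>2 \<partial>M) = (\<integral>x. 2 * (A i x)\<^sup>2 + 2 * (A j x)\<^sup>2 - 4 * ((A i x + A j x) / 2)\<^sup>2 \<partial>M)"
      by (intro Bochner_Integration.integral_cong) (auto simp: power2_eq_square field_simps)
    also have "\<dots> = 2 * I i + 2 * I j - 4 * (\<integral>x. ((A i x + A j x) / 2)\<^sup>2 \<partial>M)"
      using int int2 by (simp add: I_def del: power_divide)
    also have "\<dots> \<le> \<epsilon>"
      using big [OF ij(1)] big [OF ij(2)] mid [OF pos] by linarith
    finally show "(\<integral>x. (time_average T f i x - time_average T f j x)\<^sup>2 \<partial>M) \<le> \<epsilon>"
      by (simp add: A_def)
  qed
qed

lemma mean_ergodic_in_measure:
  assumes fm [measurable]: "f \<in> borel_measurable borel" and f: "\<And>x. 0 \<le> f x" "\<And>x. f x \<le> 1"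
  obtains F where "F \<in> borel_measurable borel" "\<And>x. F (T x) = F x" "\<And>x. 0 \<le> F x" "\<And>x. F x \<le> 1"
    "\<And>\<epsilon>. \<epsilon> > 0 \<Longrightarrow> \<exists>m>0. measure M {x. \<epsilon> < \<bar>time_average T f m x - F x\<bar>} \<le> \<epsilon>"
proof -
  have f1: "\<bar>f x\<bar> \<le> 1" for x using f [of x] by simp
  have "\<exists>N>0. \<forall>m\<ge>N. \<forall>n\<ge>N. (\<integral>x. (time_average T f m x - time_average T f n x)\<^sup>2 \<partial>M) \<le> (1/8)^i" for i :: nat
    by (rule time_average_Cauchy_L2 [OF fm f1, of "(1/8)^i"]) auto
  then obtain N where N: "\<And>i. N i > 0"
    "\<And>i m n. N i \<le> m \<Longrightarrow> N i \<le> n \<Longrightarrow> (\<integral>x. (time_average T f m x - time_average T f n x)\<^sup>2 \<partial>M) \<le> (1/8)^i"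
    by metis
  define n where "n i = (\<Sum>j\<le>i. N j)" for i
  have nN: "N i \<le> n i" for i unfolding n_def by (rule member_le_sum) auto
  have ni: "i < n i" for i
  proof (induction i)
    case (Suc i)
    then show ?case using N(1) [of "Suc i"] by (simp add: n_def)
  qed (simp add: n_def N)
  define a where "a i = time_average T f (n i)" for i
  have am [measurable]: "a i \<in> borel_measurable borel" for i by (simp add: a_def)
  have a01: "0 \<le> a i x" "a i x \<le> 1" for i x
    using time_average_bounds [of f T "n i" x] f by (auto simp: a_def)
  \<comment> \<open>Markov's inequality for the squared difference with threshold
    \<open>(1/4)^i\<close> explains the rate \<open>1/8\<close> above:
    \<open>(1/8)^i / (1/4)^i = (1/2)^i\<close> is summable.\<close>
  define bad where "bad i = {x. (1/2)^i < \<bar>a i x - a (Suc i) x\<bar>}" for i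
  have bad_sets [measurable]: "bad i \<in> sets borel" for i unfolding bad_def by measurable
  have bad: "measure M (bad i) \<le> (1/2)^i" for i
  proof -
    have "integrable M (\<lambda>x. (a i x - a (Suc i) x)\<^sup>2)"
    proof (rule integrable_bounded [of _ 1])
      show "\<bar>(a i x - a (Suc i) x)\<^sup>2\<bar> \<le> 1" for x
        using a01 [of i x] a01 [of "Suc i" x] unfolding abs_power2 abs_square_le_1 by (auto simp: abs_le_iff)
    qed simp
    then have "measure M {x \<in> space M. (1/4)^i \<le> (a i x - a (Suc i) x)\<^sup>2} \<le> (\<integral>x. (a i x - a (Suc i) x)\<^sup>2 \<partial>M) / (1/4)^i"
      by (intro integral_Markov_inequality_measure [where A = "{}"]) auto
    also have "\<dots> \<le> (1/8)^i / (1/4)^i"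
      using N(2) [of i "n i" "n (Suc i)"] nN [of i] by (intro divide_right_mono) (auto simp: a_def n_def)
    also have "\<dots> = (1/2)^i" by (simp flip: power_divide)
    finally have "measure M {x \<in> space M. (1/4)^i \<le> (a i x - a (Suc i) x)\<^sup>2} \<le> (1/2)^i" .
    moreover have "bad i \<subseteq> {x \<in> space M. (1/4)^i \<le> (a i x - a (Suc i) x)\<^sup>2}"
    proof
      fix x assume "x \<in> bad i"
      then have "((1/2)^i)\<^sup>2 \<le> \<bar>a i x - a (Suc i) x\<bar>\<^sup>2"
        by (intro power_mono) (auto simp: bad_def)
      then show "x \<in> {x \<in> space M. (1/4)^i \<le> (a i x - a (Suc i) x)\<^sup>2}"
        by (simp add: power2_eq_square flip: power_mult_distrib)
    qed
    moreover have "{x \<in> space M. (1/4)^i \<le> (a i x - a (Suc i) x)\<^sup>2} \<in> sets M" by measurable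
    ultimately show ?thesis
      using finite_measure_mono order_trans by blast
  qed
  define E where "E i = (\<Union>k. bad (i + k))" for i
  have E_sets [measurable]: "E i \<in> sets borel" for i unfolding E_def by measurable
  have E: "measure M (E i) \<le> 2 * (1/2)^i" for i
  proof -
    have sums: "(\<lambda>k. (1/2)^(i + k) :: real) sums (2 * (1/2)^i)"
      using sums_mult [OF geometric_sums [of "1/2 :: real"], of "(1/2)^i"] by (simp add: power_add mult.commute)
    have summ: "summable (\<lambda>k. measure M (bad (i + k)))"
      by (rule summable_comparison_test' [OF sums_summable [OF sums], of 0]) (use bad in auto)
    have "measure M (E i) \<le> (\<Sum>k. measure M (bad (i + k)))"
      unfolding E_def
      by (rule finite_measure_subadditive_countably [OF _ summ]) (simp add: image_subset_iff sets_M bad_sets)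
    also have "\<dots> \<le> (\<Sum>k. (1/2)^(i + k))"
      by (rule suminf_le [OF bad summ sums_summable [OF sums]])
    also have "\<dots> = 2 * (1/2)^i" using sums by (rule sums_unique [symmetric])
    finally show ?thesis .
  qed
  define L where "L x = lim (\<lambda>i. a i x)" for x
  have conv: "\<bar>a i x - L x\<bar> \<le> 2 * (1/2)^i \<and> (\<lambda>i. a i x) \<longlonglongrightarrow> L x" if x: "x \<notin> E i" for i x
  proof -
    have step: "\<bar>a j x - a (Suc j) x\<bar> \<le> (1/2)^j" if "i \<le> j" for j
      using x that unfolding E_def bad_def by (auto simp: not_less dest: spec [of _ "j - i"])
    \<comment> \<open>Keeping the subtracted term makes the geometric estimate exact, and the
      induction closes.\<close>
    have diff: "\<bar>a j x - a (j + k) x\<bar> \<le> 2 * (1/2)^j - 2 * (1/2)^(j + k)" if "i \<le> j" for j k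
    proof (induction k)
      case (Suc k)
      then show ?case using step [of "j + k"] that by simp
    qed simp
    have diff': "\<bar>a j x - a (j + k) x\<bar> \<le> 2 * (1/2)^j" if "i \<le> j" for j k
      using diff [OF that, of k] zero_le_power [of "1/2 :: real" "j + k"] by linarith
    have "Cauchy (\<lambda>i. a i x)"
    proof (rule metric_CauchyI)
      fix e :: real assume e: "e > 0"
      have "(\<lambda>j. 4 * (1/2)^j :: real) \<longlonglongrightarrow> 4 * 0"
        by (intro tendsto_mult tendsto_const LIMSEQ_power_zero) simp
      then have "\<forall>\<^sub>F j in sequentially. 4 * (1/2)^j < e"
        using e by (intro order_tendstoD(2)) auto
      then obtain j0 where j0: "\<And>j. j0 \<le> j \<Longrightarrow> 4 * (1/2)^j < e" by (auto simp: eventually_sequentially)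
      define j where "j = max i j0"
      show "\<exists>M. \<forall>m\<ge>M. \<forall>n\<ge>M. dist (a m x) (a n x) < e"
      proof (intro exI [of _ j] allI impI)
        fix m n assume mn: "j \<le> m" "j \<le> n"
        have "\<bar>a j x - a m x\<bar> \<le> 2 * (1/2)^j" "\<bar>a j x - a n x\<bar> \<le> 2 * (1/2)^j"
          using diff' [of j "m - j"] diff' [of j "n - j"] mn by (auto simp: j_def)
        moreover have "4 * (1/2)^j < e" by (rule j0) (simp add: j_def)
        ultimately show "dist (a m x) (a n x) < e" unfolding dist_real_def by linarith
      qed
    qed
    then have lim: "(\<lambda>i. a i x) \<longlonglongrightarrow> L x"
      unfolding L_def by (simp add: Cauchy_convergent_iff convergent_LIMSEQ_iff)
    have "(\<lambda>k. \<bar>a i x - a (i + k) x\<bar>) \<longlonglongrightarrow> \<bar>a i x - L x\<bar>"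
      using LIMSEQ_ignore_initial_segment [OF lim, of i] by (intro tendsto_intros) (simp add: add.commute)
    then have "\<bar>a i x - L x\<bar> \<le> 2 * (1/2)^i"
      by (rule LIMSEQ_le_const2) (use diff' in auto)
    then show ?thesis using lim by simp
  qed
  define F where "F x = max 0 (min 1 (L x))" for x
  show ?thesis
  proof (rule that [of F])
    show "F \<in> borel_measurable borel"
      unfolding F_def L_def by measurable
    show "0 \<le> F x" "F x \<le> 1" for x by (auto simp: F_def)
    show "F (T x) = F x" for x
    proof -
      have "(\<lambda>i. a i (T x) - a i x) \<longlonglongrightarrow> 0"
      proof (rule Lim_null_comparison)
        show "\<forall>\<^sub>F i in sequentially. norm (a i (T x) - a i x) \<le> 2 / real i"
          using eventually_gt_at_top [of 0]
        proof eventually_elim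
          case (elim i)
          have "norm (a i (T x) - a i x) = \<bar>birkhoff_sum T f ((T ^^ 1) x) (n i) - birkhoff_sum T f x (n i)\<bar> / real (n i)"
            by (simp add: a_def time_average_def flip: diff_divide_distrib)
          also have "\<dots> \<le> 2 / real (n i)"
            using birkhoff_sum_funpow_diff [of f T 1 x "n i", OF f1] by (intro divide_right_mono) auto
          also have "\<dots> \<le> 2 / real i" using ni [of i] elim by (intro divide_left_mono) auto
          finally show ?case .
        qed
        show "(\<lambda>i. 2 / real i) \<longlonglongrightarrow> 0" by (rule lim_const_over_n)
      qed
      then have "((\<lambda>i. a i (T x)) \<longlonglongrightarrow> l) = ((\<lambda>i. a i x) \<longlonglongrightarrow> l)" for l
        using tendsto_add [of "\<lambda>i. a i (T x) - a i x" 0 sequentially "\<lambda>i. a i x" l]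
          tendsto_diff [of "\<lambda>i. a i (T x)" l sequentially "\<lambda>i. a i (T x) - a i x" 0] by auto
      \<comment> \<open>\<open>lim\<close> is a definite description depending only on which numbers
        are limits of the sequence. These agree for \<open>x\<close> and \<open>T x\<close>, so the
        equality holds also where the averages diverge.\<close>
      then have "L (T x) = L x" by (simp add: L_def lim_def)
      then show ?thesis by (simp add: F_def)
    qed
    fix \<epsilon> :: real assume \<epsilon>: "\<epsilon> > 0"
    have "(\<lambda>j. 2 * (1/2)^j :: real) \<longlonglongrightarrow> 2 * 0"
      by (intro tendsto_mult tendsto_const LIMSEQ_power_zero) simp
    then have "\<forall>\<^sub>F j in sequentially. 2 * (1/2)^j < \<epsilon>"
      using \<epsilon> by (intro order_tendstoD(2)) auto
    then obtain i where i: "2 * (1/2)^i < \<epsilon>" by (auto simp: eventually_sequentially)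
    show "\<exists>m>0. measure M {x. \<epsilon> < \<bar>time_average T f m x - F x\<bar>} \<le> \<epsilon>"
    proof (intro exI [of _ "n i"] conjI)
      show "n i > 0" using ni [of i] by simp
      have "{x. \<epsilon> < \<bar>a i x - F x\<bar>} \<subseteq> E i"
      proof (rule ccontr)
        assume "\<not> ?thesis"
        then obtain x where x: "\<epsilon> < \<bar>a i x - F x\<bar>" "x \<notin> E i" by auto
        have "0 \<le> L x" "L x \<le> 1"
          using conv [OF x(2)] a01 by (auto intro: LIMSEQ_le_const LIMSEQ_le_const2)
        then have "F x = L x" by (simp add: F_def)
        then show False using conv [OF x(2)] x(1) i by linarith
      qed
      then have "measure M {x. \<epsilon> < \<bar>a i x - F x\<bar>} \<le> measure M (E i)"
        by (rule finite_measure_mono) (simp add: sets_M)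
      then show "measure M {x. \<epsilon> < \<bar>time_average T f (n i) x - F x\<bar>} \<le> \<epsilon>"
        using E [of i] i by (simp add: a_def)
    qed
  qed
qed

end

section \<open>Conditioning on invariant sets\<close>

lemma (in prob_space) integral_uniform_measure:
  fixes g :: "'a \<Rightarrow> real"
  assumes B: "B \<in> events" "prob B > 0" and g: "g \<in> borel_measurable M"
  shows "integral\<^sup>L (uniform_measure M B) g = (\<integral>x. indicator B x * g x \<partial>M) / prob B"
proof -
  have "uniform_measure M B = density M (\<lambda>x. ennreal (indicator B x / prob B))"
    unfolding uniform_measure_def
    using B by (intro arg_cong [of _ _ "density M"] ext) (auto simp: emeasure_eq_measure divide_ennreal ennreal_1 [symmetric] simp del: ennreal_1 split: split_indicator)
  then have "integral\<^sup>L (uniform_measure M B) g = (\<integral>x. indicator B x / prob B * g x \<partial>M)"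
    using B g by (simp add: integral_density)
  then show ?thesis by simp
qed

lemma (in invariant_measure) invariant_measure_uniform_measure:
  assumes B: "B \<in> sets borel" "T -` B = B" "prob B > 0"
  shows "invariant_measure (uniform_measure M B) T"
proof -
  have B': "B \<in> events" using B(1) by (simp add: sets_M)
  have em: "emeasure M B \<noteq> 0" "emeasure M B \<noteq> \<infinity>" using B(3) by (auto simp: emeasure_eq_measure)
  interpret U: prob_space "uniform_measure M B" by (rule prob_space_uniform_measure [OF em])
  show ?thesis
  proof
    fix A :: "'a set" assume A: "A \<in> sets borel"
    have "B \<inter> T -` A = T -` (B \<inter> A)" using B(2) by auto
    then have "prob (B \<inter> T -` A) = prob (B \<inter> A)"
      using invariant [of "B \<inter> A"] A B(1) by simp
    then show "measure (uniform_measure M B) (T -` A) = measure (uniform_measure M B) A"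
      using em A borel_vimage [OF A] by (simp add: sets_M)
  qed (auto simp: sets_M)
qed

text \<open>The potential \<open>W B = (\<Sum>l. 2 ^ l * prob (B \<inter> D l)) - (\<integral>x\<in>B. g x)\<close> is additive in \<open>B\<close>, so
  when an invariant set is split into two invariant pieces, one of them has positive measure and
  potential per mass not larger than before.\<close>

lemma (in invariant_measure) localisation:
  assumes D: "\<And>l. D l \<in> sets borel" "\<And>l. prob (D l) \<le> \<delta> / 2 * (1/4)^l"
    and S: "\<And>n. S n \<in> sets borel" "\<And>n. T -` S n = S n"
    and g [measurable]: "g \<in> borel_measurable borel" and gc: "\<And>x. \<bar>g x\<bar> \<le> c"
  obtains \<mu> :: "nat \<Rightarrow> 'a measure" where "\<And>n. invariant_measure (\<mu> n) T"
    "\<And>n l. measure (\<mu> n) (D l) \<le> (\<delta> + 2 * c) * (1/2)^l"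
    "\<And>n. integral\<^sup>L M g - \<delta> \<le> integral\<^sup>L (\<mu> n) g"
    "\<And>k. (\<forall>n>k. measure (\<mu> n) (S k) = 1) \<or> (\<forall>n>k. measure (\<mu> n) (S k) = 0)"
proof -
  note [measurable] = D(1) S(1)
  \<comment> \<open>The weight \<open>2^l\<close> is affordable since \<open>prob (D l)\<close>
    decays like \<open>(1/4)^l\<close>. It becomes the rate \<open>(1/2)^l\<close> for the
    conditioned measures, uniformly in \<open>n\<close>.\<close>
  define w where "w B l = 2^l * prob (B \<inter> D l)" for B l
  define G where "G B = (\<integral>x. indicator B x * g x \<partial>M)" for B
  define W where "W B = (\<Sum>l. w B l) - G B" for B
  have w0: "0 \<le> w B l" for B l by (simp add: w_def)
  have w_le: "w B l \<le> \<delta> / 2 * (1/2)^l" for B l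
  proof -
    have "prob (B \<inter> D l) \<le> prob (D l)" by (rule finite_measure_mono) (auto simp: sets_M)
    then have "w B l \<le> 2^l * (\<delta> / 2 * (1/4)^l)"
      unfolding w_def using D(2) [of l] by (intro mult_left_mono) auto
    also have "2^l * (\<delta> / 2 * (1/4)^l) = \<delta> / 2 * (2 * (1/4))^l" unfolding power_mult_distrib by simp
    finally show ?thesis by simp
  qed
  have geo: "(\<lambda>l. \<delta> / 2 * (1/2)^l) sums \<delta>"
    using sums_mult [OF geometric_sums [of "1/2 :: real"], of "\<delta> / 2"] by simp
  have w_summable: "summable (w B)" for B
    by (rule summable_comparison_test' [OF sums_summable [OF geo], of 0]) (use w0 w_le in auto)
  have w_sum: "(\<Sum>l. w B l) \<le> \<delta>" for B
    using suminf_le [OF w_le w_summable sums_summable [OF geo]] sums_unique [OF geo] by simp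
  have int: "integrable M (\<lambda>x. indicator B x * g x)" if [measurable]: "B \<in> sets borel" for B
  proof (rule integrable_bounded [of _ c])
    show "\<bar>indicator B x * g x\<bar> \<le> c" for x
      using gc [of x] by (auto split: split_indicator)
  qed simp
  have G_le: "\<bar>G B\<bar> \<le> c * prob B" if B [measurable]: "B \<in> sets borel" for B
  proof -
    have "\<bar>G B\<bar> \<le> (\<integral>x. \<bar>indicator B x * g x\<bar> \<partial>M)" unfolding G_def by (rule integral_abs_bound)
    also have "\<dots> \<le> (\<integral>x. c * indicator B x \<partial>M)"
    proof (rule integral_mono)
      show "\<bar>indicator B x * g x\<bar> \<le> c * indicator B x" for x
        using gc [of x] by (auto split: split_indicator)
      show "integrable M (\<lambda>x. c * indicator B x)"
        by (rule integrable_bounded [of _ "\<bar>c\<bar>"]) (auto split: split_indicator)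
    qed (use int in auto)
    finally show ?thesis by (simp add: sets_M)
  qed
  have split_prob: "prob A = prob (A \<inter> E) + prob (A - E)" if "A \<in> sets borel" "E \<in> sets borel" for A E
    using that finite_measure_Union [of "A \<inter> E" "A - E"] by (simp add: sets_M Un_Diff_Int Un_commute disjoint_iff)
  have W_add: "W B = W (B \<inter> E) + W (B - E)" if [measurable]: "B \<in> sets borel" "E \<in> sets borel" for B E
  proof -
    have "w B l = w (B \<inter> E) l + w (B - E) l" for l
    proof -
      have "B \<inter> D l \<inter> E = B \<inter> E \<inter> D l" "B \<inter> D l - E = (B - E) \<inter> D l" by auto
      then show ?thesis
        using split_prob [of "B \<inter> D l" E] by (simp add: w_def algebra_simps)
    qed
    then have 1: "(\<Sum>l. w B l) = (\<Sum>l. w (B \<inter> E) l) + (\<Sum>l. w (B - E) l)"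
      by (simp add: suminf_add w_summable)
    have "G B = (\<integral>x. indicator (B \<inter> E) x * g x + indicator (B - E) x * g x \<partial>M)"
      unfolding G_def by (intro Bochner_Integration.integral_cong) (auto split: split_indicator)
    also have "\<dots> = G (B \<inter> E) + G (B - E)"
      unfolding G_def by (intro Bochner_Integration.integral_add int) measurable
    finally show ?thesis using 1 by (simp add: W_def)
  qed
  have W_null: "W B = 0" if B [measurable]: "B \<in> sets borel" "prob B = 0" for B
  proof -
    have "prob (B \<inter> D l) \<le> prob B" for l by (rule finite_measure_mono) (auto simp: sets_M)
    then have "w B l = 0" for l using B(2) by (auto simp: w_def intro: antisym)
    moreover have "G B = 0" using G_le [OF B(1)] B(2) by simp
    ultimately show ?thesis by (simp add: W_def)
  qed
  \<comment> \<open>The comparison is with the whole space rather than with the preceding set, so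
    nothing deteriorates along the sequence.\<close>
  define good where "good B \<longleftrightarrow> B \<in> sets borel \<and> T -` B = B \<and> prob B > 0 \<and> W B \<le> W UNIV * prob B" for B
  have good_split: "good (B \<inter> E) \<or> good (B - E)"
    if B: "good B" and E: "E \<in> sets borel" "T -` E = E" for B E
  proof -
    have Bs: "B \<in> sets borel" "T -` B = B" using B by (auto simp: good_def)
    have sets: "B \<inter> E \<in> sets borel" "B - E \<in> sets borel"
      "T -` (B \<inter> E) = B \<inter> E" "T -` (B - E) = B - E"
      using Bs E by (auto simp: vimage_Int vimage_Diff)
    have p: "prob B = prob (B \<inter> E) + prob (B - E)" by (rule split_prob [OF Bs(1) E(1)])
    have WB: "W (B \<inter> E) + W (B - E) \<le> W UNIV * prob (B \<inter> E) + W UNIV * prob (B - E)"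
      using B W_add [OF Bs(1) E(1)] unfolding good_def p by (simp add: algebra_simps)
    consider "prob (B \<inter> E) = 0" | "prob (B - E) = 0" | "prob (B \<inter> E) > 0" "prob (B - E) > 0"
      using measure_nonneg [of M "B \<inter> E"] measure_nonneg [of M "B - E"] by linarith
    then show ?thesis
    proof cases
      case 1
      then have "good (B - E)"
        using B WB W_null [OF sets(1)] p sets by (simp add: good_def)
      then show ?thesis ..
    next
      case 2
      then have "good (B \<inter> E)"
        using B WB W_null [OF sets(2)] p sets by (simp add: good_def)
      then show ?thesis ..
    next
      case 3
      then show ?thesis using WB sets unfolding good_def by linarith
    qed
  qed
  \<comment> \<open>Stage \<open>n\<close> decides \<open>S n\<close>, keeping its complement only
    if the intersection fails to be good. All later sets lie on the same side of
    \<open>S n\<close>.\<close>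
  define B where "B = rec_nat UNIV (\<lambda>n A. if good (A \<inter> S n) then A \<inter> S n else A - S n)"
  have B_0: "B 0 = UNIV" and B_Suc: "B (Suc n) = (if good (B n \<inter> S n) then B n \<inter> S n else B n - S n)" for n
    by (simp_all add: B_def)
  have B_good: "good (B n)" for n
  proof (induction n)
    case 0
    show ?case by (simp add: B_0 good_def)
  next
    case (Suc n)
    then show ?case using good_split [OF Suc S] by (auto simp: B_Suc)
  qed
  have B_antimono: "B n \<subseteq> B m" if "m \<le> n" for m n
    using that by (induction n rule: dec_induct) (auto simp: B_Suc)
  have Bs: "B n \<in> sets borel" "T -` B n = B n" "prob (B n) > 0" for n
    using B_good [of n] by (auto simp: good_def)
  define \<mu> where "\<mu> n = uniform_measure M (B n)" for n
  have \<mu>: "measure (\<mu> n) A = prob (B n \<inter> A) / prob (B n)" if "A \<in> sets borel" for n A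
    unfolding \<mu>_def using Bs(3) [of n] that
    by (intro measure_uniform_measure) (auto simp: emeasure_eq_measure sets_M)
  \<comment> \<open>This one inequality gives both conclusions. Dropping the nonnegative sum bounds
    the conditioned integral of \<open>g\<close> from below; keeping a single summand and estimating
    \<open>G\<close> by \<open>c\<close> bounds the measure of \<open>D l\<close>.\<close>
  have WB: "(\<Sum>l. w (B n) l) - G (B n) \<le> (\<delta> - integral\<^sup>L M g) * prob (B n)" for n
  proof -
    have "W UNIV \<le> \<delta> - integral\<^sup>L M g" using w_sum [of UNIV] by (simp add: W_def G_def)
    then have "W UNIV * prob (B n) \<le> (\<delta> - integral\<^sup>L M g) * prob (B n)"
      by (rule mult_right_mono) simp
    moreover have "(\<Sum>l. w (B n) l) - G (B n) \<le> W UNIV * prob (B n)"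
      using B_good [of n] by (simp add: good_def W_def [of "B n"])
    ultimately show ?thesis by linarith
  qed
  show ?thesis
  proof (rule that [of \<mu>])
    show "invariant_measure (\<mu> n) T" for n
      unfolding \<mu>_def by (rule invariant_measure_uniform_measure [OF Bs])
    show "integral\<^sup>L M g - \<delta> \<le> integral\<^sup>L (\<mu> n) g" for n
    proof -
      have "0 \<le> (\<Sum>l. w (B n) l)" by (rule suminf_nonneg [OF w_summable w0])
      then have "(integral\<^sup>L M g - \<delta>) * prob (B n) \<le> G (B n)"
        using WB [of n] by (simp add: algebra_simps)
      moreover have "integral\<^sup>L (\<mu> n) g = G (B n) / prob (B n)"
        unfolding \<mu>_def G_def using Bs by (intro integral_uniform_measure) (auto simp: sets_M)
      ultimately show ?thesis using Bs(3) [of n] by (simp add: le_divide_eq)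
    qed
    show "measure (\<mu> n) (D l) \<le> (\<delta> + 2 * c) * (1/2)^l" for n l
    proof -
      have "w (B n) l \<le> (\<Sum>l. w (B n) l)"
        using sum_le_suminf [OF w_summable, of "{l}" "B n"] w0 by simp
      moreover have "\<bar>integral\<^sup>L M g\<bar> \<le> c"
        using G_le [of UNIV] by (simp add: G_def)
      then have "(\<delta> - integral\<^sup>L M g) * prob (B n) \<le> (\<delta> + c) * prob (B n)"
        by (intro mult_right_mono) auto
      ultimately have "w (B n) l \<le> (\<delta> + c) * prob (B n) + c * prob (B n)"
        using WB [of n] G_le [OF Bs(1), of n] by linarith
      then have "2^l * (prob (B n \<inter> D l) / prob (B n)) \<le> \<delta> + 2 * c"
        using Bs(3) [of n] by (simp add: w_def divide_le_eq algebra_simps)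
      then show ?thesis
        by (simp add: \<mu> D field_simps)
    qed
    show "(\<forall>n>k. measure (\<mu> n) (S k) = 1) \<or> (\<forall>n>k. measure (\<mu> n) (S k) = 0)" for k
    proof (cases "B (Suc k) \<subseteq> S k")
      case True
      have "measure (\<mu> n) (S k) = 1" if "n > k" for n
      proof -
        have "B n \<inter> S k = B n" using True B_antimono [of "Suc k" n] that by auto
        then show ?thesis using Bs(3) [of n] by (simp add: \<mu> S)
      qed
      then show ?thesis by auto
    next
      case False
      then have "B (Suc k) = B k - S k" by (auto simp: B_Suc split: if_splits)
      then have "B n \<inter> S k = {}" if "n > k" for n using B_antimono [of "Suc k" n] that by auto
      then show ?thesis by (auto simp: \<mu> S)
    qed
  qed
qed

text \<open>On an invariant \<open>B\<close> the average of the indicator of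
  \<open>C \<inter> B\<close> is that of \<open>C\<close>, cut off by \<open>B\<close>; off the
  exceptional set it is near \<open>v\<close>, and there it differs from \<open>v\<close> by at most
  2. For \<open>B = UNIV\<close> the measure of \<open>C\<close> is nearly \<open>v\<close>; for
  general \<open>B\<close> this is approximate independence of \<open>C\<close> and
  \<open>B\<close>, from which ergodicity follows.\<close>

lemma (in invariant_measure) prob_Int_invariant_deviation:
  assumes C: "C \<in> sets borel" and B: "B \<in> sets borel" "T -` B = B" and m: "m > 0" and v: "\<bar>v\<bar> \<le> 1"
    and t: "0 \<le> t" and dev: "prob {x. t < \<bar>time_average T (indicator C) m x - v\<bar>} \<le> s"
  shows "\<bar>prob (C \<inter> B) - v * prob B\<bar> \<le> t + 2 * s"
proof -
  note [measurable] = C B(1)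
  define E where "E = {x. t < \<bar>time_average T (indicator C) m x - v\<bar>}"
  have E [measurable]: "E \<in> sets borel" unfolding E_def by measurable
  define A where "A = time_average T (indicator C) m"
  have A: "0 \<le> A x" "A x \<le> 1" for x
    unfolding A_def by (auto intro!: time_average_bounds)
  have [measurable]: "A \<in> borel_measurable borel" by (simp add: A_def)
  have "(T ^^ j) x \<in> B \<longleftrightarrow> x \<in> B" for j x
  proof (induction j)
    case (Suc j)
    have "T y \<in> B \<longleftrightarrow> y \<in> B" for y using B(2) by auto
    then show ?case using Suc by simp
  qed simp
  then have ind: "time_average T (indicator (C \<inter> B)) m x = indicator B x * A x" for x
    by (simp add: A_def time_average_def birkhoff_sum_def indicator_inter_arith sum_distrib_right mult.commute indicator_def sum_distrib_left)
  have "prob (C \<inter> B) = (\<integral>x. time_average T (indicator (C \<inter> B)) m x \<partial>M)"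
    using integral_time_average [of "indicator (C \<inter> B)" 1 m] m by (simp add: sets_M)
  also have "\<dots> = (\<integral>x. indicator B x * A x \<partial>M)" by (simp add: ind)
  finally have "prob (C \<inter> B) - v * prob B = (\<integral>x. indicator B x * A x \<partial>M) - (\<integral>x. v * indicator B x \<partial>M)"
    by (simp add: sets_M)
  also have "\<dots> = (\<integral>x. indicator B x * (A x - v) \<partial>M)"
  proof (subst Bochner_Integration.integral_diff [symmetric])
    show "integrable M (\<lambda>x. indicator B x * A x)"
      by (rule integrable_bounded [of _ 1]) (use A in \<open>auto split: split_indicator\<close>)
    show "integrable M (\<lambda>x. v * indicator B x)"
      by (rule integrable_bounded [of _ 1]) (use v in \<open>auto split: split_indicator\<close>)
  qed (simp add: algebra_simps)
  finally have "\<bar>prob (C \<inter> B) - v * prob B\<bar> \<le> (\<integral>x. \<bar>indicator B x * (A x - v)\<bar> \<partial>M)"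
    by (simp add: integral_abs_bound)
  also have "\<dots> \<le> (\<integral>x. t + 2 * indicator E x \<partial>M)"
  proof (rule integral_mono)
    have bound: "\<bar>indicator B x * (A x - v)\<bar> \<le> 2" for x
      using A [of x] v by (auto split: split_indicator)
    then show "integrable M (\<lambda>x. \<bar>indicator B x * (A x - v)\<bar>)"
      by (intro integrable_bounded [of _ 2]) auto
    show "integrable M (\<lambda>x. t + 2 * indicator E x)"
      using t by (intro integrable_bounded [of _ "t + 2"]) (auto split: split_indicator)
    show "\<bar>indicator B x * (A x - v)\<bar> \<le> t + 2 * indicator E x" for x
      using bound [of x] t by (auto simp: E_def A_def not_less split: split_indicator)
  qed
  also have "\<dots> = t + 2 * prob E"
    by (simp add: sets_M integrable_bounded [of "indicator E" 1] split: split_indicator)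
  finally show ?thesis using dev by (simp add: E_def)
qed

section \<open>A finite layer-cake formula\<close>

lemma grid_sum_bounds:
  fixes y \<delta> :: real
  assumes "\<delta> > 0" "0 \<le> y" "y \<le> real n * \<delta>"
  shows "(\<Sum>k=1..n. if real k * \<delta> < y then \<delta> else 0) \<le> y \<and> y \<le> (\<Sum>k=1..n. if real k * \<delta> < y then \<delta> else 0) + \<delta>"
  using assms
proof (induction n)
  case (Suc n)
  show ?case
  proof (cases "y \<le> real n * \<delta>")
    case True
    then have "\<not> real (Suc n) * \<delta> < y" using Suc.prems by (simp add: algebra_simps)
    then show ?thesis using Suc.IH Suc.prems True by simp
  next
    case False
    have "(\<Sum>k=1..n. if real k * \<delta> < y then \<delta> else 0) = (\<Sum>k=1..n. \<delta>)"
    proof (rule sum.cong)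
      fix k assume "k \<in> {1..n}"
      then have "real k * \<delta> \<le> real n * \<delta>" using Suc.prems by (intro mult_right_mono) auto
      then show "(if real k * \<delta> < y then \<delta> else 0) = \<delta>" using False by auto
    qed simp
    then show ?thesis using False Suc.prems by (simp add: algebra_simps)
  qed
qed simp

text \<open>A bounded integral is determined up to \<open>\<delta>\<close> by the measures of
  finitely many superlevel sets. Once these belong to the algebra, convergence there reaches a
  function \<open>g\<close> that is only measurable.\<close>

lemma (in prob_space) integral_grid_approx:
  assumes g: "g \<in> borel_measurable M" "\<And>x. \<bar>g x\<bar> \<le> c" and \<delta>: "\<delta> > 0" and n: "2 * c \<le> real n * \<delta>"
  shows "\<bar>integral\<^sup>L M g - ((\<Sum>k=1..n. \<delta> * prob {x \<in> space M. - c + real k * \<delta> < g x}) - c)\<bar> \<le> \<delta>"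
proof -
  define E where "E k = {x \<in> space M. - c + real k * \<delta> < g x}" for k :: nat
  have E: "E k \<in> events" for k using g(1) unfolding E_def by measurable
  define s where "s x = (\<Sum>k=1..n. \<delta> * indicator (E k) x) - c" for x
  have s: "s x \<le> g x \<and> g x \<le> s x + \<delta>" if "x \<in> space M" for x
  proof -
    have "s x = (\<Sum>k=1..n. if real k * \<delta> < g x + c then \<delta> else 0) - c"
      unfolding s_def E_def using that by (intro arg_cong2 [of _ _ _ _ "(-)"] sum.cong) (auto split: split_indicator)
    moreover have "0 \<le> g x + c" "g x + c \<le> real n * \<delta>" using g(2) [of x] n by (auto simp: abs_le_iff)
    ultimately show ?thesis using grid_sum_bounds [OF \<delta>, of "g x + c" n] by auto
  qed
  have ig: "integrable M g" by (rule integrable_const_bound [of _ c]) (use g in auto)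
  have iE: "integrable M (indicator (E k) :: 'a \<Rightarrow> real)" for k
    by (rule integrable_const_bound [of _ 1]) (use E in \<open>auto split: split_indicator\<close>)
  have iE': "integrable M (\<lambda>x. \<delta> * indicator (E k) x)" for k
    by (intro integrable_mult_right iE)
  have iSum: "integrable M (\<lambda>x. \<Sum>k=1..n. \<delta> * indicator (E k) x)"
    by (intro Bochner_Integration.integrable_sum iE')
  then have iS: "integrable M s"
    unfolding s_def by (intro Bochner_Integration.integrable_diff) auto
  have "integral\<^sup>L M s = (\<integral>x. (\<Sum>k=1..n. \<delta> * indicator (E k) x) \<partial>M) - (\<integral>x. c \<partial>M)"
    unfolding s_def by (rule Bochner_Integration.integral_diff [OF iSum]) simp
  also have "\<dots> = (\<Sum>k=1..n. \<integral>x. \<delta> * indicator (E k) x \<partial>M) - c"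
    by (subst Bochner_Integration.integral_sum [OF iE']) (simp add: prob_space)
  finally have "integral\<^sup>L M s = (\<Sum>k=1..n. \<delta> * prob (E k)) - c"
    using E by simp
  moreover have "integral\<^sup>L M s \<le> integral\<^sup>L M g"
    by (rule integral_mono [OF iS ig]) (use s in auto)
  moreover have "integral\<^sup>L M g \<le> (\<integral>x. s x + \<delta> \<partial>M)"
    by (rule integral_mono) (use iS ig s in auto)
  moreover have "(\<integral>x. s x + \<delta> \<partial>M) = integral\<^sup>L M s + \<delta>" using iS by (simp add: prob_space)
  ultimately show ?thesis by (simp add: E_def abs_le_iff)
qed

section \<open>Existence of ergodic measures\<close>

lemma prob_space_eqI_algebra:
  fixes M N :: "'a::topological_space measure"
  assumes alg: "algebra UNIV \<A>" and gen: "sigma_sets UNIV \<A> = sets borel"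
    and M: "prob_space M" "sets M = sets borel" and N: "prob_space N" "sets N = sets borel"
    and eq: "\<And>A. A \<in> \<A> \<Longrightarrow> measure M A = measure N A"
  shows "M = N"
proof (rule measure_eqI_generator_eq [where E = \<A> and \<Omega> = UNIV and A = "\<lambda>_. UNIV"])
  interpret M: prob_space M by fact
  interpret N: prob_space N by fact
  interpret algebra UNIV \<A> by fact
  show "Int_stable \<A>" by (auto simp: Int_stable_def)
  show "emeasure M X = emeasure N X" if "X \<in> \<A>" for X
    using eq [OF that] by (simp add: M.emeasure_eq_measure N.emeasure_eq_measure)
  show "range (\<lambda>_. UNIV) \<subseteq> \<A>" using top by auto
  show "emeasure M UNIV \<noteq> \<infinity>" by simp
qed (use M N gen in auto)

text \<open>A uniform compact inner approximation replaces tightness in Prokhorov's theorem, and lets the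
  limit be defined on the algebra itself.\<close>

lemma limit_measure_on_algebra:
  fixes \<mu> :: "nat \<Rightarrow> 'a::metric_space measure"
  assumes alg: "algebra UNIV \<A>" and gen: "sigma_sets UNIV \<A> = sets borel"
    and \<mu>: "\<And>n. prob_space (\<mu> n)" "\<And>n. sets (\<mu> n) = sets borel"
    and conv: "\<And>A. A \<in> \<A> \<Longrightarrow> convergent (\<lambda>n. measure (\<mu> n) A)"
    and reg: "\<And>A \<epsilon>. A \<in> \<A> \<Longrightarrow> \<epsilon> > 0 \<Longrightarrow> \<exists>K. compact K \<and> K \<subseteq> A \<and> (\<forall>n. measure (\<mu> n) (A - K) \<le> \<epsilon>)"
  obtains \<nu> where "prob_space \<nu>" "sets \<nu> = sets borel"
    "\<And>A. A \<in> \<A> \<Longrightarrow> (\<lambda>n. measure (\<mu> n) A) \<longlonglongrightarrow> measure \<nu> A"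
proof -
  interpret algebra UNIV \<A> by fact
  interpret P: prob_space "\<mu> n" for n by (rule \<mu>)
  have space [simp]: "space (\<mu> n) = UNIV" for n
    using sets_eq_imp_space_eq [OF \<mu>(2)] by simp
  have \<A>_sets: "A \<in> sets borel" if "A \<in> \<A>" for A
    using that gen by blast
  define v where "v A = lim (\<lambda>n. measure (\<mu> n) A)" for A
  have lim: "(\<lambda>n. measure (\<mu> n) A) \<longlonglongrightarrow> v A" if "A \<in> \<A>" for A
    using conv [OF that] by (simp add: v_def convergent_LIMSEQ_iff)
  have v0: "0 \<le> v A" if "A \<in> \<A>" for A
    by (rule LIMSEQ_le_const [OF lim [OF that]]) auto
  have v_add: "v (A \<union> B) = v A + v B" if "A \<in> \<A>" "B \<in> \<A>" "A \<inter> B = {}" for A B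
  proof -
    have "measure (\<mu> n) (A \<union> B) = measure (\<mu> n) A + measure (\<mu> n) B" for n
      using that \<A>_sets by (intro P.finite_measure_Union) (auto simp: \<mu>)
    then have "(\<lambda>n. measure (\<mu> n) (A \<union> B)) \<longlonglongrightarrow> v A + v B"
      using tendsto_add [OF lim [OF that(1)] lim [OF that(2)]] by simp
    then show ?thesis using lim [of "A \<union> B"] that LIMSEQ_unique by blast
  qed
  have v_empty: "v {} = 0" using v_add [of "{}" "{}"] by simp
  have v_UNIV: "v UNIV = 1"
    using lim [OF top] P.prob_space LIMSEQ_unique [of "\<lambda>n. 1 :: real"] by simp
  \<comment> \<open>Continuity at the empty set is what Caratheodory's extension requires. The
    compact sets inside the decreasing \<open>A j\<close> have empty intersection, so finitely many
    of them already do; \<open>A i\<close> is then covered by differences whose total measure is at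
    most \<open>\<epsilon>\<close> for every \<open>n\<close>.\<close>
  have cont: "(\<lambda>i. ennreal (v (A i))) \<longlonglongrightarrow> 0"
    if A: "range A \<subseteq> \<A>" "decseq A" "(\<Inter>i. A i) = {}" for A :: "nat \<Rightarrow> 'a set"
  proof -
    have A\<A>: "A i \<in> \<A>" for i using A(1) by auto
    have "\<exists>J. \<forall>i\<ge>J. v (A i) \<le> \<epsilon>" if \<epsilon>: "\<epsilon> > 0" for \<epsilon>
    proof -
      have "\<exists>K. compact K \<and> K \<subseteq> A j \<and> (\<forall>n. measure (\<mu> n) (A j - K) \<le> \<epsilon> / 2 * (1/2)^j)" for j
        using reg [OF A\<A>, of "\<epsilon> / 2 * (1/2)^j" j] \<epsilon> by simp
      then obtain K where K: "\<And>j. compact (K j)" "\<And>j. K j \<subseteq> A j"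
        "\<And>j n. measure (\<mu> n) (A j - K j) \<le> \<epsilon> / 2 * (1/2)^j"
        by metis
      have "(\<Inter>j. K j) \<subseteq> (\<Inter>j. A j)" by (intro INF_mono') (rule K(2))
      then have "K 0 \<inter> (\<Inter>j\<in>UNIV. K j) = {}" using A(3) by auto
      then obtain I' where I': "finite I'" "K 0 \<inter> (\<Inter>j\<in>I'. K j) = {}"
        using compact_imp_fip_image [OF K(1) compact_imp_closed [OF K(1)], of UNIV 0 "\<lambda>j. j"] by auto
      define J where "J = Max (insert 0 I')"
      have J: "j \<le> J" if "j \<in> insert 0 I'" for j using that I'(1) unfolding J_def by (intro Max_ge) auto
      have "measure (\<mu> n) (A i) \<le> \<epsilon>" if "J \<le> i" for n i
      proof -
        have Aij: "A i \<subseteq> A j" if "j \<le> J" for j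
          using decseqD [OF A(2), of j i] that \<open>J \<le> i\<close> by auto
        have sub: "A i \<subseteq> (\<Union>j\<in>{..J}. A j - K j)" 
        proof (intro subsetI, rule ccontr)
          fix x assume x: "x \<in> A i" "x \<notin> (\<Union>j\<in>{..J}. A j - K j)"
          then have "x \<in> K j" if "j \<le> J" for j using that Aij [OF that] by auto
          then have "x \<in> K 0 \<inter> (\<Inter>j\<in>I'. K j)" using J by auto
          then show False using I'(2) by auto
        qed
        have sets: "A j - K j \<in> sets (\<mu> n)" for j
          using \<A>_sets [OF A\<A>] K(1) by (auto simp: \<mu> compact_imp_closed)
        have "measure (\<mu> n) (A i) \<le> measure (\<mu> n) (\<Union>j\<in>{..J}. A j - K j)"
          using sub sets by (intro P.finite_measure_mono) auto
        also have "\<dots> \<le> (\<Sum>j\<le>J. measure (\<mu> n) (A j - K j))"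
          using sets by (intro P.finite_measure_subadditive_finite) auto
        also have "\<dots> \<le> (\<Sum>j\<le>J. \<epsilon> / 2 * (1/2)^j)" by (intro sum_mono K(3))
        also have "\<dots> = \<epsilon> / 2 * (2 - (1/2)^J)"
          unfolding sum_distrib_left [symmetric] by (simp add: sum_gp0)
        also have "\<dots> \<le> \<epsilon> / 2 * 2" using \<epsilon> by (intro mult_left_mono) auto
        finally show ?thesis by simp
      qed
      then have "v (A i) \<le> \<epsilon>" if "J \<le> i" for i
        using that by (intro LIMSEQ_le_const2 [OF lim [OF A\<A>]]) auto
      then show ?thesis by blast
    qed
    then have "\<exists>J. \<forall>i\<ge>J. norm (v (A i) - 0) < r" if "r > 0" for r
    proof -
      have "r / 2 > 0" using that by simp
      then obtain J where "\<And>i. i \<ge> J \<Longrightarrow> v (A i) \<le> r / 2"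
        using \<open>\<And>\<epsilon>. \<epsilon> > 0 \<Longrightarrow> \<exists>J. \<forall>i\<ge>J. v (A i) \<le> \<epsilon>\<close> by blast
      then have "norm (v (A i) - 0) < r" if "J \<le> i" for i
        using v0 [OF A\<A>, of i] that \<open>r > 0\<close> by fastforce
      then show ?thesis by blast
    qed
    then have "(\<lambda>i. v (A i)) \<longlonglongrightarrow> 0" by (intro LIMSEQ_I)
    then have "(\<lambda>i. ennreal (v (A i))) \<longlonglongrightarrow> ennreal 0" by (rule tendsto_ennrealI)
    then show ?thesis by simp
  qed
  have "\<exists>\<kappa>. (\<forall>s\<in>\<A>. \<kappa> s = ennreal (v s)) \<and> measure_space UNIV (sigma_sets UNIV \<A>) \<kappa>"
  proof (rule caratheodory_empty_continuous)
    show "positive \<A> (\<lambda>A. ennreal (v A))" by (simp add: positive_def v_empty)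
    show "additive \<A> (\<lambda>A. ennreal (v A))" by (auto simp: additive_def v_add v0 ennreal_plus)
  qed (use cont in auto)
  then obtain \<kappa> where \<kappa>: "\<And>s. s \<in> \<A> \<Longrightarrow> \<kappa> s = ennreal (v s)" "measure_space UNIV (sets borel) \<kappa>"
    by (auto simp: gen)
  define \<nu> where "\<nu> = measure_of UNIV (sets borel) \<kappa>"
  have sets_\<nu>: "sets \<nu> = sets borel"
    unfolding \<nu>_def using sets.sigma_sets_eq [of borel] by (subst sets_measure_of) (auto simp: space_borel)
  have "emeasure \<nu> A = ennreal (v A)" if "A \<in> \<A>" for A
    using \<kappa> that \<A>_sets [OF that] unfolding \<nu>_def measure_space_def
    by (subst emeasure_measure_of_sigma) auto
  then have \<nu>: "emeasure \<nu> A = ennreal (v A)" "measure \<nu> A = v A" if "A \<in> \<A>" for A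
    using that v0 by (auto simp: measure_def)
  show ?thesis
  proof (rule that [of \<nu>])
    show "prob_space \<nu>"
      using \<nu>(1) [OF top] v_UNIV sets_eq_imp_space_eq [OF sets_\<nu>] by (intro prob_spaceI) simp
  qed (use sets_\<nu> \<nu> lim in auto)
qed

section \<open>A countable algebra closed under preimages\<close>

datatype boolean_term = Gen nat nat | Neg boolean_term | Cup boolean_term boolean_term

instance boolean_term :: countable
  by countable_datatype

text \<open>The terms, not the sets, carry the countability and later serve as codes in
  enumerations. The exponent \<open>j\<close> of a generator is there so that a preimage under
  \<open>T\<close> only raises it.\<close>

primrec interp :: "('a \<Rightarrow> 'a) \<Rightarrow> (nat \<Rightarrow> 'a set) \<Rightarrow> boolean_term \<Rightarrow> 'a set" where
  "interp T U (Gen j i) = (T ^^ j) -` U i"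
| "interp T U (Neg a) = - interp T U a"
| "interp T U (Cup a b) = interp T U a \<union> interp T U b"

lemma algebra_interp: "algebra UNIV (range (interp T U))"
  unfolding algebra_iff_Un
proof (intro conjI ballI)
  show "{} \<in> range (interp T U)"
    by (rule range_eqI [of _ _ "Neg (Cup (Gen 0 0) (Neg (Gen 0 0)))"]) auto
  show "UNIV - a \<in> range (interp T U)" if "a \<in> range (interp T U)" for a
    using that by (auto simp flip: interp.simps(2) Compl_eq_Diff_UNIV)
  show "a \<union> b \<in> range (interp T U)" if "a \<in> range (interp T U)" "b \<in> range (interp T U)" for a b
    using that by (auto simp flip: interp.simps(3))
qed auto

lemma vimage_interp: "T -` interp T U e \<in> range (interp T U)"
proof (induction e)
  case (Gen j i)
  have "T -` interp T U (Gen j i) = interp T U (Gen (Suc j) i)"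
    by (auto simp: funpow_swap1)
  then show ?case by blast
next
  case (Neg e)
  then obtain e' where "T -` interp T U e = interp T U e'" by auto
  then have "T -` interp T U (Neg e) = interp T U (Neg e')" by (simp add: vimage_Compl)
  then show ?case by blast
next
  case (Cup a b)
  then obtain a' b' where "T -` interp T U a = interp T U a'" "T -` interp T U b = interp T U b'" by auto
  then have "T -` interp T U (Cup a b) = interp T U (Cup a' b')" by simp
  then show ?case by blast
qed

text \<open>The sum depends only on which of finitely many iterates lie in \<open>C\<close>. An
  arbitrary \<open>P\<close> keeps the induction simple, since a further visit to \<open>C\<close>
  merely shifts \<open>P\<close> by 1. The exceptional sets of finite-time averages thereby belong
  to the algebra.\<close>

lemma (in algebra) birkhoff_sum_indicator_preimage:
  assumes \<Omega>: "\<Omega> = UNIV" and vim: "\<And>A. A \<in> M \<Longrightarrow> T -` A \<in> M" and C: "C \<in> M"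
  shows "{x. P (birkhoff_sum T (indicator C) x m)} \<in> M"
proof (induction m arbitrary: P)
  case 0
  show ?case using top \<Omega> by (cases "P 0") auto
next
  case (Suc m)
  have pre: "(T ^^ m) -` C \<in> M" for m
  proof (induction m)
    case (Suc m)
    have "(T ^^ Suc m) -` C = T -` ((T ^^ m) -` C)" by (auto simp: funpow_swap1)
    then show ?case using vim [OF Suc] by (simp only:)
  qed (simp add: C)
  have "{x. P (birkhoff_sum T (indicator C) x (Suc m))}
      = ((T ^^ m) -` C \<inter> {x. P (birkhoff_sum T (indicator C) x m + 1)})
        \<union> ({x. P (birkhoff_sum T (indicator C) x m)} - (T ^^ m) -` C)"
    by (auto simp: birkhoff_sum_def split: split_indicator)
  also have "\<dots> \<in> M"
    using pre [of m] Suc [of P] Suc [of "\<lambda>r. P (r + 1)"] by auto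
  finally show ?case .
qed

section \<open>Construction of an ergodic measure with a large integral\<close>

lemma (in invariant_measure) invariant_measure_mem: "M \<in> invariant_measures T"
  using invariant prob_space_axioms by (auto simp: invariant_measures_def Borel_prob_def sets_M)

text \<open>The limits \<open>F e\<close> are constant in the limit along the conditioned measures,
  but they are not functions of the algebra. They are used only to show that the finite-time
  averages \<open>A e m\<close> are nearly constant for \<open>\<mu> n\<close>; this statement
  concerns sets of the algebra and passes to \<open>\<nu>\<close>, where it yields
  ergodicity.\<close>

lemma exists_ergodic_measure:
  fixes M :: "'a::polish_space measure" and g :: "'a \<Rightarrow> real"
  assumes M: "invariant_measure M T" and g [measurable]: "g \<in> borel_measurable borel"
    and gc: "\<And>x. \<bar>g x\<bar> \<le> c" and \<delta>: "\<delta> > 0"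
  obtains \<nu> where "\<nu> \<in> ergodic_measures T" "integral\<^sup>L M g - \<delta> \<le> integral\<^sup>L \<nu> g"
proof -
  interpret invariant_measure M T by fact
  \<comment> \<open>One \<open>d\<close> is lost in conditioning, two in replacing the integrals for
    \<open>\<mu> n\<close> and for \<open>\<nu>\<close> by grid sums.\<close>
  define d where "d = \<delta> / 3"
  have d: "d > 0" using \<delta> by (simp add: d_def)
  have c: "0 \<le> c" using gc [of undefined] by linarith
  define \<kappa> where "\<kappa> = d + 2 * c"
  have \<kappa>: "0 \<le> \<kappa>" using c d by (simp add: \<kappa>_def)
  have small: "\<exists>i. a * (1/2)^i < r" if "r > 0" for a r :: real
  proof -
    have "(\<lambda>i. a * (1/2)^i) \<longlonglongrightarrow> a * 0"
      by (intro tendsto_mult tendsto_const LIMSEQ_power_zero) simp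
    then have "\<forall>\<^sub>F i in sequentially. a * (1/2)^i < r"
      using that by (intro order_tendstoD(2)) auto
    then show ?thesis by (auto simp: eventually_sequentially)
  qed
  obtain \<B> :: "'a set set" where \<B>: "countable \<B>" "topological_basis \<B>"
    using ex_countable_basis by blast
  \<comment> \<open>These sets join the generators so that the grid sums for the integral of
    \<open>g\<close> converge.\<close>
  define level where "level k = {x. - c + real k * d < g x}" for k :: nat
  define \<U> where "\<U> = \<B> \<union> range level"
  define U where "U = from_nat_into \<U>"
  have range_U: "range U = \<U>"
    unfolding U_def using \<B>(1) by (intro range_from_nat_into) (auto simp: \<U>_def)
  have level [measurable]: "level k \<in> sets borel" for k unfolding level_def by measurable
  have U_sets: "U i \<in> sets borel" for i
  proof -
    have "U i \<in> \<U>" using range_U by auto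
    then show ?thesis using topological_basis_open [OF \<B>(2)] level by (auto simp: \<U>_def)
  qed
  define C where "C = interp T U"
  have C_sets [measurable]: "C e \<in> sets borel" for e
  proof (induction e)
    case (Gen j i)
    show ?case using measurable_sets [OF measurable_funpow U_sets] by (simp add: C_def)
  qed (auto simp: C_def)
  define \<A> where "\<A> = range C"
  have alg: "algebra UNIV \<A>" unfolding \<A>_def C_def by (rule algebra_interp)
  interpret algebra UNIV \<A> by (rule alg)
  have vim: "T -` A \<in> \<A>" if "A \<in> \<A>" for A
    using that vimage_interp by (auto simp: \<A>_def C_def)
  have U_\<A>: "\<U> \<subseteq> \<A>"
  proof
    fix A assume "A \<in> \<U>"
    then obtain i where "A = U i" using range_U by auto
    then have "A = C (Gen 0 i)" by (simp add: C_def)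
    then show "A \<in> \<A>" by (simp add: \<A>_def)
  qed
  have gen: "sigma_sets UNIV \<A> = sets borel"
  proof
    show "sigma_sets UNIV \<A> \<subseteq> sets borel"
    proof -
      have "\<A> \<subseteq> sets borel" by (auto simp: \<A>_def)
      then show ?thesis using sets.sigma_sets_subset [of \<A> borel] by (simp add: space_borel)
    qed
    have "sets borel = sigma_sets UNIV \<B>"
      by (subst borel_eq_countable_basis [OF \<B>]) (rule sets_measure_of, simp)
    also have "\<dots> \<subseteq> sigma_sets UNIV \<A>"
      using U_\<A> by (intro sigma_sets_mono') (auto simp: \<U>_def)
    finally show "sets borel \<subseteq> sigma_sets UNIV \<A>" .
  qed
  define A where "A e = time_average T (indicator (C e))" for e
  have A_meas [measurable]: "A e m \<in> borel_measurable borel" for e m by (simp add: A_def)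
  define limit where "limit e F \<longleftrightarrow> F \<in> borel_measurable borel \<and> (\<forall>x. F (T x) = F x) \<and>
      (\<forall>x. 0 \<le> F x \<and> F x \<le> 1) \<and> (\<forall>\<epsilon>>0. \<exists>m>0. prob {x. \<epsilon> < \<bar>A e m x - F x\<bar>} \<le> \<epsilon>)" for e F
  have "\<exists>F. limit e F" for e
  proof (rule mean_ergodic_in_measure [of "indicator (C e)"])
    fix F assume "F \<in> borel_measurable borel" "\<And>x. F (T x) = F x" "\<And>x. 0 \<le> F x" "\<And>x. F x \<le> 1"
      "\<And>\<epsilon>. \<epsilon> > 0 \<Longrightarrow> \<exists>m>0. prob {x. \<epsilon> < \<bar>time_average T (indicator (C e)) m x - F x\<bar>} \<le> \<epsilon>"
    then have "limit e F" by (simp add: limit_def A_def)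
    then show "\<exists>F. limit e F" by blast
  qed auto
  then obtain F where "\<And>e. limit e (F e)" by metis
  then have F_meas [measurable]: "\<And>e. F e \<in> borel_measurable borel"
    and F_inv: "\<And>e x. F e (T x) = F e x" and F01: "\<And>e x. 0 \<le> F e x" "\<And>e x. F e x \<le> 1"
    and F_lim: "\<And>e \<epsilon>. \<epsilon> > 0 \<Longrightarrow> \<exists>m>0. prob {x. \<epsilon> < \<bar>A e m x - F e x\<bar>} \<le> \<epsilon>"
    unfolding limit_def by auto
  \<comment> \<open>An index \<open>l\<close> codes a term together with a precision, so that every
    term is treated at every precision. The code of a pair is at least its second entry, which turns
    the bound \<open>(1/2)^l\<close> into one by the precision.\<close>
  define te :: "nat \<Rightarrow> boolean_term" where "te l = from_nat (fst (prod_decode l))" for l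
  define ti where "ti l = snd (prod_decode l)" for l
  define code where "code e i = prod_encode (to_nat e, i)" for e :: boolean_term and i :: nat
  have te_code [simp]: "te (code e i) = e" and ti_code [simp]: "ti (code e i) = i" for e i
    by (simp_all add: te_def ti_def code_def)
  have code_ge: "(1/2 :: real) ^ code e i \<le> (1/2)^i" for e i
    unfolding code_def by (intro power_decreasing le_prod_encode_2) auto
  have "\<exists>m>0. prob {x. (1/2)^ti l < \<bar>A (te l) m x - F (te l) x\<bar>} \<le> d / 4 * (1/4)^l" for l
  proof -
    define \<epsilon> where "\<epsilon> = min ((1/2)^ti l) (d / 4 * (1/4)^l)"
    have "\<epsilon> > 0" using d by (simp add: \<epsilon>_def)
    then obtain m where m: "m > 0" "prob {x. \<epsilon> < \<bar>A (te l) m x - F (te l) x\<bar>} \<le> \<epsilon>"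
      using F_lim by blast
    have "prob {x. (1/2)^ti l < \<bar>A (te l) m x - F (te l) x\<bar>} \<le> prob {x. \<epsilon> < \<bar>A (te l) m x - F (te l) x\<bar>}"
      by (intro finite_measure_mono) (auto simp: \<epsilon>_def sets_M)
    also have "\<dots> \<le> d / 4 * (1/4)^l" using m(2) by (simp add: \<epsilon>_def)
    finally show ?thesis using m(1) by blast
  qed
  then obtain m where m: "\<And>l. m l > 0"
    "\<And>l. prob {x. (1/2)^ti l < \<bar>A (te l) (m l) x - F (te l) x\<bar>} \<le> d / 4 * (1/4)^l"
    by metis
  have "\<exists>K. compact K \<and> K \<subseteq> C (te l) \<and> prob (C (te l) - K) \<le> d / 4 * (1/4)^l" for l
  proof -
    have pos: "d / 4 * (1/4)^l > 0" using d by simp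
    have sup: "emeasure M (C (te l)) = (SUP K \<in> {K. K \<subseteq> C (te l) \<and> compact K}. emeasure M K)"
      by (rule inner_regular) (auto simp: sets_M)
    have "\<exists>K\<in>{K. K \<subseteq> C (te l) \<and> compact K}. emeasure M (C (te l)) < emeasure M K + ennreal (d / 4 * (1/4)^l)"
      by (rule SUP_approx_ennreal [OF pos _ sup]) (auto intro: exI [of _ "{}"])
    then obtain K where K: "K \<subseteq> C (te l)" "compact K" "emeasure M (C (te l)) < emeasure M K + ennreal (d / 4 * (1/4)^l)"
      by blast
    have Ks: "K \<in> events" using K(2) by (simp add: sets_M compact_imp_closed)
    have "prob (C (te l)) < prob K + d / 4 * (1/4)^l"
      using K(3) d by (simp add: emeasure_eq_measure ennreal_less_iff flip: ennreal_plus)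
    then have "prob (C (te l) - K) \<le> d / 4 * (1/4)^l"
      using finite_measure_Diff [OF _ Ks K(1)] by (simp add: sets_M)
    then show ?thesis using K by blast
  qed
  then obtain K where K: "\<And>l. compact (K l)" "\<And>l. K l \<subseteq> C (te l)"
    "\<And>l. prob (C (te l) - K l) \<le> d / 4 * (1/4)^l"
    by metis
  have K_sets [measurable]: "K l \<in> sets borel" for l using K(1) by (simp add: compact_imp_closed)
  define V where "V l = {x. (1/2)^ti l < \<bar>A (te l) (m l) x - F (te l) x\<bar>}" for l
  have V [measurable]: "V l \<in> sets borel" for l unfolding V_def by measurable
  \<comment> \<open>Two defects in one family: where the finite average leaves its limit, and what
    the compact set misses. Each has at most \<open>d / 4 * (1/4)^l\<close>.\<close>
  define D where "D l = V l \<union> (C (te l) - K l)" for l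
  \<comment> \<open>Deciding all rational superlevel sets of all \<open>F e\<close> makes each
    \<open>F e\<close> asymptotically constant.\<close>
  define S where "S n = (case from_nat n of (e, r) \<Rightarrow> {x. real_of_rat r < F e x})" for n :: nat
  obtain \<mu> where \<mu>: "\<And>n. invariant_measure (\<mu> n) T"
    and \<mu>D: "\<And>n l. measure (\<mu> n) (D l) \<le> \<kappa> * (1/2)^l"
    and \<mu>g: "\<And>n. integral\<^sup>L M g - d \<le> integral\<^sup>L (\<mu> n) g"
    and \<mu>S: "\<And>k. (\<forall>n>k. measure (\<mu> n) (S k) = 1) \<or> (\<forall>n>k. measure (\<mu> n) (S k) = 0)"
  proof (rule localisation [of D d S g c])
    show "D l \<in> sets borel" for l unfolding D_def by measurable
    show "prob (D l) \<le> d / 2 * (1/4)^l" for l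
    proof -
      have "prob (D l) \<le> prob (V l) + prob (C (te l) - K l)"
        unfolding D_def by (rule measure_Un_le) (auto simp: sets_M)
      then show ?thesis using m(2) [of l] K(3) [of l] by (simp add: V_def)
    qed
    show "S n \<in> sets borel" for n
      unfolding S_def by (cases "from_nat n :: boolean_term \<times> rat") simp
    show "T -` S n = S n" for n
      unfolding S_def by (cases "from_nat n :: boolean_term \<times> rat") (simp add: F_inv vimage_def)
  qed (use gc \<kappa>_def in auto)
  interpret P: invariant_measure "\<mu> n" T for n by (rule \<mu>)
  have "\<exists>v. \<bar>v\<bar> \<le> 1 \<and> (\<forall>\<epsilon>>0. \<forall>\<^sub>F n in sequentially. measure (\<mu> n) {x. \<epsilon> < \<bar>F e x - v\<bar>} = 0)" for e
  proof -
    \<comment> \<open>A cut: the constant value of \<open>F e\<close> is its supremum. The number -1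
      belongs to it, whereas 0 need not, as the inequality is strict and \<open>F e\<close> may
      vanish.\<close>
    define R where "R = {r \<in> \<rat>. \<forall>\<^sub>F n in sequentially. measure (\<mu> n) {x. r < F e x} = 1}"
    have dich: "\<forall>\<^sub>F n in sequentially. measure (\<mu> n) {x. r < F e x} = 0" if "r \<in> \<rat>" "r \<notin> R" for r
    proof -
      obtain q where q: "r = real_of_rat q" using \<open>r \<in> \<rat>\<close> by (auto elim: Rats_cases)
      define k where "k = to_nat (e, q)"
      have "S k = {x. r < F e x}" by (simp add: S_def k_def q)
      then have "(\<forall>n>k. measure (\<mu> n) {x. r < F e x} = 1) \<or> (\<forall>n>k. measure (\<mu> n) {x. r < F e x} = 0)"
        using \<mu>S [of k] by simp
      then have "(\<forall>\<^sub>F n in sequentially. measure (\<mu> n) {x. r < F e x} = 1)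
          \<or> (\<forall>\<^sub>F n in sequentially. measure (\<mu> n) {x. r < F e x} = 0)"
        unfolding eventually_at_top_dense by blast
      then show ?thesis using that by (auto simp: R_def)
    qed
    have R1: "r \<le> 1" if "r \<in> R" for r
    proof (rule ccontr)
      assume "\<not> r \<le> 1"
      then have "{x. r < F e x} = {}" using F01(2) [of e] by (auto simp: not_less not_le intro: order_trans less_imp_le)
      then show False using that by (auto simp: R_def)
    qed
    have "{x. -1 < F e x} = UNIV" using F01(1) [of e] by (auto intro: less_le_trans [of _ 0])
    then have Rm: "-1 \<in> R" by (simp add: R_def)
    define v where "v = Sup R"
    have bdd: "bdd_above R" using R1 by (intro bdd_aboveI)
    have v: "-1 \<le> v" "v \<le> 1"
      unfolding v_def using Rm R1 bdd by (auto intro: cSup_upper cSup_least)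
    show ?thesis
    proof (intro exI [of _ v] conjI allI impI)
      show "\<bar>v\<bar> \<le> 1" using v by (simp add: abs_le_iff)
      fix \<epsilon> :: real assume \<epsilon>: "\<epsilon> > 0"
      obtain r where r: "r \<in> R" "v - \<epsilon> < r"
        using less_cSupD [of R "v - \<epsilon>"] Rm \<epsilon> unfolding v_def by auto
      obtain r' where r': "r' \<in> \<rat>" "v < r'" "r' < v + \<epsilon>"
        using Rats_dense_in_real [of v "v + \<epsilon>"] \<epsilon> by auto
      have "r' \<notin> R" using r'(2) cSup_upper [OF _ bdd] unfolding v_def by fastforce
      then have "\<forall>\<^sub>F n in sequentially. measure (\<mu> n) {x. r' < F e x} = 0" by (rule dich [OF r'(1)])
      moreover have "\<forall>\<^sub>F n in sequentially. measure (\<mu> n) {x. r < F e x} = 1" using r(1) by (simp add: R_def)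
      ultimately show "\<forall>\<^sub>F n in sequentially. measure (\<mu> n) {x. \<epsilon> < \<bar>F e x - v\<bar>} = 0"
      proof eventually_elim
        case (elim n)
        have "measure (\<mu> n) {x. \<epsilon> < \<bar>F e x - v\<bar>} \<le> measure (\<mu> n) ({x. r' < F e x} \<union> (UNIV - {x. r < F e x}))"
          using r r' by (intro P.finite_measure_mono) (auto simp: P.sets_M abs_if split: if_splits)
        also have "\<dots> \<le> measure (\<mu> n) {x. r' < F e x} + measure (\<mu> n) (UNIV - {x. r < F e x})"
          by (rule measure_Un_le) (auto simp: P.sets_M)
        also have "\<dots> = 0"
          using elim P.prob_compl [of "{x. r < F e x}" n] by (simp add: P.sets_M)
        finally show ?case by (simp add: antisym)
      qed
    qed
  qed
  then obtain v where v1: "\<And>e. \<bar>v e\<bar> \<le> 1"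
    and v: "\<And>e \<epsilon>. \<epsilon> > 0 \<Longrightarrow> \<forall>\<^sub>F n in sequentially. measure (\<mu> n) {x. \<epsilon> < \<bar>F e x - v e\<bar>} = 0"
    by metis
  \<comment> \<open>The factor 2 leaves one \<open>(1/2)^i\<close> for the passage from the average
    to \<open>F e\<close> and one for the passage from \<open>F e\<close> to
    \<open>v e\<close>.\<close>
  define E where "E e i = {x. 2 * (1/2)^i < \<bar>A e (m (code e i)) x - v e\<bar>}" for e i
  have E_sets [measurable]: "E e i \<in> sets borel" for e i unfolding E_def by measurable
  have near: "\<forall>\<^sub>F n in sequentially. measure (\<mu> n) (E e i) \<le> \<kappa> * (1/2)^i" for e i
  proof -
    have "\<forall>\<^sub>F n in sequentially. measure (\<mu> n) {x. (1/2)^i < \<bar>F e x - v e\<bar>} = 0" by (rule v) simp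
    then show ?thesis
    proof eventually_elim
      case (elim n)
      have "measure (\<mu> n) (E e i) \<le> measure (\<mu> n) (D (code e i) \<union> {x. (1/2)^i < \<bar>F e x - v e\<bar>})"
      proof (rule P.finite_measure_mono)
        show "E e i \<subseteq> D (code e i) \<union> {x. (1/2)^i < \<bar>F e x - v e\<bar>}"
        proof
          fix x assume "x \<in> E e i"
          then have "2 * (1/2)^i < \<bar>A e (m (code e i)) x - v e\<bar>" by (simp add: E_def)
          then have "(1/2)^i < \<bar>A e (m (code e i)) x - F e x\<bar> \<or> (1/2)^i < \<bar>F e x - v e\<bar>" by linarith
          then show "x \<in> D (code e i) \<union> {x. (1/2)^i < \<bar>F e x - v e\<bar>}" by (auto simp: D_def V_def)
        qed
      qed (simp add: P.sets_M D_def)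
      also have "\<dots> \<le> measure (\<mu> n) (D (code e i)) + measure (\<mu> n) {x. (1/2)^i < \<bar>F e x - v e\<bar>}"
        by (rule measure_Un_le) (auto simp: P.sets_M D_def)
      also have "\<dots> \<le> \<kappa> * (1/2)^code e i" using \<mu>D elim by simp
      also have "\<dots> \<le> \<kappa> * (1/2)^i" using \<kappa> code_ge by (intro mult_left_mono) auto
      finally show ?case .
    qed
  qed
  have lim: "(\<lambda>n. measure (\<mu> n) (C e)) \<longlonglongrightarrow> v e" for e
  proof (rule tendstoI)
    fix r :: real assume r: "r > 0"
    obtain i where i: "(2 + 2 * \<kappa>) * (1/2)^i < r" using small [OF r] by blast
    show "\<forall>\<^sub>F n in sequentially. dist (measure (\<mu> n) (C e)) (v e) < r"
      using near [of e i]
    proof eventually_elim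
      case (elim n)
      have "\<bar>measure (\<mu> n) (C e \<inter> UNIV) - v e * measure (\<mu> n) UNIV\<bar> \<le> 2 * (1/2)^i + 2 * (\<kappa> * (1/2)^i)"
        by (rule P.prob_Int_invariant_deviation [where m = "m (code e i)"])
          (use elim m v1 in \<open>auto simp: E_def A_def\<close>)
      then show ?case using i by (simp add: dist_real_def algebra_simps)
    qed
  qed
  obtain \<nu> where \<nu>: "prob_space \<nu>" "sets \<nu> = sets borel"
    and \<nu>_lim: "\<And>B. B \<in> \<A> \<Longrightarrow> (\<lambda>n. measure (\<mu> n) B) \<longlonglongrightarrow> measure \<nu> B"
  proof (rule limit_measure_on_algebra [OF alg gen, of \<mu>])
    show "prob_space (\<mu> n)" for n by (rule P.prob_space_axioms)
    show "sets (\<mu> n) = sets borel" for n by (rule P.sets_M)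
    show "convergent (\<lambda>n. measure (\<mu> n) B)" if "B \<in> \<A>" for B
      using that lim by (auto simp: \<A>_def convergent_def)
    show "\<exists>K. compact K \<and> K \<subseteq> B \<and> (\<forall>n. measure (\<mu> n) (B - K) \<le> \<epsilon>)" if B: "B \<in> \<A>" and \<epsilon>: "\<epsilon> > 0" for B \<epsilon>
    proof -
      obtain e where e: "B = C e" using B by (auto simp: \<A>_def)
      obtain i where i: "\<kappa> * (1/2)^i < \<epsilon>" using small [OF \<epsilon>] by blast
      have "measure (\<mu> n) (C e - K (code e i)) \<le> \<epsilon>" for n
      proof -
        have "measure (\<mu> n) (C e - K (code e i)) \<le> measure (\<mu> n) (D (code e i))"
          by (rule P.finite_measure_mono) (auto simp: D_def P.sets_M)
        also have "\<dots> \<le> \<kappa> * (1/2)^code e i" by (rule \<mu>D)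
        also have "\<dots> \<le> \<kappa> * (1/2)^i" using \<kappa> code_ge by (intro mult_left_mono) auto
        finally show ?thesis using i by simp
      qed
      then show ?thesis using K(1,2) [of "code e i"] e by auto
    qed
  qed blast
  have \<nu>_C: "measure \<nu> (C e) = v e" for e
    using LIMSEQ_unique [OF \<nu>_lim lim] by (simp add: \<A>_def)
  interpret N0: prob_space \<nu> by fact
  have [measurable_cong]: "sets \<nu> = sets borel" by (rule \<nu>(2))
  have [simp]: "space \<nu> = UNIV" using sets_eq_imp_space_eq [OF \<nu>(2)] by simp
  have distr: "distr \<nu> borel T = \<nu>"
  proof (rule prob_space_eqI_algebra [OF alg gen])
    show "prob_space (distr \<nu> borel T)" by (rule N0.prob_space_distr) simp
    fix B assume B: "B \<in> \<A>"
    then have Bs: "B \<in> sets borel" using gen by blast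
    have "(\<lambda>n. measure (\<mu> n) B) \<longlonglongrightarrow> measure \<nu> (T -` B)"
      using \<nu>_lim [OF vim [OF B]] P.invariant [OF Bs] by simp
    then have "measure \<nu> (T -` B) = measure \<nu> B"
      using \<nu>_lim [OF B] LIMSEQ_unique by blast
    then show "measure (distr \<nu> borel T) B = measure \<nu> B"
      using Bs by (simp add: measure_distr)
  qed (use \<nu> in auto)
  interpret N: invariant_measure \<nu> T
  proof
    fix B :: "'a set" assume "B \<in> sets borel"
    then have "measure \<nu> (T -` B) = measure (distr \<nu> borel T) B" by (simp add: measure_distr)
    then show "measure \<nu> (T -` B) = measure \<nu> B" by (simp add: distr)
  qed (use \<nu> in auto)
  \<comment> \<open>Here the estimate crosses to the limit measure: \<open>E e i\<close> involves a
    finite average and a constant, no longer \<open>F e\<close>.\<close>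
  have E_\<nu>: "measure \<nu> (E e i) \<le> \<kappa> * (1/2)^i" for e i
  proof (rule tendsto_upperbound [OF \<nu>_lim near])
    have "C e \<in> \<A>" by (simp add: \<A>_def)
    then show "E e i \<in> \<A>"
      unfolding E_def A_def time_average_def
      by (intro birkhoff_sum_indicator_preimage [where P = "\<lambda>s. 2 * (1/2)^i < \<bar>s / real (m (code e i)) - v e\<bar>"] vim refl)
  qed simp
  have erg: "measure \<nu> B = 0 \<or> measure \<nu> B = 1" if B: "B \<in> sets borel" "T -` B = B" for B
  proof (cases "measure \<nu> B = 0")
    case False
    then have pos: "measure \<nu> B > 0" by (simp add: less_le)
    have em: "emeasure \<nu> B \<noteq> 0" "emeasure \<nu> B \<noteq> \<infinity>" using pos by (auto simp: N0.emeasure_eq_measure)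
    \<comment> \<open>Each \<open>C e\<close> is independent of \<open>B\<close>, so conditioning on
      \<open>B\<close> changes nothing on the algebra and hence nothing at all. Evaluating at
      \<open>B\<close> itself gives \<open>measure \<nu> B = 1\<close>.\<close>
    have "uniform_measure \<nu> B = \<nu>"
    proof (rule prob_space_eqI_algebra [OF alg gen])
      show "prob_space (uniform_measure \<nu> B)" by (rule prob_space_uniform_measure [OF em])
      fix X assume "X \<in> \<A>"
      then obtain e where e: "X = C e" by (auto simp: \<A>_def)
      have "\<bar>measure \<nu> (C e \<inter> B) - v e * measure \<nu> B\<bar> \<le> 0 + r" if r: "r > 0" for r
      proof -
        obtain i where i: "(2 + 2 * \<kappa>) * (1/2)^i < r" using small [OF r] by blast
        have "\<bar>measure \<nu> (C e \<inter> B) - v e * measure \<nu> B\<bar> \<le> 2 * (1/2)^i + 2 * (\<kappa> * (1/2)^i)"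
          by (rule N.prob_Int_invariant_deviation [where m = "m (code e i)"])
            (use B E_\<nu> [of e i] m v1 in \<open>auto simp: E_def A_def\<close>)
        then show ?thesis using i by (simp add: algebra_simps)
      qed
      then have "\<bar>measure \<nu> (C e \<inter> B) - v e * measure \<nu> B\<bar> \<le> 0" by (rule field_le_epsilon)
      then have "measure \<nu> (B \<inter> C e) = v e * measure \<nu> B" by (simp add: Int_commute)
      then show "measure (uniform_measure \<nu> B) X = measure \<nu> X"
        using em pos by (simp add: e \<nu>_C \<nu>(2))
    qed (use \<nu> in auto)
    then have "measure \<nu> B = measure \<nu> (B \<inter> B) / measure \<nu> B"
      using measure_uniform_measure [OF em, of B] B by (simp add: \<nu>(2))
    then show ?thesis using pos by simp
  qed simp
  have gint: "integral\<^sup>L M g - \<delta> \<le> integral\<^sup>L \<nu> g"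
  proof -
    obtain n0 :: nat where "2 * c / d \<le> real n0" using real_arch_simple by blast
    then have n0: "2 * c \<le> real n0 * d" using d by (simp add: divide_le_eq)
    define s where "s N = (\<Sum>k=1..n0. d * measure N (level k)) - c" for N :: "'a measure"
    have s: "\<bar>integral\<^sup>L N g - s N\<bar> \<le> d" if "invariant_measure N T" for N
    proof -
      interpret I: invariant_measure N T by fact
      show ?thesis
        using I.integral_grid_approx [of g c d n0] gc d n0 by (simp add: s_def level_def)
    qed
    have "(\<lambda>n. s (\<mu> n)) \<longlonglongrightarrow> s \<nu>"
      unfolding s_def using U_\<A> by (intro tendsto_intros \<nu>_lim) (auto simp: \<U>_def)
    moreover have "integral\<^sup>L M g - 2 * d \<le> s (\<mu> n)" for n
      using \<mu>g [of n] s [OF \<mu>, of n] by linarith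
    ultimately have "integral\<^sup>L M g - 2 * d \<le> s \<nu>"
      by (intro LIMSEQ_le_const) auto
    moreover have "\<bar>integral\<^sup>L \<nu> g - s \<nu>\<bar> \<le> d" by (rule s) (rule N.invariant_measure_axioms)
    ultimately show ?thesis unfolding d_def by linarith
  qed
  show ?thesis
  proof (rule that [OF _ gint])
    show "\<nu> \<in> ergodic_measures T"
      using N.invariant_measure_mem erg by (simp add: ergodic_measures_def)
  qed
qed

section \<open>Approximation by periodic orbits and generic points\<close>

lemma invariant_measureI:
  assumes "continuous_on UNIV T" "M \<in> invariant_measures T"
  shows "invariant_measure M T"
proof -
  interpret prob_space M using assms by (simp add: invariant_measures_def Borel_prob_def)
  show ?thesis
    using assms borel_measurable_continuous_onI [of T]
    by unfold_locales (auto simp: invariant_measures_def Borel_prob_def)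
qed

text \<open>Among the points of \<open>K\<close> minimise the squared distance of the vector of periodic averages to
  the vector of integrals. The linear functional pointing from the former to the latter is almost
  maximised by an ergodic measure, hence by a point of \<open>K\<close>, and linking a little of that point
  decreases the distance by an amount bounded below.\<close>

lemma periodic_average_approx:
  fixes T :: "'a::polish_space \<Rightarrow> 'a"
  assumes T: "continuous_on UNIV T" and link: "linkable T K" and close: "K_closeable T K"
    and M: "M \<in> invariant_measures T"
    and F: "finite F" "\<And>f. f \<in> F \<Longrightarrow> test_function f" and \<delta>: "\<delta> > 0"
  obtains y where "y \<in> K" "\<And>f. f \<in> F \<Longrightarrow> \<bar>periodic_average T f y - integral\<^sup>L M f\<bar> \<le> \<delta>"
proof -
  have M': "invariant_measure M T" by (rule invariant_measureI [OF T M])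
  have BM: "Borel_prob M" using M by (simp add: invariant_measures_def)
  have KP: "y \<in> periodic_points T" if "y \<in> K" for y using link that by (auto simp: linkable_def)
  define p where "p y f = periodic_average T f y" for y f
  define a where "a f = integral\<^sup>L M f" for f :: "'a \<Rightarrow> real"
  have p1: "\<bar>p y f\<bar> \<le> 1" if "y \<in> K" "f \<in> F" for y f
    using abs_periodic_average_le [OF KP [OF that(1)], of f] F(2) [OF that(2)] by (simp add: p_def test_function_def)
  have a1: "\<bar>a f\<bar> \<le> 1" if "f \<in> F" for f
    using test_function_integrable [OF BM F(2) [OF that]] by (simp add: a_def)
  have f1: "\<bar>f x\<bar> \<le> 1" if "f \<in> F" for f x using F(2) [OF that] by (simp add: test_function_def)
  have f_meas: "f \<in> borel_measurable borel" if "f \<in> F" for f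
    using F(2) [OF that] by (auto simp: test_function_def
        intro!: borel_measurable_continuous_onI uniformly_continuous_imp_continuous)
  define e where "e y f = a f - p y f" for y f
  have e2: "\<bar>e y f\<bar> \<le> 2" if "y \<in> K" "f \<in> F" for y f
    using p1 [OF that] a1 [OF that(2)] unfolding e_def by linarith
  define Q where "Q y = (\<Sum>f\<in>F. (e y f)\<^sup>2)" for y
  define N where "N = real (card F)"
  have N0: "0 \<le> N" by (simp add: N_def)
  \<comment> \<open>\<open>R\<close> is positive even for empty \<open>F\<close>, and it dominates
    both \<open>d\<close> and the squared length of \<open>p y' - p y\<close>, each being at most
    \<open>4 * N\<close>.\<close>
  define R where "R = 4 * N + 1"
  have R: "R > 0" using N0 by (simp add: R_def)
  \<comment> \<open>This provides a point of \<open>K\<close>, without which the infimum below would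
    be meaningless.\<close>
  obtain \<nu>0 where "\<nu>0 \<in> ergodic_measures T"
    using exists_ergodic_measure [OF M', of "\<lambda>_. 0" 0 1] by auto
  then obtain y0 where y0: "y0 \<in> K"
    using closeable_periodic_average [OF close, of \<nu>0 "{}" 1] by auto
  have Q0: "0 \<le> Q y" for y by (simp add: Q_def sum_nonneg)
  have Q4: "Q y \<le> 4 * N" if "y \<in> K" for y
  proof -
    have "Q y \<le> (\<Sum>f\<in>F. 4)" unfolding Q_def
    proof (rule sum_mono)
      fix f assume "f \<in> F"
      then have "\<bar>e y f\<bar>\<^sup>2 \<le> 2\<^sup>2" using e2 [OF that] by (intro power_mono) auto
      then show "(e y f)\<^sup>2 \<le> 4" by simp
    qed
    then show ?thesis by (simp add: N_def)
  qed
  define d where "d = Inf (Q ` K)"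
  have bdd: "bdd_below (Q ` K)" using Q0 by (intro bdd_belowI [of _ 0]) auto
  have dQ: "d \<le> Q y" if "y \<in> K" for y unfolding d_def using that by (intro cInf_lower bdd) auto
  have d0: "0 \<le> d" unfolding d_def using y0 Q0 by (intro cInf_greatest) auto
  have infQ: "\<exists>y\<in>K. Q y < t" if "d < t" for t
    using cInf_lessD [of "Q ` K" t, folded d_def] y0 that by auto
  have decrease: "\<exists>z\<in>K. Q z \<le> Q y - d\<^sup>2 / (4 * R)" if y: "y \<in> K" and d: "d > 0" for y
  proof -
    define g where "g x = (\<Sum>f\<in>F. e y f * f x)" for x
    have g_meas: "g \<in> borel_measurable borel"
      unfolding g_def using f_meas by (intro borel_measurable_sum borel_measurable_times) auto
    have g_bound: "\<bar>g x\<bar> \<le> 2 * N" for x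
    proof -
      have "\<bar>g x\<bar> \<le> (\<Sum>f\<in>F. \<bar>e y f * f x\<bar>)" unfolding g_def by (rule sum_abs)
      also have "\<dots> \<le> (\<Sum>f\<in>F. 2 * 1)"
        unfolding abs_mult using e2 [OF y] f1 by (intro sum_mono mult_mono) auto
      finally show ?thesis by (simp add: N_def)
    qed
    obtain \<nu> where \<nu>: "\<nu> \<in> ergodic_measures T" "integral\<^sup>L M g - d / 8 \<le> integral\<^sup>L \<nu> g"
      using exists_ergodic_measure [OF M' g_meas g_bound, of "d / 8"] d by auto
    have B\<nu>: "Borel_prob \<nu>" using \<nu>(1) by (simp add: ergodic_measures_def invariant_measures_def)
    have gint: "integral\<^sup>L L g = (\<Sum>f\<in>F. e y f * integral\<^sup>L L f)" if "Borel_prob L" for L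
      unfolding g_def using test_function_integrable(1) [OF that F(2)] by (subst Bochner_Integration.integral_sum) auto
    \<comment> \<open>Passing from \<open>M\<close> to \<open>\<nu>\<close> costs
      \<open>d / 8\<close>, and passing from \<open>\<nu>\<close> to a periodic orbit another
      \<open>d / 8\<close>; of \<open>Q y \<ge> d\<close> there remains \<open>3 / 4 * d\<close> for
      the inner product.\<close>
    define \<tau> where "\<tau> = d / (8 * (2 * N + 1))"
    have \<tau>: "\<tau> > 0" using d N0 by (simp add: \<tau>_def)
    obtain y' where y': "y' \<in> K" "\<And>f. f \<in> F \<Longrightarrow> \<bar>p y' f - integral\<^sup>L \<nu> f\<bar> \<le> \<tau>"
      using closeable_periodic_average [OF close \<nu>(1) F \<tau>] unfolding p_def by metis
    have "\<bar>(\<Sum>f\<in>F. e y f * p y' f) - integral\<^sup>L \<nu> g\<bar> \<le> d / 8"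
    proof -
      have "\<bar>(\<Sum>f\<in>F. e y f * p y' f) - integral\<^sup>L \<nu> g\<bar> = \<bar>\<Sum>f\<in>F. e y f * (p y' f - integral\<^sup>L \<nu> f)\<bar>"
        unfolding gint [OF B\<nu>] by (simp add: sum_subtractf right_diff_distrib)
      also have "\<dots> \<le> (\<Sum>f\<in>F. \<bar>e y f * (p y' f - integral\<^sup>L \<nu> f)\<bar>)" by (rule sum_abs)
      also have "\<dots> \<le> (\<Sum>f\<in>F. 2 * \<tau>)"
        unfolding abs_mult using e2 [OF y] y'(2) \<tau> by (intro sum_mono mult_mono) auto
      also have "\<dots> = 2 * N * \<tau>" by (simp add: N_def)
      also have "\<dots> \<le> d / 8" using N0 d by (simp add: \<tau>_def field_simps)
      finally show ?thesis .
    qed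
    then have "(\<Sum>f\<in>F. e y f * a f) - d / 4 \<le> (\<Sum>f\<in>F. e y f * p y' f)"
      using \<nu>(2) unfolding gint [OF BM] a_def by linarith
    moreover have "Q y = (\<Sum>f\<in>F. e y f * a f) - (\<Sum>f\<in>F. e y f * p y f)"
      unfolding Q_def sum_subtractf [symmetric]
      by (intro sum.cong) (auto simp: e_def power2_eq_square algebra_simps)
    ultimately have inner: "3 / 4 * d \<le> (\<Sum>f\<in>F. e y f * (p y' f - p y f))"
      using dQ [OF y] by (simp add: right_diff_distrib sum_subtractf)
    \<comment> \<open>With this step the gain \<open>3 / 2 * lam * d\<close> of the linear term
      outweighs the quadratic loss \<open>lam\<^sup>2 * R = lam * d / 4\<close>.\<close>
    define lam where "lam = d / (4 * R)"
    have dR: "d \<le> R" using dQ [OF y] Q4 [OF y] by (simp add: R_def)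
    have lam: "0 < lam" "lam \<le> 1" using d R dR by (auto simp: lam_def field_simps)
    define u where "u f = e y f - lam * (p y' f - p y f)" for f
    have u2: "\<bar>u f\<bar> \<le> 2" if "f \<in> F" for f
    proof -
      have "u f = (1 - lam) * e y f + lam * e y' f" by (simp add: u_def e_def algebra_simps)
      also have "\<bar>\<dots>\<bar> \<le> (1 - lam) * \<bar>e y f\<bar> + lam * \<bar>e y' f\<bar>"
        using lam abs_triangle_ineq [of "(1 - lam) * e y f" "lam * e y' f"] by (simp add: abs_mult)
      also have "\<dots> \<le> (1 - lam) * 2 + lam * 2"
        using lam e2 [OF y that] e2 [OF y'(1) that] by (intro add_mono mult_left_mono) auto
      finally show ?thesis by simp
    qed
    have pp: "(\<Sum>f\<in>F. (p y' f - p y f)\<^sup>2) \<le> R"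
    proof -
      have "(\<Sum>f\<in>F. (p y' f - p y f)\<^sup>2) \<le> (\<Sum>f\<in>F. 4)"
      proof (rule sum_mono)
        fix f assume f: "f \<in> F"
        have "\<bar>p y' f - p y f\<bar> \<le> 2" using p1 [OF y f] p1 [OF y'(1) f] by linarith
        then have "\<bar>p y' f - p y f\<bar>\<^sup>2 \<le> 2\<^sup>2" by (intro power_mono) auto
        then show "(p y' f - p y f)\<^sup>2 \<le> 4" by simp
      qed
      then show ?thesis by (simp add: N_def R_def)
    qed
    have usum: "(\<Sum>f\<in>F. (u f)\<^sup>2) \<le> Q y - 5 / 4 * (lam * d)"
    proof -
      have "(\<Sum>f\<in>F. (u f)\<^sup>2) = (\<Sum>f\<in>F. (e y f)\<^sup>2 - 2 * lam * (e y f * (p y' f - p y f)) + lam\<^sup>2 * (p y' f - p y f)\<^sup>2)"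
        by (intro sum.cong) (auto simp: u_def power2_eq_square algebra_simps)
      also have "\<dots> = Q y - 2 * lam * (\<Sum>f\<in>F. e y f * (p y' f - p y f)) + lam\<^sup>2 * (\<Sum>f\<in>F. (p y' f - p y f)\<^sup>2)"
        by (simp add: sum.distrib sum_subtractf sum_distrib_left Q_def)
      also have "\<dots> \<le> Q y - 2 * lam * (3 / 4 * d) + lam\<^sup>2 * R"
        using inner pp lam by (intro add_mono diff_mono mult_left_mono) auto
      also have "lam\<^sup>2 * R = lam * d / 4" using R by (simp add: lam_def power2_eq_square)
      finally show ?thesis by (simp add: algebra_simps)
    qed
    \<comment> \<open>The linking error adds at most \<open>5 * \<omega>\<close> per function, hence
      \<open>d\<^sup>2 / (16 * R)\<close> in total. Of the gain
      \<open>5 * d\<^sup>2 / (16 * R)\<close> there remains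
      \<open>d\<^sup>2 / (4 * R)\<close>.\<close>
    define \<omega> where "\<omega> = d\<^sup>2 / (80 * R\<^sup>2)"
    have R2: "R\<^sup>2 > 0" using R by simp
    moreover have "d\<^sup>2 \<le> R\<^sup>2" using dR d by (intro power_mono) auto
    ultimately have "d\<^sup>2 \<le> 80 * R\<^sup>2" by linarith
    then have \<omega>: "\<omega> > 0" "\<omega> \<le> 1" using d R2 by (simp_all add: \<omega>_def)
    have l01: "0 \<le> 1 - lam" "1 - lam \<le> 1" using lam by auto
    obtain z where z: "z \<in> K" "\<And>f. f \<in> F \<Longrightarrow> \<bar>p z f - ((1 - lam) * p y f + lam * p y' f)\<bar> \<le> \<omega>"
      by (rule linkable_periodic_average [OF link y y'(1) \<omega>(1) l01 F, of 0]) (auto simp: p_def)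
    have "Q z \<le> (\<Sum>f\<in>F. (u f)\<^sup>2 + 5 * \<omega>)"
      unfolding Q_def
    proof (rule sum_mono)
      fix f assume f: "f \<in> F"
      define h where "h = e z f - u f"
      have "h = - (p z f - ((1 - lam) * p y f + lam * p y' f))"
        by (simp add: h_def e_def u_def algebra_simps)
      then have h: "\<bar>h\<bar> \<le> \<omega>" using z(2) [OF f] by simp
      have "(e z f)\<^sup>2 = (u f)\<^sup>2 + h * (2 * u f + h)"
        by (simp add: h_def power2_eq_square algebra_simps)
      also have "h * (2 * u f + h) \<le> \<bar>h\<bar> * \<bar>2 * u f + h\<bar>" by (metis abs_ge_self abs_mult)
      also have "\<dots> \<le> \<omega> * 5"
        using h u2 [OF f] \<omega> by (intro mult_mono) auto
      finally show "(e z f)\<^sup>2 \<le> (u f)\<^sup>2 + 5 * \<omega>" by simp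
    qed
    also have "\<dots> = (\<Sum>f\<in>F. (u f)\<^sup>2) + N * (5 * \<omega>)" by (simp add: sum.distrib N_def)
    also have "\<dots> \<le> Q y - 5 / 4 * (lam * d) + R * (5 * \<omega>)"
      using usum \<omega> N0 by (intro add_mono mult_right_mono) (auto simp: R_def)
    also have "\<dots> = Q y - d\<^sup>2 / (4 * R)"
      using R by (simp add: \<omega>_def lam_def power2_eq_square field_simps)
    finally show ?thesis using z(1) by blast
  qed
  have "d = 0"
  proof (rule ccontr)
    assume "d \<noteq> 0"
    then have d: "d > 0" using d0 by simp
    then have "d < d + d\<^sup>2 / (4 * R)" using R by simp
    then obtain y where y: "y \<in> K" "Q y < d + d\<^sup>2 / (4 * R)" using infQ by blast
    obtain z where "z \<in> K" "Q z \<le> Q y - d\<^sup>2 / (4 * R)" using decrease [OF y(1) d] by blast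
    then show False using dQ [of z] y(2) by linarith
  qed
  then obtain y where y: "y \<in> K" "Q y < \<delta>\<^sup>2" using infQ [of "\<delta>\<^sup>2"] \<delta> by auto
  show ?thesis
  proof (rule that [OF y(1)])
    fix f assume f: "f \<in> F"
    have "(e y f)\<^sup>2 \<le> Q y" unfolding Q_def using F(1) f by (intro member_le_sum) auto
    then have "\<bar>e y f\<bar>\<^sup>2 \<le> \<delta>\<^sup>2" using y(2) by simp
    then have "\<bar>e y f\<bar> \<le> \<delta>" by (rule power2_le_imp_le) (use \<delta> in simp)
    then show "\<bar>periodic_average T f y - integral\<^sup>L M f\<bar> \<le> \<delta>"
      by (simp add: e_def a_def p_def abs_minus_commute)
  qed
qed

section \<open>A generic point as a limit of linked periodic points\<close>

lemma geometric_steps_dist: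
  assumes "\<And>m. n \<le> m \<Longrightarrow> dist (w (Suc m)) (w m) \<le> c * (1/2)^m"
  shows "dist (w (n + k)) (w n) \<le> 2 * c * (1/2)^n - 2 * c * (1/2)^(n + k)"
proof (induction k)
  case (Suc k)
  have "dist (w (n + Suc k)) (w n) \<le> dist (w (Suc (n + k))) (w (n + k)) + dist (w (n + k)) (w n)"
    using dist_triangle [of "w (n + Suc k)" "w n" "w (n + k)"] by simp
  also have "\<dots> \<le> c * (1/2)^(n + k) + (2 * c * (1/2)^n - 2 * c * (1/2)^(n + k))"
    using Suc assms [of "n + k"] by (intro add_mono) auto
  finally show ?case by simp
qed simp

lemma geometric_steps_Cauchy:
  assumes c: "c \<ge> 0" and step: "\<And>m. dist (w (Suc m)) (w m) \<le> c * (1/2)^m"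
  shows "Cauchy w"
proof (rule metric_CauchyI)
  fix r :: real assume r: "r > 0"
  have le: "dist (w (n + k)) (w n) \<le> 2 * c * (1/2)^n" for n k
  proof -
    have "0 \<le> 2 * c * (1/2)^(n + k)" using c by simp
    then show ?thesis using geometric_steps_dist [of n w c k, OF step] by linarith
  qed
  have "(\<lambda>n. 4 * c * (1/2)^n) \<longlonglongrightarrow> 4 * c * 0"
    by (intro tendsto_mult tendsto_const LIMSEQ_power_zero) simp
  then have "\<forall>\<^sub>F n in sequentially. 4 * c * (1/2)^n < r"
    using r by (intro order_tendstoD(2)) auto
  then obtain n where n: "4 * c * (1/2)^n < r" by (auto simp: eventually_sequentially)
  show "\<exists>M. \<forall>m\<ge>M. \<forall>k\<ge>M. dist (w m) (w k) < r"
  proof (intro exI [of _ n] allI impI)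
    fix m k assume "n \<le> m" "n \<le> k"
    then have "dist (w m) (w n) \<le> 2 * c * (1/2)^n" "dist (w k) (w n) \<le> 2 * c * (1/2)^n"
      using le [of n "m - n"] le [of n "k - n"] by auto
    then show "dist (w m) (w k) < r" using n dist_triangle2 [of "w m" "w k" "w n"] by linarith
  qed
qed

text \<open>The time \<open>s\<close> is carried along because links start from points of
  \<open>K\<close>, and \<open>K\<close> need not contain \<open>(T ^^ s) y\<close>. All shadowing
  times exceed \<open>s\<close>, so the orbits of \<open>x\<close> and \<open>y\<close> are close at
  that time; shifting a starting point by \<open>s\<close> steps does not affect its limits of
  averages.\<close>

lemma generic_shadowing:
  fixes T :: "'a::polish_space \<Rightarrow> 'a"
  assumes T: "continuous_on UNIV T" and link: "linkable T K" and close: "K_closeable T K"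
    and M: "M \<in> invariant_measures T" and y: "y \<in> K" and e: "e > 0"
  obtains x where "generic T M ((T ^^ s) x)" "dist ((T ^^ s) x) ((T ^^ s) y) \<le> e"
proof -
  have BM: "Borel_prob M" using M by (simp add: invariant_measures_def)
  obtain \<psi> :: "nat \<Rightarrow> 'a \<Rightarrow> real" where \<psi>: "\<And>k. test_function (\<psi> k)"
    and det: "\<And>T M x. Borel_prob M \<Longrightarrow>
      (\<And>k. (\<lambda>n. birkhoff_sum T (\<psi> k) x n / real n) \<longlonglongrightarrow> integral\<^sup>L M (\<psi> k)) \<Longrightarrow> generic T M x"
    using convergence_determining_test_functions by blast
  define a where "a k = integral\<^sup>L M (\<psi> k)" for k
  have a1: "\<bar>a k\<bar> \<le> 1" for k using test_function_integrable [OF BM \<psi>] by (simp add: a_def)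
  have \<psi>1: "\<bar>\<psi> k x\<bar> \<le> 1" for k x using \<psi> [of k] by (simp add: test_function_def)
  define c where "c = e / 2"
  have c: "c > 0" using e by (simp add: c_def)
  \<comment> \<open>A stage is a point together with its shadowing time. \<open>good 0\<close> asks
    only for a point of \<open>K\<close>, so the averages of the initial \<open>y\<close> may be
    unrelated to \<open>M\<close>.\<close>
  define good where "good n w \<longleftrightarrow> fst w \<in> K \<and> (\<forall>j<n. \<bar>periodic_average T (\<psi> j) (fst w) - a j\<bar> \<le> (1/2)^n)"
    for n and w :: "'a \<times> nat"
  define link_step where "link_step n w w' \<longleftrightarrow> snd w < snd w' \<and> s < snd w' \<and> fst w' \<in> bowen_ball T (fst w) (snd w') (c * (1/2)^n) \<and>
      (\<forall>j<n. \<forall>N\<ge>snd w'. \<bar>birkhoff_sum T (\<psi> j) (fst w') N - real N * a j\<bar> \<le> 2 * (1/2)^n * real N)"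
    for n and w w' :: "'a \<times> nat"
  have stage: "\<exists>w'. good (Suc n) w' \<and> link_step n w w'" if w: "good n w" for n w
  proof -
    \<comment> \<open>The first bound makes the total displacement at most \<open>2 * c = e\<close>.
      The second lets the errors of \<open>u\<close> and of the link add up to at most
      \<open>(1/2)^Suc n\<close>.\<close>
    define \<omega> where "\<omega> = min (c * (1/2)^n) ((1/2)^n / 4)"
    have \<omega>: "\<omega> > 0" "\<omega> \<le> c * (1/2)^n" "\<omega> \<le> (1/2)^n / 4" using c by (auto simp: \<omega>_def)
    define F where "F = \<psi> ` {..<Suc n}"
    have F: "finite F" "\<And>f. f \<in> F \<Longrightarrow> test_function f" by (auto simp: F_def \<psi>)
    obtain u where u: "u \<in> K" "\<And>f. f \<in> F \<Longrightarrow> \<bar>periodic_average T f u - integral\<^sup>L M f\<bar> \<le> \<omega>"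
      using periodic_average_approx [OF T link close M F \<omega>(1)] by blast
    have wK: "fst w \<in> K" using w by (simp add: good_def)
    \<comment> \<open>The weight \<open>lam = 0\<close> gives \<open>z\<close> the averages of
      \<open>u\<close>, while \<open>z\<close> follows the old point for more than
      \<open>max (snd w) s\<close> steps.\<close>
    obtain z P where z: "z \<in> K" "Suc (max (snd w) s) \<le> P" "z \<in> bowen_ball T (fst w) P \<omega>"
      and za: "\<And>f. f \<in> F \<Longrightarrow>
        \<bar>periodic_average T f z - (0 * periodic_average T f (fst w) + (1 - 0) * periodic_average T f u)\<bar> \<le> \<omega>"
      and zb: "\<And>f a \<eta> N. f \<in> F \<Longrightarrow> \<bar>a\<bar> \<le> 1 \<Longrightarrow> \<bar>periodic_average T f (fst w) - a\<bar> \<le> \<eta> \<Longrightarrow>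
        \<bar>periodic_average T f u - a\<bar> \<le> \<eta> \<Longrightarrow> P \<le> N \<Longrightarrow> \<bar>birkhoff_sum T f z N - real N * a\<bar> \<le> (\<eta> + \<omega>) * real N"
      by (rule linkable_periodic_average [OF link wK u(1) \<omega>(1) _ _ F, of 0 "Suc (max (snd w) s)"]) auto
    have "good (Suc n) (z, P)"
      unfolding good_def fst_conv
    proof (intro conjI allI impI z(1))
      fix j assume "j < Suc n"
      then have "\<psi> j \<in> F" by (simp add: F_def)
      then have "\<bar>periodic_average T (\<psi> j) z - periodic_average T (\<psi> j) u\<bar> \<le> \<omega>"
        "\<bar>periodic_average T (\<psi> j) u - a j\<bar> \<le> \<omega>"
        using za [of "\<psi> j"] u(2) [of "\<psi> j"] by (simp_all add: a_def)
      then show "\<bar>periodic_average T (\<psi> j) z - a j\<bar> \<le> (1/2)^Suc n"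
        using \<omega>(3) unfolding power_Suc by linarith
    qed
    moreover have "link_step n w (z, P)"
      unfolding link_step_def fst_conv snd_conv
    proof (intro conjI allI impI)
      show "snd w < P" "s < P" using z(2) by auto
      show "z \<in> bowen_ball T (fst w) P (c * (1/2)^n)"
        using z(3) \<omega>(2) unfolding bowen_ball_def by fastforce
      fix j N assume j: "j < n" and N: "P \<le> N"
      have jF: "\<psi> j \<in> F" using j by (simp add: F_def)
      have "\<bar>periodic_average T (\<psi> j) u - a j\<bar> \<le> (1/2)^n"
        using u(2) [OF jF] \<omega>(3) zero_le_power [of "1/2 :: real" n] unfolding a_def by linarith
      then have "\<bar>birkhoff_sum T (\<psi> j) z N - real N * a j\<bar> \<le> ((1/2)^n + \<omega>) * real N"
        using w j by (intro zb [OF jF a1 _ _ N]) (auto simp: good_def)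
      also have "\<dots> \<le> 2 * (1/2)^n * real N"
        using \<omega>(3) zero_le_power [of "1/2 :: real" n] by (intro mult_right_mono) linarith+
      finally show "\<bar>birkhoff_sum T (\<psi> j) z N - real N * a j\<bar> \<le> 2 * (1/2)^n * real N" .
    qed
    ultimately show ?thesis by blast
  qed
  obtain w where w: "\<And>n. good n (w n)" "\<And>n. link_step n (w n) (w (Suc n))" "w 0 = (y, 0)"
  proof -
    have "\<exists>w. \<forall>n. (good n (w n) \<and> (n = 0 \<longrightarrow> w n = (y, 0))) \<and> link_step n (w n) (w (Suc n))"
      by (rule dependent_nat_choice) (use y stage in \<open>auto simp: good_def [of 0]\<close>)
    then show ?thesis using that by blast
  qed
  define z where "z n = fst (w n)" for n
  define p where "p n = snd (w (Suc n))" for n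
  have z0: "z 0 = y" using w(3) by (simp add: z_def)
  have p_mono: "p n < p (Suc n)" and p_s: "s < p n"
    and z_step: "i < p n \<Longrightarrow> dist ((T ^^ i) (z (Suc n))) ((T ^^ i) (z n)) < c * (1/2)^n"
    and z_birkhoff_sum: "j < n \<Longrightarrow> p n \<le> N \<Longrightarrow> \<bar>birkhoff_sum T (\<psi> j) (z (Suc n)) N - real N * a j\<bar> \<le> 2 * (1/2)^n * real N"
    for n i j N
    using w(2) [of n] w(2) [of "Suc n"] by (auto simp: link_step_def z_def p_def bowen_ball_def)
  have p_strict: "strict_mono p" using p_mono by (simp add: strict_mono_Suc_iff)
  have p_le: "p m \<le> p n" if "m \<le> n" for m n using p_strict that by (simp add: strict_mono_less_eq)
  have "Cauchy z"
  proof (rule geometric_steps_Cauchy [of c])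
    show "dist (z (Suc m)) (z m) \<le> c * (1/2)^m" for m
      using z_step [of 0 m] p_s [of m] by simp
  qed (use c in simp)
  then obtain x where x: "z \<longlonglongrightarrow> x" using Cauchy_convergent convergent_def by blast
  have contT: "continuous_on UNIV (T ^^ i)" for i
  proof (induction i)
    case (Suc i)
    show ?case using continuous_on_compose2 [OF T Suc] by (simp add: comp_def)
  qed (simp add: id_def)
  have shadow: "dist ((T ^^ i) x) ((T ^^ i) (z n)) \<le> 2 * c * (1/2)^n" if i: "i < p n" for i n
  proof -
    have "(\<lambda>m. (T ^^ i) (z m)) \<longlonglongrightarrow> (T ^^ i) x"
      using continuous_on_tendsto_compose [OF contT x] by simp
    then have "(\<lambda>k. (T ^^ i) (z (k + n))) \<longlonglongrightarrow> (T ^^ i) x" by (rule LIMSEQ_ignore_initial_segment)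
    then have "(\<lambda>k. dist ((T ^^ i) (z (k + n))) ((T ^^ i) (z n))) \<longlonglongrightarrow> dist ((T ^^ i) x) ((T ^^ i) (z n))"
      by (intro tendsto_intros)
    moreover have "dist ((T ^^ i) (z (k + n))) ((T ^^ i) (z n)) \<le> 2 * c * (1/2)^n" for k
    proof -
      have "dist ((T ^^ i) (z (n + k))) ((T ^^ i) (z n)) \<le> 2 * c * (1/2)^n - 2 * c * (1/2)^(n + k)"
      proof (rule geometric_steps_dist [of n "\<lambda>m. (T ^^ i) (z m)"])
        fix m assume "n \<le> m"
        then show "dist ((T ^^ i) (z (Suc m))) ((T ^^ i) (z m)) \<le> c * (1/2)^m"
          using z_step [of i m] i p_le [of n m] by simp
      qed
      moreover have "0 \<le> 2 * c * (1/2)^(n + k)" using c by simp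
      ultimately show ?thesis by (simp add: add.commute)
    qed
    ultimately show ?thesis by (intro LIMSEQ_le_const2) auto
  qed
  have avg: "(\<lambda>N. birkhoff_sum T (\<psi> j) x N / real N) \<longlonglongrightarrow> a j" for j
  proof (rule tendstoI)
    fix r :: real assume r: "r > 0"
    obtain \<theta> where \<theta>: "\<theta> > 0" "\<And>f x y. f \<in> {\<psi> j} \<Longrightarrow> dist x y < \<theta> \<Longrightarrow> \<bar>f x - f y\<bar> \<le> r / 4"
      by (rule finite_test_functions_modulus [of "{\<psi> j}" "r / 4"]) (use \<psi> r in auto)
    have "(\<lambda>n. b * (1/2)^n :: real) \<longlonglongrightarrow> b * 0" for b
      by (intro tendsto_mult tendsto_const LIMSEQ_power_zero) simp
    then have "\<forall>\<^sub>F n in sequentially. b * (1/2)^n < t" if "t > 0" for b t :: real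
      using that by (intro order_tendstoD(2)) auto
    then have "\<forall>\<^sub>F n in sequentially. 2 * c * (1/2)^n < \<theta> \<and> 2 * (1/2)^n < r / 4 \<and> j < n"
      using \<theta>(1) r by (intro eventually_conj eventually_gt_at_top) auto
    then obtain n1 where n1: "\<And>n. n1 \<le> n \<Longrightarrow> 2 * c * (1/2)^n < \<theta> \<and> 2 * (1/2)^n < r / 4 \<and> j < n"
      by (auto simp: eventually_sequentially)
    show "\<forall>\<^sub>F N in sequentially. dist (birkhoff_sum T (\<psi> j) x N / real N) (a j) < r"
      using eventually_ge_at_top [of "p n1"]
    proof eventually_elim
      case (elim N)
      have N0: "N > 0" using elim p_s [of n1] by linarith
      have "N < p (Suc N)" using strict_mono_imp_increasing [OF p_strict, of "Suc N"] by simp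
      \<comment> \<open>Minimality gives \<open>p n \<le> N < p k\<close> with
        \<open>k = Suc n\<close>: at time \<open>N\<close> the sums of \<open>z k\<close> are
        already controlled, and \<open>x\<close> still shadows \<open>z k\<close>.\<close>
      define k where "k = (LEAST k. N < p k)"
      have k: "N < p k" unfolding k_def by (rule LeastI) fact
      have kn: "n1 < k"
      proof (rule ccontr)
        assume "\<not> n1 < k"
        then have "p k \<le> p n1" using p_le by simp
        then show False using k elim by linarith
      qed
      then obtain n where n: "k = Suc n" by (cases k) auto
      have pn: "p n \<le> N" using not_less_Least [of n "\<lambda>k. N < p k"] n by (simp add: k_def [symmetric] not_less)
      have n1n: "n1 \<le> n" using kn n by simp
      have 1: "\<bar>birkhoff_sum T (\<psi> j) (z k) N - real N * a j\<bar> \<le> r / 4 * real N"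
      proof -
        have "\<bar>birkhoff_sum T (\<psi> j) (z k) N - real N * a j\<bar> \<le> 2 * (1/2)^n * real N"
          using z_birkhoff_sum [OF _ pn] n1 [OF n1n] n by simp
        also have "\<dots> \<le> r / 4 * real N" using n1 [OF n1n] by (intro mult_right_mono) auto
        finally show ?thesis .
      qed
      have 2: "\<bar>birkhoff_sum T (\<psi> j) x N - birkhoff_sum T (\<psi> j) (z k) N\<bar> \<le> r / 4 * real N"
      proof (rule birkhoff_sum_shadow)
        fix i assume "i < N"
        then have "dist ((T ^^ i) x) ((T ^^ i) (z k)) \<le> 2 * c * (1/2)^k" using k by (intro shadow) simp
        then have "dist ((T ^^ i) x) ((T ^^ i) (z k)) < \<theta>" using n1 [of k] kn by simp
        then show "\<bar>\<psi> j ((T ^^ i) x) - \<psi> j ((T ^^ i) (z k))\<bar> \<le> r / 4" by (intro \<theta>(2)) auto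
      qed
      have "birkhoff_sum T (\<psi> j) x N / real N - a j = (birkhoff_sum T (\<psi> j) x N - real N * a j) / real N"
        using N0 by (simp add: field_simps)
      also have "\<bar>\<dots>\<bar> \<le> r / 2"
      proof -
        have "\<bar>birkhoff_sum T (\<psi> j) x N - real N * a j\<bar> \<le> r / 2 * real N" using 1 2 by linarith
        then show ?thesis using N0 by (simp add: divide_le_eq)
      qed
      finally show ?case using r by (simp add: dist_real_def)
    qed
  qed
  show ?thesis
  proof (rule that [of x])
    show "generic T M ((T ^^ s) x)"
    proof (rule det [OF BM])
      fix j
      have "(\<lambda>N. birkhoff_sum T (\<psi> j) ((T ^^ s) x) N / real N - birkhoff_sum T (\<psi> j) x N / real N) \<longlonglongrightarrow> 0"
      proof (rule Lim_null_comparison)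
        show "\<forall>\<^sub>F N in sequentially. norm (birkhoff_sum T (\<psi> j) ((T ^^ s) x) N / real N - birkhoff_sum T (\<psi> j) x N / real N) \<le> 2 * real s / real N"
          using birkhoff_sum_funpow_diff [of "\<psi> j" T s x, OF \<psi>1]
          by (intro always_eventually allI) (simp add: divide_right_mono flip: diff_divide_distrib)
        show "(\<lambda>N. 2 * real s / real N) \<longlonglongrightarrow> 0" by (rule lim_const_over_n)
      qed
      from tendsto_add [OF this avg [of j]]
      show "(\<lambda>N. birkhoff_sum T (\<psi> j) ((T ^^ s) x) N / real N) \<longlonglongrightarrow> integral\<^sup>L M (\<psi> j)"
        by (simp add: a_def)
    qed
    show "dist ((T ^^ s) x) ((T ^^ s) y) \<le> e"
      using shadow [OF p_s [of 0]] by (simp add: z0 c_def)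
  qed
qed

theorem theorem6p2:
  fixes T :: "'a::polish_space \<Rightarrow> 'a" and K :: "'a set"
  assumes "continuous_on UNIV T" and "surj T"
    and "linkable T K" and "K_closeable T K"
    and "M \<in> invariant_measures T"
  shows "measure_center T \<subseteq> closure {x. generic T M x}"
proof
  fix x0 assume x0: "x0 \<in> measure_center T"
  show "x0 \<in> closure {x. generic T M x}"
    unfolding closure_approachable
  proof (intro allI impI)
    fix r :: real assume r: "r > 0"
    define h where "h = min r 1"
    have h: "0 < h" "h \<le> r" "h \<le> 1" using r by (auto simp: h_def)
    \<comment> \<open>The measure \<open>L\<close> may differ from \<open>M\<close>; it supplies a
      point of \<open>K\<close> whose orbit enters the ball, and this point is then linked towards
      \<open>M\<close>.\<close>
    obtain L where L: "L \<in> invariant_measures T" "measure L (ball x0 h) \<noteq> 0"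
    proof (rule ccontr)
      assume "\<not> thesis"
      then have "ball x0 h \<in> {U. open U \<and> (\<forall>L\<in>invariant_measures T. measure L U = 0)}"
        using that by auto
      moreover have "x0 \<in> ball x0 h" using h(1) by simp
      ultimately show False using x0 unfolding measure_center_def by blast
    qed
    interpret L: invariant_measure L T by (rule invariant_measureI [OF assms(1) L(1)])
    \<comment> \<open>The cone is positive exactly on \<open>ball x0 h\<close>, so a positive
      periodic average forces a visit to the ball; its height \<open>h \<le> 1\<close> makes it a
      test function.\<close>
    define f where "f x = max 0 (h - 1 * dist x x0)" for x
    have f: "test_function f" unfolding f_def using h by (intro test_function_cone) auto
    have fpos: "integral\<^sup>L L f > 0"
    proof -
      have fi: "integrable L f" using test_function_integrable(1) [OF _ f] L(1) by (simp add: invariant_measures_def)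
      have f0: "0 \<le> f x" for x by (simp add: f_def)
      have "integral\<^sup>L L f \<noteq> 0"
      proof
        assume "integral\<^sup>L L f = 0"
        then have "AE x in L. f x = 0" using integral_nonneg_eq_0_iff_AE [OF fi] f0 by simp
        then have "AE x in L. x \<notin> ball x0 h"
          by eventually_elim (auto simp: f_def dist_commute)
        then have "measure L (ball x0 h) = 0"
          using L.prob_eq_0 [of "ball x0 h"] by (simp add: L.sets_M)
        then show False using L(2) by simp
      qed
      then show ?thesis using Bochner_Integration.integral_nonneg [of L f] f0 by (simp add: less_le)
    qed
    obtain y where y: "y \<in> K" "\<bar>periodic_average T f y - integral\<^sup>L L f\<bar> \<le> integral\<^sup>L L f / 2"
      using periodic_average_approx [OF assms(1,3,4) L(1), of "{f}" "integral\<^sup>L L f / 2"] f fpos by auto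
    have "periodic_average T f y > 0" using y(2) fpos by linarith
    then have "\<exists>s. f ((T ^^ s) y) > 0"
    proof (rule contrapos_pp)
      assume "\<not> (\<exists>s. f ((T ^^ s) y) > 0)"
      then have "birkhoff_sum T f y n \<le> 0" for n
        unfolding birkhoff_sum_def by (intro sum_nonpos) (auto simp: not_less)
      then show "\<not> periodic_average T f y > 0"
        by (simp add: periodic_average_def not_less divide_nonpos_nonneg)
    qed
    then obtain s where s: "dist ((T ^^ s) y) x0 < h" by (auto simp: f_def less_max_iff_disj)
    define e where "e = (h - dist ((T ^^ s) y) x0) / 2"
    have e: "e > 0" using s by (simp add: e_def)
    obtain x where x: "generic T M ((T ^^ s) x)" "dist ((T ^^ s) x) ((T ^^ s) y) \<le> e"
      using generic_shadowing [OF assms(1,3,4,5) y(1) e] by blast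
    have "dist ((T ^^ s) x) x0 \<le> dist ((T ^^ s) x) ((T ^^ s) y) + dist ((T ^^ s) y) x0"
      by (rule dist_triangle)
    also have "\<dots> < h" using x(2) s by (simp add: e_def field_simps)
    finally show "\<exists>x\<in>{x. generic T M x}. dist x x0 < r"
      using x(1) h(2) by (intro bexI [of _ "(T ^^ s) x"]) auto
  qed
qed

end
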